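(* Let $P$ be any finite poset and let $\lambda=(\lambda_1,\dots,\lambda_r)$ be a partition of $|P|$. Then the number $\psi^\lambda(\mathrm{inc}(P))$ is equal to each of the following: (1) the number of cyclically row-semistrict $P$-tableaux of shape $\lambda$; (2) the number of $P$-record-free, row-semistrict $P$-tableaux of shape $\lambda$; (3) the number of disjoint cyclic vertex covers of $\mathrm{ngr}(P)$ of type $\lambda$; (4) the number of acyclic orientations $(O_1,\dots,O_r)$ of sequences $(\mathrm{inc}(P_{I_1}),\dots,\mathrm{inc}(P_{I_r}))\in\mathcal I_\lambda(\mathrm{inc}(P))$ in which each oriented component $O_i$ has exactly one source.
   Context: Let $n=|P|$. Trace evaluations at graphs: for a graph $G$ on $n$ vertices and $\lambda=(\lambda_1,\dots,\lambda_\ell)\vdash n$, let $c(G,\lambda)$ be the number of proper colorings of $G$ by positive integers in which exactly $\lambda_i$ vertices have color $i$ for $i=1,\dots,\ell$. Let $\epsilon^\lambda$ be the character of $\mathfrak S_n$ induced from the sign character of the Young subgroup $\mathfrak S_\lambda$; the $\epsilon^\lambda$ form a basis of the space of class functions. For a class function $\theta=\sum_{\lambda\vdash n}a_\lambda\epsilon^\lambda$ define $\theta(G)=\sum_{\lambda\vdash n}a_\lambda c(G,\lambda)$. The power sum trace $\psi^\lambda$ is the class function with $\psi^\lambda(w)=z_\lambda$ if $w$ has cycle type $\lambda$ and $\psi^\lambda(w)=0$ otherwise, where $z_\lambda=\lambda_1\cdots\lambda_r\,\alpha_1!\cdots\alpha_n!$ and $\alpha_i$ is the number of parts of $\lambda$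 equal to $i$. (Equivalently, $\omega X_G=\sum_\lambda \frac{\psi^\lambda(G)}{z_\lambda}p_\lambda$, where $X_G=\sum_\lambda c(G,\lambda)m_\lambda$ is Stanley's chromatic symmetric function, $m_\lambda$ and $p_\lambda$ are the monomial and power sum symmetric functions, and $\omega$ is the involutive automorphism of the ring of symmetric functions sending each elementary symmetric function $e_k$ to the complete homogeneous symmetric function $h_k$.) The incomparability graph $\mathrm{inc}(P)$ has vertex set $P$ and an edge $\{i,j\}$ for each incomparable pair. $P_I$ denotes the subposet induced by $I\subseteq P$. The directed graph $\mathrm{ngr}(P)$ has vertex set $P$ and edge set $\{(i,j)\in P^2: i\not>_P j\}$, including all loops $(i,i)$. A $P$-tableau of shape $\lambda$ is a filling of a Young diagram of shape $\lambda$ (with $\lambda_i$ boxes in row $i$) with the elements of $P$, one per box, each used exactly once; $U_{i,j}$ is the $j$th entry of row $i$. It is row-semistrict if $U_{i,j}\not>_P U_{i,j+1}$ for all horizontally adjacent entries; cyclically row-semistrict if it is row-semistrict and $U_{i,\lambda_i}\not>_P U_{i,1}$ for all $i$; $P$-record-free if there is no position $(i,j)$ with $j\neq 1$ such that all of $U_{i,1},\dots,U_{i,j-1}$ are less than $U_{i,j}$ in $P$. For a directed graph $D$ on $n$ vertices, a disjoint cyclic vertex cover of $D$ of type $\lambda$ is a sequence $(H_1,\dots,H_r)$ of vertex-disjoint subdigraphs of $D$ with $H_j$ isomorphic to the (directed) cycle graph $C_{\lambda_j}$ on $\lambda_j$ vertices for each $j$ (a loop if $\lambda_j=1$, a pair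 of opposite edges if $\lambda_j=2$). An ordered set partition of an $n$-element set of type $\lambda$ is a sequence $(I_1,\dots,I_r)$ of pairwise disjoint subsets with union the whole set and $|I_i|=\lambda_i$. $\mathcal I_\lambda(G)$ is the set of sequences $(G_{I_1},\dots,G_{I_r})$ of induced subgraphs of $G$ over all ordered set partitions of its vertex set of type $\lambda$. An acyclic orientation of such a sequence is a sequence $(O_1,\dots,O_r)$ with $O_j$ an acyclic orientation of $G_{I_j}$ (one direction for each edge, no directed cycle). A source is a vertex with indegree $0$.
   Formalization: In (3) each cover is counted with a chosen initial vertex in every cycle H_j, i.e. λ_1⋯λ_r times; the literal count fails for the two-element antichain and λ=(2), where ψ^λ(inc(P))=2 but ngr(P) has only one cyclic vertex cover of type (2). *)

theory Defs
  imports
    Complex_Main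
    "HOL-Library.FuncSet"
    "HOL-Library.Multiset"
    "HOL-Combinatorics.Permutations"
    "HOL-Combinatorics.Orbits"
    "HOL-Algebra.Sym_Groups"
    "Graph_Theory.Graph_Theory"
begin

section \<open>Partitions and class functions of the symmetric group\<close>

definition is_partition :: "nat list \<Rightarrow> nat \<Rightarrow> bool"  (infix \<open>\<turnstile>\<^sub>p\<close> 50) where
  "lam \<turnstile>\<^sub>p n \<longleftrightarrow> sorted_wrt (\<ge>) lam \<and> (\<forall>k\<in>set lam. 0 < k) \<and> sum_list lam = n"

definition young_block :: "nat list \<Rightarrow> nat \<Rightarrow> nat set" where
  "young_block lam i = {sum_list (take i lam) <.. sum_list (take (Suc i) lam)}"

definition young_subgroup :: "nat list \<Rightarrow> (nat \<Rightarrow> nat) set" where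
  "young_subgroup lam =
     {w \<in> carrier (sym_group (sum_list lam)).
        \<forall>i<length lam. w ` young_block lam i = young_block lam i}"

text \<open>The Frobenius formula for induction of a class function from a subgroup \<open>H\<close> of a
  finite group \<open>G\<close>.\<close>

definition induced_class_function ::
    "('g, 'm) monoid_scheme \<Rightarrow> 'g set \<Rightarrow> ('g \<Rightarrow> complex) \<Rightarrow> 'g \<Rightarrow> complex" where
  "induced_class_function G H \<chi> g =
     (\<Sum>x\<in>carrier G.
        if inv\<^bsub>G\<^esub> x \<otimes>\<^bsub>G\<^esub> g \<otimes>\<^bsub>G\<^esub> x \<in> H then \<chi> (inv\<^bsub>G\<^esub> x \<otimes>\<^bsub>G\<^esub> g \<otimes>\<^bsub>G\<^esub> x) else 0)
     / of_nat (card H)"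

definition induced_sign :: "nat list \<Rightarrow> (nat \<Rightarrow> nat) \<Rightarrow> complex" where
  "induced_sign lam =
     induced_class_function (sym_group (sum_list lam)) (young_subgroup lam)
       (\<lambda>w. of_int (sign w))"

definition cycle_type :: "nat \<Rightarrow> (nat \<Rightarrow> nat) \<Rightarrow> nat multiset" where
  "cycle_type n w = image_mset card (mset_set (orbit w ` {1..n}))"

definition z_number :: "nat list \<Rightarrow> nat" where
  "z_number lam = prod_list lam * (\<Prod>i=1..sum_list lam. fact (count_list lam i))"

definition power_sum_trace :: "nat list \<Rightarrow> (nat \<Rightarrow> nat) \<Rightarrow> complex" where
  "power_sum_trace lam w =
     (if cycle_type (sum_list lam) w = mset lam then of_nat (z_number lam) else 0)"


section \<open>Evaluating traces at graphs\<close>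

text \<open>Undirected simple graphs are represented as symmetric loop-free digraphs
  (\<open>pair_graph\<close>).\<close>

definition proper_colorings :: "'a pair_pre_digraph \<Rightarrow> nat list \<Rightarrow> ('a \<Rightarrow> nat) set" where
  "proper_colorings G lam =
     {\<kappa> \<in> pverts G \<rightarrow>\<^sub>E {1..}.
        (\<forall>(u, v)\<in>parcs G. \<kappa> u \<noteq> \<kappa> v) \<and>
        (\<forall>i<length lam. card {v \<in> pverts G. \<kappa> v = Suc i} = lam ! i)}"

definition coloring_count :: "'a pair_pre_digraph \<Rightarrow> nat list \<Rightarrow> nat" where
  "coloring_count G lam = card (proper_colorings G lam)"

definition induced_sign_expansion ::
    "nat \<Rightarrow> ((nat \<Rightarrow> nat) \<Rightarrow> complex) \<Rightarrow> (nat list \<Rightarrow> complex) \<Rightarrow> bool" where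
  "induced_sign_expansion n \<theta> a \<longleftrightarrow>
     (\<forall>w\<in>carrier (sym_group n). \<theta> w = (\<Sum>lam | lam \<turnstile>\<^sub>p n. a lam * induced_sign lam w))"

text \<open>The induced sign characters form a basis of the class functions of \<open>sym_group n\<close>. So for
  a class function \<open>\<theta>\<close> an expansion exists, and its coefficients are unique on the partitions
  of \<open>n\<close>, which are the only ones used in the sum: the choice below is immaterial.\<close>

definition trace_eval ::
    "((nat \<Rightarrow> nat) \<Rightarrow> complex) \<Rightarrow> 'a pair_pre_digraph \<Rightarrow> complex" where
  "trace_eval \<theta> G =
     (let n = card (pverts G); a = (SOME a. induced_sign_expansion n \<theta> a)
      in \<Sum>lam | lam \<turnstile>\<^sub>p n. a lam * of_nat (coloring_count G lam))"


section \<open>Graphs of a poset\<close>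

text \<open>A poset is a carrier \<open>P\<close> with its reflexive order \<open>r\<close>.\<close>

definition strictly_below :: "'a rel \<Rightarrow> 'a \<Rightarrow> 'a \<Rightarrow> bool" where
  "strictly_below r x y \<longleftrightarrow> (x, y) \<in> r \<and> x \<noteq> y"

definition inc :: "'a set \<Rightarrow> 'a rel \<Rightarrow> 'a pair_pre_digraph" where
  "inc P r = \<lparr> pverts = P,
     parcs = {(x, y) \<in> P \<times> P. (x, y) \<notin> r \<and> (y, x) \<notin> r} \<rparr>"

definition ngr :: "'a set \<Rightarrow> 'a rel \<Rightarrow> 'a pair_pre_digraph" where
  "ngr P r = \<lparr> pverts = P,
     parcs = {(x, y) \<in> P \<times> P. \<not> strictly_below r y x} \<rparr>"


section \<open>Tableaux\<close>

text \<open>A tableau is the list of its rows; \<open>U ! i ! j\<close> is the entry in row \<open>i\<close> and column \<open>j\<close>,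
  counted from 0.\<close>

definition tableau :: "'a set \<Rightarrow> nat list \<Rightarrow> 'a list list \<Rightarrow> bool" where
  "tableau P lam U \<longleftrightarrow>
     map length U = lam \<and> distinct (concat U) \<and> set (concat U) = P"

definition row_semistrict :: "'a rel \<Rightarrow> 'a list list \<Rightarrow> bool" where
  "row_semistrict r U \<longleftrightarrow>
     (\<forall>i<length U. \<forall>j. Suc j < length (U ! i) \<longrightarrow>
        \<not> strictly_below r (U ! i ! Suc j) (U ! i ! j))"

definition cyclically_row_semistrict :: "'a rel \<Rightarrow> 'a list list \<Rightarrow> bool" where
  "cyclically_row_semistrict r U \<longleftrightarrow>
     row_semistrict r U \<and>
     (\<forall>i<length U. \<not> strictly_below r (hd (U ! i)) (last (U ! i)))"

definition record_free :: "'a rel \<Rightarrow> 'a list list \<Rightarrow> bool" where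
  "record_free r U \<longleftrightarrow>
     \<not> (\<exists>i<length U. \<exists>j<length (U ! i). j \<noteq> 0 \<and>
          (\<forall>k<j. strictly_below r (U ! i ! k) (U ! i ! j)))"


section \<open>Cyclic vertex covers\<close>

definition directed_cycle :: "nat \<Rightarrow> nat pair_pre_digraph" where
  "directed_cycle k = \<lparr> pverts = {0..<k}, parcs = (\<lambda>i. (i, Suc i mod k)) ` {0..<k} \<rparr>"

text \<open>If \<open>lam\<close> is a partition of the number of vertices of \<open>D\<close>, disjointness already forces the
  cycles to cover all vertices.\<close>

definition disjoint_cyclic_vertex_cover ::
    "'a pair_pre_digraph \<Rightarrow> nat list \<Rightarrow> 'a pair_pre_digraph list \<Rightarrow> bool" where
  "disjoint_cyclic_vertex_cover D lam Hs \<longleftrightarrow>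
     list_all2 (\<lambda>H k. subgraph (with_proj H) (with_proj D) \<and>
                      digraph_iso (with_proj H) (with_proj (directed_cycle k))) Hs lam \<and>
     (\<forall>i<length Hs. \<forall>j<length Hs. i \<noteq> j \<longrightarrow> pverts (Hs ! i) \<inter> pverts (Hs ! j) = {})"

text \<open>For comparison with power sum traces a cycle has to be counted once for each way of placing
  the standard cycle on it, that is, once for each choice of its initial vertex. For the
  two-element antichain and the partition \<open>[2]\<close> the power sum trace is 2, whereas there is just
  one 2-cycle as a bare subdigraph. A cover \<open>Hs\<close> of type \<open>lam\<close> is thus counted
  \<open>prod_list lam\<close> times.\<close>

definition based_cyclic_vertex_covers ::
    "'a pair_pre_digraph \<Rightarrow> nat list \<Rightarrow> ('a pair_pre_digraph list \<times> 'a list) set" where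
  "based_cyclic_vertex_covers D lam =
     {(Hs, vs). disjoint_cyclic_vertex_cover D lam Hs \<and>
                list_all2 (\<lambda>H v. v \<in> pverts H) Hs vs}"


section \<open>Acyclic orientations of sequences of induced subgraphs\<close>

definition ordered_set_partition :: "'a set \<Rightarrow> nat list \<Rightarrow> 'a set list \<Rightarrow> bool" where
  "ordered_set_partition A lam Is \<longleftrightarrow>
     map card Is = lam \<and> \<Union> (set Is) = A \<and>
     (\<forall>i<length Is. \<forall>j<length Is. i \<noteq> j \<longrightarrow> Is ! i \<inter> Is ! j = {})"

definition induced_sequences ::
    "nat list \<Rightarrow> 'a pair_pre_digraph \<Rightarrow> 'a pair_pre_digraph list set" where
  "induced_sequences lam G =
     {Gs. \<exists>Is. ordered_set_partition (pverts G) lam Is \<and>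
        list_all2 (\<lambda>H I. pverts H = I \<and> induced_subgraph (with_proj H) (with_proj G)) Gs Is}"

definition acyclic_orientation :: "'a pair_pre_digraph \<Rightarrow> 'a pair_pre_digraph \<Rightarrow> bool" where
  "acyclic_orientation G Q \<longleftrightarrow>
     pverts Q = pverts G \<and> parcs Q \<subseteq> parcs G \<and>
     (\<forall>(u, v)\<in>parcs G. (u, v) \<in> parcs Q \<longleftrightarrow> (v, u) \<notin> parcs Q) \<and>
     acyclic (parcs Q)"

definition source :: "'a pair_pre_digraph \<Rightarrow> 'a \<Rightarrow> bool" where
  "source Q v \<longleftrightarrow> v \<in> pverts Q \<and> in_degree (with_proj Q) v = 0"

text \<open>The vertex sets of the components of \<open>Qs\<close> determine the sequence that is oriented, so
  counting the lists \<open>Qs\<close> counts pairs of a sequence and an orientation of it.\<close>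

definition single_source_orientations ::
    "'a set \<Rightarrow> 'a rel \<Rightarrow> nat list \<Rightarrow> 'a pair_pre_digraph list set" where
  "single_source_orientations P r lam =
     {Qs. (\<exists>Is. map (\<lambda>I. inc I (Restr r I)) Is \<in> induced_sequences lam (inc P r) \<and>
                list_all2 acyclic_orientation (map (\<lambda>I. inc I (Restr r I)) Is) Qs) \<and>
          (\<forall>Q\<in>set Qs. \<exists>!v. source Q v)}"

end

theory Submission
  imports Defs
begin

text \<open>Let \<open>A(w) = 1\<close> if \<open>w(m)\<close> is never below \<open>m\<close>, and \<open>A(w) = 0\<close> otherwise, where \<open>P\<close> is labelled by
  \<open>1, \<dots>, n\<close>. For an induced sign character \<open>\<epsilon>\<^sup>\<mu>\<close> the sum \<open>\<Sum>\<^sub>w \<epsilon>\<^sup>\<mu>(w) A(w)\<close> is an immanant, hence a sum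
  over ordered set partitions of products of principal minors. Such a minor is 1 on a chain and 0
  elsewhere, so the sum counts colorings of the incomparability graph. By linearity every
  trace \<open>\<theta>\<close> evaluates to \<open>\<Sum>\<^sub>w \<theta>(w) A(w)\<close>, whichever expansion of \<open>\<theta>\<close> is used. For a power sum trace this
  counts cyclically row-semistrict tableaux, because a permutation of cycle type \<open>\<lambda>\<close> can be
  written in \<open>z\<^sub>\<lambda>\<close> ways as a tableau whose rows are its cycles.

  The other counts are compared row by row. Recording for incomparable elements which one comes first
  turns semistrict rows into acyclic orientations, and records into sources. The number of
  orientations with a unique source does not depend on the source, and the number of cyclically
  semistrict rows does not depend on the first entry. If the first entry is maximal, then
  every semistrict row is both record-free and cyclically semistrict.\<close>

section \<open>Semistrict rows and acyclic orientations\<close>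

text \<open>\<open>trace_eval\<close> is defined by a \<open>SOME\<close> term, so it says nothing
  until an expansion of the class function is known to exist; hence the triangularity argument for
  induced signs at the end. No normalising factor survives in the resulting formula: an induced
  character divides by the order of the Young subgroup, and the relabellings belonging to one
  coloring form exactly one coset of it. On the combinatorial side, cyclically semistrict and
  record-free rows on the same set are not matched row by row. They are shown to agree only in
  number: both counts are split by the first entry, all classes of one splitting are equinumerous,
  and the two splittings share the class of a maximal element. Lists of blocks are therefore
  compared through arbitrarily chosen bijections, one for each block. Base points explain the
  product of the parts in \<open>z_number\<close>: a cycle of length \<open>k\<close> can be listed
  from any of its \<open>k\<close> elements, and the remaining factorials order the cycles of equal
  length.\<close>

definition rows :: "'a set \<Rightarrow> 'a list set" where
  "rows I = {xs. distinct xs \<and> set xs = I}"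

lemma finite_rows: "finite (rows I)"
proof (cases "finite I")
  case True
  have "rows I \<subseteq> {xs. set xs \<subseteq> I \<and> length xs = card I}"
    by (auto simp: rows_def distinct_card)
  then show ?thesis
    using finite_lists_length_eq[OF True] finite_subset by blast
next
  case False
  then have "rows I = {}" by (auto simp: rows_def)
  then show ?thesis by simp
qed

fun before :: "'a list \<Rightarrow> 'a rel" where
  "before [] = {}"
| "before (x # xs) = {x} \<times> set xs \<union> before xs"

lemma before_subset: "before xs \<subseteq> set xs \<times> set xs"
  by (induction xs) auto

lemma before_total:
  "x \<in> set xs \<Longrightarrow> y \<in> set xs \<Longrightarrow> x \<noteq> y \<Longrightarrow> (x, y) \<in> before xs \<or> (y, x) \<in> before xs"
  by (induction xs) auto

lemma before_append: "before (as @ bs) = before as \<union> set as \<times> set bs \<union> before bs"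
  by (induction as) auto

lemma acyclic_before: "distinct xs \<Longrightarrow> acyclic (before xs)"
proof (induction xs)
  case (Cons x xs)
  have "wf ({x} \<times> set xs \<union> before xs)"
  proof (rule wf_Un)
    show "wf (before xs)"
      using Cons before_subset[of xs] by (intro finite_acyclic_wf) (auto intro: finite_subset)
    have "acyclic ({x} \<times> set xs)"
      by (rule acyclicI_order[of _ "\<lambda>y. if y = x then 1 else 0 :: nat"]) (use Cons.prems in auto)
    then show "wf ({x} \<times> set xs)" by (intro finite_acyclic_wf) auto
    show "Domain ({x} \<times> set xs) \<inter> Range (before xs) = {}"
      using Cons.prems before_subset[of xs] by auto
  qed
  then show ?case by (simp add: wf_acyclic)
qed (simp add: acyclic_def)

lemma list_all2_rotate1: "list_all2 p xs ys \<Longrightarrow> list_all2 p (rotate1 xs) (rotate1 ys)"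
  by (cases xs; cases ys) (auto intro: list_all2_appendI)

lemma list_all2_rotate: "list_all2 p xs ys \<Longrightarrow> list_all2 p (rotate n xs) (rotate n ys)"
  by (induction n) (auto intro: list_all2_rotate1)

definition start_at :: "'a \<Rightarrow> 'a list \<Rightarrow> 'a list" where
  "start_at w xs = dropWhile (\<lambda>x. x \<noteq> w) xs @ takeWhile (\<lambda>x. x \<noteq> w) xs"

lemma start_at_append: "w \<notin> set as \<Longrightarrow> start_at w (as @ w # bs) = w # bs @ as"
  by (simp add: start_at_def dropWhile_append takeWhile_append)

locale strict_poset =
  fixes lt :: "'a \<Rightarrow> 'a \<Rightarrow> bool"  (infix \<open>\<prec>\<close> 50)
  assumes lt_irrefl: "\<not> x \<prec> x"
    and lt_trans: "x \<prec> y \<Longrightarrow> y \<prec> z \<Longrightarrow> x \<prec> z"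
begin

lemma lt_asym: "x \<prec> y \<Longrightarrow> \<not> y \<prec> x"
  using lt_irrefl lt_trans by blast

lemma ex_maximal:
  assumes "finite I" "I \<noteq> {}"
  shows "\<exists>m\<in>I. \<forall>x\<in>I. \<not> m \<prec> x"
  using assms
proof (induction rule: finite_ne_induct)
  case (singleton x)
  then show ?case using lt_irrefl by auto
next
  case (insert x F)
  then obtain m where m: "m \<in> F" "\<forall>y\<in>F. \<not> m \<prec> y" by blast
  show ?case
  proof (cases "m \<prec> x")
    case True
    then have "\<forall>y\<in>insert x F. \<not> x \<prec> y" using m lt_trans lt_irrefl by blast
    then show ?thesis by blast
  next
    case False
    then show ?thesis using m by blast
  qed
qed

definition comparable :: "'a \<Rightarrow> 'a \<Rightarrow> bool" where
  "comparable x y \<longleftrightarrow> x = y \<or> x \<prec> y \<or> y \<prec> x"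

lemma comparable_refl [simp]: "comparable x x"
  by (simp add: comparable_def)

lemma comparable_sym: "comparable x y \<longleftrightarrow> comparable y x"
  by (auto simp: comparable_def)

definition semistrict :: "'a list \<Rightarrow> bool" where
  "semistrict = successively (\<lambda>x y. \<not> y \<prec> x)"

text \<open>Comparison with \<open>rotate1\<close> treats all adjacent pairs alike, including the
  pair (last, first), so invariance under rotation needs no case distinction.\<close>

definition cyclically_semistrict :: "'a list \<Rightarrow> bool" where
  "cyclically_semistrict xs \<longleftrightarrow> list_all2 (\<lambda>x y. \<not> y \<prec> x) xs (rotate1 xs)"

text \<open>Splitting at the entry \<open>y\<close> matches the description of sources by prefixes
  in \<open>source_orient_iff\<close>.\<close>

definition no_record :: "'a list \<Rightarrow> bool" where
  "no_record xs \<longleftrightarrow> (\<forall>as y bs. xs = as @ y # bs \<longrightarrow> as \<noteq> [] \<longrightarrow> (\<exists>a\<in>set as. \<not> a \<prec> y))"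

text \<open>Swapping adjacent comparable entries leaves this orientation unchanged, so it is an
  invariant of a commutation class of lists. Semistrict lists turn out to be normal forms: every
  acyclic orientation comes from exactly one of them.\<close>

definition orient :: "'a list \<Rightarrow> 'a pair_pre_digraph" where
  "orient xs = \<lparr> pverts = set xs, parcs = {(x, y) \<in> before xs. \<not> comparable x y} \<rparr>"

definition incomparability :: "'a set \<Rightarrow> 'a pair_pre_digraph" where
  "incomparability I = \<lparr> pverts = I, parcs = {(x, y) \<in> I \<times> I. \<not> comparable x y} \<rparr>"

lemma acyclic_orientation_orient:
  assumes "xs \<in> rows I"
  shows "acyclic_orientation (incomparability I) (orient xs)"
proof -
  have xs: "distinct xs" "set xs = I" using assms by (auto simp: rows_def)
  have ac: "acyclic (before xs)" by (rule acyclic_before[OF xs(1)])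
  have asym: "(y, x) \<notin> before xs" if "(x, y) \<in> before xs" for x y
    using ac that unfolding acyclic_def
    by (meson r_into_trancl' trancl_into_trancl)
  have "acyclic {(x, y) \<in> before xs. \<not> comparable x y}"
    by (rule acyclic_subset[OF ac]) auto
  moreover have "(a, b) \<in> before xs \<longleftrightarrow> (b, a) \<notin> before xs"
    if "a \<in> set xs" "b \<in> set xs" "\<not> comparable a b" for a b
    using before_total[of a xs b] asym[of a b] that comparable_refl by blast
  ultimately show ?thesis
    using before_subset[of xs] xs comparable_sym
    unfolding acyclic_orientation_def orient_def incomparability_def
    by (simp add: split_beta) blast
qed

lemma acyclic_orientation_iff:
  "acyclic_orientation (incomparability I) Q \<longleftrightarrow>
     pverts Q = I \<and> parcs Q \<subseteq> I \<times> I \<and> acyclic (parcs Q) \<and>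
     (\<forall>u v. (u, v) \<in> parcs Q \<longrightarrow> \<not> comparable u v) \<and>
     (\<forall>u v. u \<in> I \<longrightarrow> v \<in> I \<longrightarrow> \<not> comparable u v \<longrightarrow> (u, v) \<in> parcs Q \<longleftrightarrow> (v, u) \<notin> parcs Q)"
  unfolding acyclic_orientation_def incomparability_def
  by (simp (no_asm) add: subset_iff Ball_def) blast

lemma source_iff:
  assumes "acyclic_orientation (incomparability I) Q" "finite I"
  shows "source Q v \<longleftrightarrow> v \<in> I \<and> (\<forall>u. (u, v) \<notin> parcs Q)"
proof -
  have "parcs Q \<subseteq> I \<times> I" "pverts Q = I"
    using assms by (auto simp: acyclic_orientation_def incomparability_def)
  \<comment> \<open>\<open>in_degree\<close> is a cardinality, and \<open>card\<close> is 0 on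
    infinite sets as well; finiteness turns in-degree 0 into the absence of incoming arcs.\<close>
  moreover from this have "finite (parcs Q)" using assms(2) finite_subset by blast
  ultimately show ?thesis
    by (auto simp: source_def in_degree_def in_arcs_def)
qed

lemma semistrict_Cons:
  "semistrict (x # xs) \<longleftrightarrow> semistrict xs \<and> (xs \<noteq> [] \<longrightarrow> \<not> hd xs \<prec> x)"
  by (auto simp: semistrict_def successively_Cons)

text \<open>If all predecessors of \<open>y\<close> are comparable to it, they cannot switch from above \<open>y\<close> to
  below \<open>y\<close> without a descent.\<close>

lemma semistrict_source_gt:
  assumes "semistrict (as @ y # bs)" "\<forall>a\<in>set as. comparable a y" "y \<notin> set as"
  shows "\<forall>a\<in>set as. a \<prec> y"
  using assms
proof (induction as)
  case (Cons a as)
  then have IH: "\<forall>a\<in>set as. a \<prec> y" by (auto simp: semistrict_Cons)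
  have "\<not> hd (as @ y # bs) \<prec> a" using Cons.prems(1) by (simp add: semistrict_Cons)
  moreover have "hd (as @ y # bs) = y \<or> hd (as @ y # bs) \<prec> y"
    using IH by (cases as) auto
  ultimately have "\<not> y \<prec> a" using lt_trans by auto
  then show ?case using Cons.prems IH by (auto simp: comparable_def)
qed simp

lemma orient_Cons:
  "x \<notin> set xs \<Longrightarrow> parcs (orient (x # xs)) = {(x, y) |y. y \<in> set xs \<and> \<not> comparable x y} \<union> parcs (orient xs)"
  by (auto simp: orient_def)

lemma orient_tl:
  assumes "x \<notin> set xs"
  shows "parcs (orient xs) = parcs (orient (x # xs)) - {x} \<times> UNIV"
proof -
  have "parcs (orient xs) \<subseteq> set xs \<times> set xs"
    using before_subset[of xs] by (auto simp: orient_def)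
  then show ?thesis unfolding orient_Cons[OF assms] using assms by blast
qed

lemma source_orient_iff:
  assumes "distinct (as @ y # bs)"
  shows "source (orient (as @ y # bs)) y \<longleftrightarrow> (\<forall>a\<in>set as. comparable a y)"
proof -
  let ?xs = "as @ y # bs"
  have "?xs \<in> rows (set ?xs)" using assms by (simp add: rows_def)
  then have "source (orient ?xs) y \<longleftrightarrow> (\<forall>u. (u, y) \<notin> parcs (orient ?xs))"
    using source_iff[OF acyclic_orientation_orient, of ?xs "set ?xs" y] by simp
  moreover have "(u, y) \<in> before ?xs \<longleftrightarrow> u \<in> set as" for u
  proof -
    have "y \<notin> set as" "y \<notin> set bs" using assms by auto
    then have "(u, y) \<notin> before as" "(u, y) \<notin> before bs" for u
      using before_subset[of as] before_subset[of bs] by blast+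
    with \<open>y \<notin> set bs\<close> show ?thesis by (simp add: before_append)
  qed
  then have "(u, y) \<in> parcs (orient ?xs) \<longleftrightarrow> u \<in> set as \<and> \<not> comparable u y" for u
    unfolding orient_def by simp
  ultimately have "source (orient ?xs) y \<longleftrightarrow> (\<forall>u. \<not> (u \<in> set as \<and> \<not> comparable u y))"
    by (simp only:)
  then show ?thesis by (simp add: Ball_def)
qed

text \<open>The head of a semistrict list is the least source of its orientation: any later source
  lies above all its predecessors, hence above the head. So the orientation determines the head, and
  deleting it allows induction.\<close>

lemma orient_inj:
  assumes "distinct xs" "distinct ys" "semistrict xs" "semistrict ys" "orient xs = orient ys"
  shows "xs = ys"
  using assms
proof (induction xs arbitrary: ys)
  case Nil
  then show ?case by (simp add: orient_def)
next
  case (Cons x xs)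
  have sets: "set (x # xs) = set ys" using Cons.prems(5) by (simp add: orient_def)
  then obtain y ys' where ys: "ys = y # ys'" by (cases ys) auto
  have d: "distinct (x # xs)" "distinct (y # ys')" "semistrict (x # xs)" "semistrict (y # ys')"
    and eq: "orient (x # xs) = orient (y # ys')"
    using Cons.prems ys by blast+
  have sx: "source (orient (x # xs)) x" using source_orient_iff[of "[]" x xs] d by simp
  have sy: "source (orient (y # ys')) y" using source_orient_iff[of "[]" y ys'] d by simp
  have key: "u \<prec> v" if "distinct (u # us)" "semistrict (u # us)" "v \<in> set us" "source (orient (u # us)) v" for u v us
  proof -
    obtain as bs where us: "us = as @ v # bs" using \<open>v \<in> set us\<close> by (meson split_list)
    have "\<forall>a\<in>set (u # as). comparable a v"
      using source_orient_iff[of "u # as" v bs] that us by simp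
    moreover have "v \<notin> set (u # as)" using that(1) us by auto
    ultimately show ?thesis using semistrict_source_gt[of "u # as" v bs] that(2) us by simp
  qed
  have "x = y"
  proof (rule ccontr)
    assume "x \<noteq> y"
    then have "y \<in> set xs" "x \<in> set ys'" using sets ys by auto
    then have "x \<prec> y" "y \<prec> x"
      using key[OF d(1,3)] key[OF d(2,4)] sx sy eq by metis+
    then show False using lt_asym by blast
  qed
  have "x \<notin> set xs" "y \<notin> set ys'" using d by simp_all
  then have "set xs = set ys'" using sets \<open>x = y\<close> ys by auto
  moreover have "parcs (orient xs) = parcs (orient ys')"
    using orient_tl[OF \<open>x \<notin> set xs\<close>] orient_tl[OF \<open>y \<notin> set ys'\<close>] eq \<open>x = y\<close> by metis
  ultimately have "orient xs = orient ys'"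
    by (simp add: orient_def)
  then have "xs = ys'" using Cons.IH d by (simp add: semistrict_Cons)
  then show ?case using ys \<open>x = y\<close> by simp
qed

text \<open>The sources of an orientation form a chain; listing a minimal source first never creates
  a descent.\<close>

lemma orient_surj:
  assumes "finite I" "acyclic_orientation (incomparability I) Q"
  shows "\<exists>xs\<in>rows I. semistrict xs \<and> orient xs = Q"
  using assms
proof (induction "card I" arbitrary: I Q)
  case 0
  then have "I = {}" by simp
  with 0 have "orient [] = Q"
    by (cases Q) (auto simp: orient_def acyclic_orientation_def incomparability_def)
  then show ?case using \<open>I = {}\<close> by (auto simp: rows_def semistrict_def)
next
  case (Suc k)
  have Q: "pverts Q = I" "parcs Q \<subseteq> I \<times> I" "acyclic (parcs Q)"
    and Qedge: "\<And>u v. (u, v) \<in> parcs Q \<Longrightarrow> \<not> comparable u v"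
    and Qtot: "\<And>u v. u \<in> I \<Longrightarrow> v \<in> I \<Longrightarrow> \<not> comparable u v \<Longrightarrow> (u, v) \<in> parcs Q \<longleftrightarrow> (v, u) \<notin> parcs Q"
    using Suc.prems(2) by (auto simp: acyclic_orientation_def incomparability_def)
  let ?S = "{v \<in> I. \<forall>u. (u, v) \<notin> parcs Q}"
  have wfQ: "wf (parcs Q)"
    using Q Suc.prems(1) by (intro finite_acyclic_wf) (auto intro: finite_subset)
  have "I \<noteq> {}" using Suc by auto
  then obtain v where "v \<in> I" "\<And>u. (u, v) \<in> parcs Q \<Longrightarrow> u \<notin> I"
    by (rule wfE_min'[OF wfQ]) blast
  then have "?S \<noteq> {}" using Q by auto
  have wfS: "wf {(x, y). x \<in> ?S \<and> y \<in> ?S \<and> x \<prec> y}"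
  proof (intro finite_acyclic_wf acyclicI_order[of _ "\<lambda>x. card {z \<in> I. x \<prec> z}"])
    show "finite {(x, y). x \<in> ?S \<and> y \<in> ?S \<and> x \<prec> y}"
      by (rule finite_subset[of _ "I \<times> I"]) (use Suc.prems in auto)
  next
    fix a b
    assume "(a, b) \<in> {(x, y). x \<in> ?S \<and> y \<in> ?S \<and> x \<prec> y}"
    then have "a \<prec> b" "b \<in> I" by auto
    then have "{z \<in> I. b \<prec> z} \<subset> {z \<in> I. a \<prec> z}" using lt_trans lt_irrefl by blast
    then show "card {z \<in> I. b \<prec> z} < card {z \<in> I. a \<prec> z}"
      using Suc.prems by (intro psubset_card_mono) auto
  qed
  obtain s where s: "s \<in> ?S" "\<And>u. u \<in> ?S \<Longrightarrow> \<not> u \<prec> s"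
  proof (rule wfE_min'[OF wfS \<open>?S \<noteq> {}\<close>])
    fix z assume "z \<in> ?S" "\<And>y. (y, z) \<in> {(x, y). x \<in> ?S \<and> y \<in> ?S \<and> x \<prec> y} \<Longrightarrow> y \<notin> ?S"
    then show thesis using that by blast
  qed
  \<comment> \<open>As a source, \<open>s\<close> has no incoming arcs, so removing the outgoing
    ones detaches it completely.\<close>
  let ?Q = "\<lparr>pverts = I - {s}, parcs = parcs Q - {s} \<times> UNIV\<rparr>"
  have "acyclic_orientation (incomparability (I - {s})) ?Q"
  proof -
    have "acyclic (parcs Q - {s} \<times> UNIV)" by (rule acyclic_subset[OF Q(3)]) auto
    moreover have "parcs Q - {s} \<times> UNIV \<subseteq> (I - {s}) \<times> (I - {s})" using Q s by auto
    moreover have "(u, v) \<in> parcs Q - {s} \<times> UNIV \<longleftrightarrow> (v, u) \<notin> parcs Q - {s} \<times> UNIV"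
      if "u \<in> I - {s}" "v \<in> I - {s}" "\<not> comparable u v" for u v
      using Qtot[of u v] that by blast
    ultimately show ?thesis
      unfolding acyclic_orientation_iff using Qedge by simp
  qed
  note aQ = this
  have "k = card (I - {s})" using Suc.hyps(2) s Suc.prems(1) by simp
  from Suc.hyps(1)[OF this _ aQ] obtain xs
    where xs: "xs \<in> rows (I - {s})" "semistrict xs" "orient xs = ?Q"
    using Suc.prems(1) by blast
  have sx: "s \<notin> set xs" "set xs = I - {s}" using xs by (auto simp: rows_def)
  \<comment> \<open>If the next entry were below \<open>s\<close>, it would be comparable to
    \<open>s\<close>, so no arc from \<open>s\<close> to it was deleted. It would then already be a
    source of \<open>Q\<close>, against the minimality of \<open>s\<close>.\<close>
  have "\<not> hd xs \<prec> s" if "xs \<noteq> []"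
  proof
    assume lt: "hd xs \<prec> s"
    have "source (orient xs) (hd xs)"
      using source_orient_iff[of "[]" "hd xs" "tl xs"] xs(1) that by (simp add: rows_def)
    then have "hd xs \<in> I - {s}" "\<forall>u. (u, hd xs) \<notin> parcs ?Q"
      using source_iff[OF aQ] Suc.prems(1) xs(3) by simp_all
    moreover have "(s, hd xs) \<notin> parcs Q" using lt Qedge by (auto simp: comparable_def)
    ultimately have "hd xs \<in> ?S" by auto
    with s(2) lt show False by blast
  qed
  then have "semistrict (s # xs)" using xs by (simp add: semistrict_Cons)
  moreover have "orient (s # xs) = Q"
  proof -
    have "parcs (orient (s # xs)) = {(s, y) |y. y \<in> I - {s} \<and> \<not> comparable s y} \<union> parcs ?Q"
      using orient_Cons[OF sx(1)] xs(3) sx(2) by simp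
    also have "\<dots> = parcs Q"
    proof (intro equalityI subsetI)
      fix e assume "e \<in> {(s, y) |y. y \<in> I - {s} \<and> \<not> comparable s y} \<union> parcs ?Q"
      then consider y where "e = (s, y)" "y \<in> I" "\<not> comparable s y" | "e \<in> parcs Q" by auto
      then show "e \<in> parcs Q"
      proof cases
        case (1 y)
        moreover have "(y, s) \<notin> parcs Q" using s(1) by blast
        ultimately show ?thesis using Qtot[of s y] s(1) by blast
      qed
    next
      fix e assume "e \<in> parcs Q"
      then show "e \<in> {(s, y) |y. y \<in> I - {s} \<and> \<not> comparable s y} \<union> parcs ?Q"
        using Q Qedge[of "fst e" "snd e"] s by (cases e) auto
    qed
    finally have "parcs (orient (s # xs)) = parcs Q" .
    moreover have "pverts (orient (s # xs)) = pverts Q" using Q(1) sx s by (auto simp: orient_def)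
    ultimately show ?thesis by simp
  qed
  ultimately show ?case using xs(1) s by (intro bexI[of _ "s # xs"]) (auto simp: rows_def)
qed

subsection \<open>Independence of the source and of the first entry\<close>

definition unique_source_orientations :: "'a set \<Rightarrow> 'a \<Rightarrow> 'a pair_pre_digraph set" where
  "unique_source_orientations I v =
     {Q. acyclic_orientation (incomparability I) Q \<and> (\<forall>u. source Q u \<longleftrightarrow> u = v)}"

definition one_source_orientations :: "'a set \<Rightarrow> 'a pair_pre_digraph set" where
  "one_source_orientations I =
     {Q. acyclic_orientation (incomparability I) Q \<and> (\<exists>!v. source Q v)}"

text \<open>Reversing all edges inside the set of vertices from which \<open>w\<close> can be reached moves a unique
  source to \<open>w\<close>. The set is the same when computed from the old source in the new orientation, so
  reversing again with the old source undoes the move.\<close>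

definition flip :: "'a \<Rightarrow> 'a pair_pre_digraph \<Rightarrow> 'a pair_pre_digraph" where
  "flip w Q = (let X = {x. (x, w) \<in> (parcs Q)\<^sup>*} in
     \<lparr> pverts = pverts Q,
       parcs = {(a, b) \<in> parcs Q. b \<notin> X} \<union> {(a, b). (b, a) \<in> parcs Q \<and> a \<in> X} \<rparr>)"

lemma
  assumes Q: "Q \<in> unique_source_orientations I v" and I: "finite I" "w \<in> I"
  shows flip_mem: "flip w Q \<in> unique_source_orientations I w"
    and flip_flip: "flip v (flip w Q) = Q"
proof -
  define E where "E = parcs Q"
  define X where "X = {x. (x, w) \<in> E\<^sup>*}"
  \<comment> \<open>\<open>X\<close> contains all predecessors of its elements, so an arc ending in
    \<open>X\<close> lies inside \<open>X\<close>; testing the end point alone identifies the arcs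
    to be reversed.\<close>
  define E' where "E' = {(a, b) \<in> E. b \<notin> X} \<union> {(a, b). (b, a) \<in> E \<and> a \<in> X}"
  have flip: "flip w Q = \<lparr>pverts = pverts Q, parcs = E'\<rparr>"
    unfolding flip_def E'_def X_def E_def by (simp add: Let_def)
  have ao: "acyclic_orientation (incomparability I) Q"
    using Q by (simp add: unique_source_orientations_def)
  have PV: "pverts Q = I" and EI: "E \<subseteq> I \<times> I" and acE: "acyclic E"
    and Einc: "\<And>a b. (a, b) \<in> E \<Longrightarrow> \<not> comparable a b"
    and Etot: "\<And>a b. a \<in> I \<Longrightarrow> b \<in> I \<Longrightarrow> \<not> comparable a b \<Longrightarrow> (a, b) \<in> E \<longleftrightarrow> (b, a) \<notin> E"
    using ao unfolding acyclic_orientation_iff E_def by blast+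
  have srcQ: "u = v" if "u \<in> I" "\<And>a. (a, u) \<notin> E" for u
    using that Q source_iff[OF ao I(1), of u] unfolding unique_source_orientations_def E_def by blast
  have srcv: "v \<in> I" "\<And>a. (a, v) \<notin> E"
    using Q source_iff[OF ao I(1), of v] unfolding unique_source_orientations_def E_def by blast+
  have finE: "finite E" using EI I(1) finite_subset by blast
  have wfE: "wf E" using acE finE by (simp add: finite_acyclic_wf)
  have down: "a \<in> X" if "(a, b) \<in> E" "b \<in> X" for a b
    using that unfolding X_def by (auto intro: converse_rtrancl_into_rtrancl)
  have XI: "X \<subseteq> I"
  proof
    fix x assume "x \<in> X"
    then have "(x, w) \<in> E\<^sup>*" by (simp add: X_def)
    then show "x \<in> I" using EI I(2) by (cases rule: converse_rtranclE) auto
  qed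
  \<comment> \<open>Walking backwards in \<open>E\<close> from \<open>x\<close> stays in
    \<open>X\<close> and can only stop at the unique source \<open>v\<close>; in \<open>E'\<close>
    this walk has become a forward path.\<close>
  have reach: "x \<in> X \<Longrightarrow> (x, v) \<in> E'\<^sup>*" for x
  proof (induction x rule: wf_induct_rule[OF wfE])
    case (1 x)
    show ?case
    proof (cases "x = v")
      case False
      then obtain a where a: "(a, x) \<in> E" using srcQ XI 1 by blast
      then have "a \<in> X" using down 1 by blast
      then have "(x, a) \<in> E'" using a 1 by (auto simp: E'_def)
      then show ?thesis using 1(1)[OF a \<open>a \<in> X\<close>] by (rule converse_rtrancl_into_rtrancl)
    qed simp
  qed
  have "w \<in> X" by (simp add: X_def)
  have "v \<in> X"
  proof -
    have "\<exists>y\<in>X. \<forall>a. (a, y) \<notin> E"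
    proof -
      obtain y where "y \<in> X" "\<And>a. (a, y) \<in> E \<Longrightarrow> a \<notin> X"
        using wfE_min'[OF wfE, of X] \<open>w \<in> X\<close> by blast
      then show ?thesis using down by blast
    qed
    then show ?thesis using srcQ XI by blast
  qed
  have X': "{x. (x, v) \<in> E'\<^sup>*} = X"
  proof
    show "X \<subseteq> {x. (x, v) \<in> E'\<^sup>*}" using reach by blast
    show "{x. (x, v) \<in> E'\<^sup>*} \<subseteq> X"
    proof
      fix x assume "x \<in> {x. (x, v) \<in> E'\<^sup>*}"
      then have "(x, v) \<in> E'\<^sup>*" by simp
      then show "x \<in> X"
        by (induction rule: converse_rtrancl_induct) (use \<open>v \<in> X\<close> in \<open>auto simp: E'_def\<close>)
    qed
  qed
  have wfE': "wf E'"
  proof -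
    \<comment> \<open>Reversed arcs start in \<open>X\<close> and kept arcs end outside it, so no
      kept arc is followed by a reversed one and the two parts cannot combine to a cycle.\<close>
    have "wf ({(a, b). (b, a) \<in> E \<and> a \<in> X} \<union> {(a, b) \<in> E. b \<notin> X})"
    proof (rule wf_Un)
      show "wf {(a, b). (b, a) \<in> E \<and> a \<in> X}"
        by (rule wf_subset[OF finite_acyclic_wf_converse[OF finE acE]]) auto
      show "wf {(a, b) \<in> E. b \<notin> X}" by (rule wf_subset[OF wfE]) auto
      show "Domain {(a, b). (b, a) \<in> E \<and> a \<in> X} \<inter> Range {(a, b) \<in> E. b \<notin> X} = {}" by auto
    qed
    then show ?thesis by (simp add: E'_def Un_commute)
  qed
  have E'I: "E' \<subseteq> I \<times> I" using EI by (auto simp: E'_def)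
  have E'tot: "(a, b) \<in> E' \<longleftrightarrow> (b, a) \<notin> E'" if ab: "a \<in> I" "b \<in> I" "\<not> comparable a b" for a b
    using Etot[OF ab] down[of a b] down[of b a] unfolding E'_def by blast
  have ao': "acyclic_orientation (incomparability I) (flip w Q)"
  proof -
    have "\<not> comparable a b" if "(a, b) \<in> E'" for a b
      using that Einc comparable_sym unfolding E'_def by blast
    then show ?thesis
      unfolding flip acyclic_orientation_iff
      using PV E'I E'tot wf_acyclic[OF wfE'] by simp
  qed
  \<comment> \<open>A vertex outside \<open>X\<close> keeps its incoming arcs, and it has one
    because it is not \<open>v\<close>. A vertex of \<open>X\<close> other than \<open>w\<close> has
    an arc towards \<open>w\<close>, which now points at it. An incoming arc at \<open>w\<close>
    would be the reversal of an arc closing a cycle of \<open>E\<close>.\<close>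
  have "u \<in> I \<and> (\<forall>a. (a, u) \<notin> E') \<longleftrightarrow> u = w" for u
  proof
    assume u: "u \<in> I \<and> (\<forall>a. (a, u) \<notin> E')"
    have "u \<in> X"
    proof (rule ccontr)
      assume "u \<notin> X"
      then have "u \<noteq> v" using \<open>v \<in> X\<close> by auto
      then obtain a where "(a, u) \<in> E" using srcQ u by blast
      then show False using u \<open>u \<notin> X\<close> by (auto simp: E'_def)
    qed
    then have "(u, w) \<in> E\<^sup>*" by (simp add: X_def)
    then show "u = w"
    proof (cases rule: converse_rtranclE)
      case (step y)
      then have "(y, u) \<in> E'" by (auto simp: E'_def X_def)
      then show ?thesis using u by blast
    qed simp
  next
    assume "u = w"
    have "(a, w) \<notin> E'" for a
    proof
      assume "(a, w) \<in> E'"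
      then have "(w, a) \<in> E" "(a, w) \<in> E\<^sup>*" using \<open>w \<in> X\<close> by (auto simp: E'_def X_def)
      then show False using acE by (meson acyclic_def rtrancl_into_trancl2)
    qed
    then show "u \<in> I \<and> (\<forall>a. (a, u) \<notin> E')" using \<open>u = w\<close> I by blast
  qed
  then show "flip w Q \<in> unique_source_orientations I w"
    unfolding unique_source_orientations_def
    using ao' source_iff[OF ao' I(1)] by (simp add: flip)
  have "{(a, b) \<in> E'. b \<notin> X} \<union> {(a, b). (b, a) \<in> E' \<and> a \<in> X} = E"
    using down unfolding E'_def by blast
  then show "flip v (flip w Q) = Q"
    unfolding flip by (simp add: flip_def X' E_def)
qed

lemma card_unique_source_orientations:
  assumes "finite I" "v \<in> I" "w \<in> I"
  shows "card (unique_source_orientations I v) = card (unique_source_orientations I w)"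
proof (rule bij_betw_same_card)
  show "bij_betw (flip w) (unique_source_orientations I v) (unique_source_orientations I w)"
    by (rule bij_betw_byWitness[where f' = "flip v"])
      (use flip_mem[OF _ assms(1)] flip_flip[OF _ assms(1)] assms(2,3) in blast)+
qed

lemma finite_acyclic_orientations:
  assumes "finite I"
  shows "finite {Q. acyclic_orientation (incomparability I) Q}"
proof -
  have "{Q. acyclic_orientation (incomparability I) Q}
      \<subseteq> (\<lambda>E. \<lparr>pverts = I, parcs = E\<rparr>) ` Pow (I \<times> I)"
  proof
    fix Q :: "'a pair_pre_digraph"
    assume "Q \<in> {Q. acyclic_orientation (incomparability I) Q}"
    then have "pverts Q = I" "parcs Q \<subseteq> I \<times> I"
      by (auto simp: acyclic_orientation_def incomparability_def)
    then have "Q = \<lparr>pverts = I, parcs = parcs Q\<rparr>" "parcs Q \<in> Pow (I \<times> I)" by simp_all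
    then show "Q \<in> (\<lambda>E. \<lparr>pverts = I, parcs = E\<rparr>) ` Pow (I \<times> I)" by (rule image_eqI)
  qed
  moreover have "finite ((\<lambda>E. \<lparr>pverts = I, parcs = E\<rparr>) ` Pow (I \<times> I))" using assms by simp
  ultimately show ?thesis by (rule finite_subset)
qed

lemma card_one_source_orientations:
  assumes "finite I" "v \<in> I"
  shows "card (one_source_orientations I) = card I * card (unique_source_orientations I v)"
proof -
  have src: "v \<in> I" if "Q \<in> unique_source_orientations I v" for Q v
    using that source_iff assms(1) unfolding unique_source_orientations_def by blast
  have "one_source_orientations I = (\<Union>v\<in>I. unique_source_orientations I v)"
  proof (intro equalityI subsetI)
    fix Q assume "Q \<in> one_source_orientations I"
    then obtain u where "Q \<in> unique_source_orientations I u"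
      unfolding one_source_orientations_def unique_source_orientations_def by blast
    then show "Q \<in> (\<Union>v\<in>I. unique_source_orientations I v)" using src by blast
  next
    fix Q assume "Q \<in> (\<Union>v\<in>I. unique_source_orientations I v)"
    then show "Q \<in> one_source_orientations I"
      unfolding one_source_orientations_def unique_source_orientations_def by auto
  qed
  moreover have "finite (unique_source_orientations I u)" for u
    using finite_acyclic_orientations[OF assms(1)]
    by (rule finite_subset[rotated]) (auto simp: unique_source_orientations_def)
  moreover have "unique_source_orientations I a \<inter> unique_source_orientations I b = {}" if "a \<noteq> b" for a b
    using that unfolding unique_source_orientations_def by blast
  ultimately have "card (one_source_orientations I) = (\<Sum>u\<in>I. card (unique_source_orientations I u))"
    using assms(1) by (simp add: card_UN_disjoint)
  also have "\<dots> = (\<Sum>u\<in>I. card (unique_source_orientations I v))"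
    using card_unique_source_orientations[OF assms(1) _ assms(2)] by (intro sum.cong) auto
  finally show ?thesis by simp
qed

section \<open>Records of a semistrict row as sources of its orientation\<close>

lemma source_orient_hd:
  assumes "distinct xs" "xs \<noteq> []"
  shows "source (orient xs) (hd xs)"
  using source_orient_iff[of "[]" "hd xs" "tl xs"] assms by simp

text \<open>In a semistrict list an entry whose predecessors are all comparable to it exceeds all of
  them (\<open>semistrict_source_gt\<close>). The sources are therefore the first entry and the
  records.\<close>

lemma no_record_iff:
  assumes "distinct xs" "semistrict xs" "xs \<noteq> []"
  shows "no_record xs \<longleftrightarrow> (\<forall>u. source (orient xs) u \<longleftrightarrow> u = hd xs)"
proof
  assume nr: "no_record xs"
  have "u = hd xs" if u: "source (orient xs) u" for u
  proof -
    have "u \<in> set xs" using u by (simp add: source_def orient_def)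
    then obtain as bs where xs: "xs = as @ u # bs" by (meson split_list)
    then have "\<forall>a\<in>set as. comparable a u" using source_orient_iff[of as u bs] assms u by simp
    then have "\<forall>a\<in>set as. a \<prec> u" using semistrict_source_gt[of as u bs] assms xs by simp
    then have "as = []" using nr xs unfolding no_record_def by blast
    then show ?thesis using xs by simp
  qed
  then show "\<forall>u. source (orient xs) u \<longleftrightarrow> u = hd xs" using source_orient_hd assms by blast
next
  assume R: "\<forall>u. source (orient xs) u \<longleftrightarrow> u = hd xs"
  show "no_record xs"
    unfolding no_record_def
  proof (intro allI impI)
    fix as y bs assume xs: "xs = as @ y # bs" and "as \<noteq> []"
    then have "y \<noteq> hd xs" using assms(1) by (cases as) auto
    then have "\<not> source (orient xs) y" using R by blast
    then obtain a where "a \<in> set as" "\<not> comparable a y" using source_orient_iff[of as y bs] xs assms(1) by blast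
    then show "\<exists>a\<in>set as. \<not> a \<prec> y" by (auto simp: comparable_def)
  qed
qed

text \<open>The properties are left open so that the counts with and without a prescribed source are
  both instances.\<close>

lemma bij_betw_orient:
  assumes "finite I" "\<And>xs. xs \<in> rows I \<Longrightarrow> semistrict xs \<Longrightarrow> p xs \<longleftrightarrow> q (orient xs)"
  shows "bij_betw orient {xs \<in> rows I. semistrict xs \<and> p xs}
           {Q. acyclic_orientation (incomparability I) Q \<and> q Q}"
  unfolding bij_betw_def
proof
  show "inj_on orient {xs \<in> rows I. semistrict xs \<and> p xs}"
    using orient_inj by (auto simp: inj_on_def rows_def)
  show "orient ` {xs \<in> rows I. semistrict xs \<and> p xs} =
      {Q. acyclic_orientation (incomparability I) Q \<and> q Q}"
  proof (intro equalityI subsetI)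
    fix Q assume "Q \<in> orient ` {xs \<in> rows I. semistrict xs \<and> p xs}"
    then show "Q \<in> {Q. acyclic_orientation (incomparability I) Q \<and> q Q}"
      using acyclic_orientation_orient assms(2) by blast
  next
    fix Q assume Q: "Q \<in> {Q. acyclic_orientation (incomparability I) Q \<and> q Q}"
    then obtain xs where "xs \<in> rows I" "semistrict xs" "orient xs = Q"
      using orient_surj[OF assms(1)] by blast
    then show "Q \<in> orient ` {xs \<in> rows I. semistrict xs \<and> p xs}"
      using assms(2) Q by blast
  qed
qed

lemma card_no_record_rows:
  assumes "finite I" "I \<noteq> {}"
  shows "card {xs \<in> rows I. semistrict xs \<and> no_record xs} = card (one_source_orientations I)"
  unfolding one_source_orientations_def
proof (rule bij_betw_same_card, rule bij_betw_orient[OF assms(1)])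
  fix xs assume "xs \<in> rows I" "semistrict xs"
  moreover from this have "distinct xs" "xs \<noteq> []" using assms by (auto simp: rows_def)
  ultimately have "no_record xs \<longleftrightarrow> (\<forall>u. source (orient xs) u \<longleftrightarrow> u = hd xs)"
    and "source (orient xs) (hd xs)"
    using no_record_iff[of xs] source_orient_hd[of xs] by auto
  then show "no_record xs \<longleftrightarrow> (\<exists>!v. source (orient xs) v)" by auto
qed

lemma card_no_record_rows_hd:
  assumes "finite I" "I \<noteq> {}"
  shows "card {xs \<in> rows I. semistrict xs \<and> no_record xs \<and> hd xs = v} =
    card (unique_source_orientations I v)"
  unfolding unique_source_orientations_def
proof (rule bij_betw_same_card, rule bij_betw_orient[OF assms(1)])
  fix xs assume "xs \<in> rows I" "semistrict xs"
  moreover from this have "distinct xs" "xs \<noteq> []" using assms by (auto simp: rows_def)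
  ultimately have "no_record xs \<longleftrightarrow> (\<forall>u. source (orient xs) u \<longleftrightarrow> u = hd xs)"
    and "source (orient xs) (hd xs)"
    using no_record_iff[of xs] source_orient_hd[of xs] by auto
  then show "no_record xs \<and> hd xs = v \<longleftrightarrow> (\<forall>u. source (orient xs) u \<longleftrightarrow> u = v)" by auto
qed

section \<open>Rotations of cyclically semistrict rows\<close>

lemma cyclically_semistrict_rotate:
  "cyclically_semistrict xs \<Longrightarrow> cyclically_semistrict (rotate n xs)"
  unfolding cyclically_semistrict_def
  using list_all2_rotate[of _ xs "rotate1 xs" n] by (simp add: rotate1_rotate_swap)

lemma cyclically_semistrict_iff:
  assumes "xs \<noteq> []"
  shows "cyclically_semistrict xs \<longleftrightarrow> semistrict xs \<and> \<not> hd xs \<prec> last xs"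
proof -
  have "list_all2 p (x # xs) (xs @ [y]) \<longleftrightarrow> successively p (x # xs) \<and> p (last (x # xs)) y" for p x y and xs :: "'a list"
    by (induction xs arbitrary: x) auto
  then show ?thesis using assms
    by (cases xs) (auto simp: cyclically_semistrict_def semistrict_def)
qed

text \<open>Rotating a row until it starts with \<open>w\<close> preserves the cyclic condition, and
  rotating it until it starts with \<open>v\<close> again is the inverse.\<close>

lemma card_cyclic_rows_hd:
  assumes "v \<in> I" "w \<in> I"
  shows "card {xs \<in> rows I. cyclically_semistrict xs \<and> hd xs = v} =
    card {xs \<in> rows I. cyclically_semistrict xs \<and> hd xs = w}"
proof -
  have *: "start_at w xs \<in> rows I \<and> cyclically_semistrict (start_at w xs) \<and> hd (start_at w xs) = w
      \<and> start_at v (start_at w xs) = xs"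
    if xs: "xs \<in> rows I" "cyclically_semistrict xs" "hd xs = v" and w: "w \<in> I" for xs v w
  proof -
    have d: "distinct xs" "set xs = I" using xs by (auto simp: rows_def)
    then obtain as bs where xs': "xs = as @ w # bs" using w by (meson split_list)
    with d have nw: "w \<notin> set as" "w \<notin> set bs" by auto
    have sa: "start_at w xs = w # bs @ as" using start_at_append[OF nw(1)] xs' by simp
    have "rotate (length as) xs = w # bs @ as" by (simp add: xs' rotate_append)
    then have "cyclically_semistrict (start_at w xs)"
      using cyclically_semistrict_rotate[OF xs(2)] sa by metis
    moreover have "start_at v (start_at w xs) = xs"
    proof (cases as)
      case Nil
      then have "v = w" using xs(3) xs' by simp
      then show ?thesis using sa xs' Nil start_at_append[of w "[]" bs] by simp
    next
      case (Cons a as')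
      then have "a = v" using xs(3) xs' by simp
      moreover have "a \<notin> set (w # bs)" using d xs' Cons by auto
      ultimately show ?thesis using start_at_append[of v "w # bs" as'] sa xs' Cons by simp
    qed
    moreover have "start_at w xs \<in> rows I" using d xs' sa by (auto simp: rows_def)
    ultimately show ?thesis using sa by simp
  qed
  show ?thesis
  proof (rule bij_betw_same_card)
    show "bij_betw (start_at w) {xs \<in> rows I. cyclically_semistrict xs \<and> hd xs = v}
        {xs \<in> rows I. cyclically_semistrict xs \<and> hd xs = w}"
      by (rule bij_betw_byWitness[where f' = "start_at v"]) (use * assms in blast)+
  qed
qed

lemma card_cyclic_rows:
  assumes "finite I" "v \<in> I"
  shows "card {xs \<in> rows I. cyclically_semistrict xs} =
    card I * card {xs \<in> rows I. cyclically_semistrict xs \<and> hd xs = v}"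
proof -
  let ?C = "\<lambda>v. {xs \<in> rows I. cyclically_semistrict xs \<and> hd xs = v}"
  have "{xs \<in> rows I. cyclically_semistrict xs} = (\<Union>v\<in>I. ?C v)"
  proof -
    have "hd xs \<in> I" if "xs \<in> rows I" for xs
      using that assms(2) hd_in_set[of xs] by (cases xs) (auto simp: rows_def)
    then show ?thesis by blast
  qed
  moreover have "finite (?C u)" for u using finite_rows[of I] by simp
  ultimately have "card {xs \<in> rows I. cyclically_semistrict xs} = (\<Sum>u\<in>I. card (?C u))"
    using assms(1) by (subst card_UN_disjoint[symmetric]) auto
  also have "\<dots> = (\<Sum>u\<in>I. card (?C v))"
    using card_cyclic_rows_hd[OF _ assms(2)] by (intro sum.cong) auto
  finally show ?thesis by simp
qed

text \<open>For a row starting at a maximal element both conditions are void.\<close>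

lemma card_cyclic_rows_eq_one_source:
  assumes "finite I" "I \<noteq> {}"
  shows "card {xs \<in> rows I. cyclically_semistrict xs} = card (one_source_orientations I)"
proof -
  obtain m where m: "m \<in> I" "\<And>x. x \<in> I \<Longrightarrow> \<not> m \<prec> x"
    using ex_maximal[OF assms] by blast
  have "{xs \<in> rows I. cyclically_semistrict xs \<and> hd xs = m} =
      {xs \<in> rows I. semistrict xs \<and> no_record xs \<and> hd xs = m}"
  proof -
    have "(cyclically_semistrict xs \<and> hd xs = m) = (semistrict xs \<and> no_record xs \<and> hd xs = m)"
      if "xs \<in> rows I" for xs
    proof -
    from that have xs: "set xs = I" "xs \<noteq> []" using assms by (auto simp: rows_def)
    have "no_record xs \<and> \<not> hd xs \<prec> last xs" if "hd xs = m"
    proof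
      show "no_record xs"
        unfolding no_record_def
      proof (intro allI impI)
        fix as y bs assume "xs = as @ y # bs" "as \<noteq> []"
        then have "m \<in> set as" "y \<in> I" using that xs by auto
        then show "\<exists>a\<in>set as. \<not> a \<prec> y" using m by blast
      qed
      show "\<not> hd xs \<prec> last xs" using that m xs last_in_set by metis
    qed
    then show ?thesis
      using cyclically_semistrict_iff[OF xs(2)] by blast
    qed
    then show ?thesis by blast
  qed
  \<comment> \<open>Both totals are \<open>card I\<close> times the size of the class with first
    entry, respectively source, \<open>m\<close>.\<close>
  then show ?thesis
    using card_cyclic_rows[OF assms(1) m(1)] card_one_source_orientations[OF assms(1) m(1)]
      card_no_record_rows_hd[OF assms] by simp
qed

end

section \<open>Sequences of structures on the blocks of an ordered set partition\<close>

definition pairwise_disjoint_list :: "'a set list \<Rightarrow> bool" where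
  "pairwise_disjoint_list Is \<longleftrightarrow>
     (\<forall>i<length Is. \<forall>j<length Is. i \<noteq> j \<longrightarrow> Is ! i \<inter> Is ! j = {})"

lemma pairwise_disjoint_list_Nil [simp]: "pairwise_disjoint_list []"
  by (simp add: pairwise_disjoint_list_def)

lemma pairwise_disjoint_list_Cons [simp]:
  "pairwise_disjoint_list (I # Is) \<longleftrightarrow> pairwise_disjoint_list Is \<and> (\<forall>J\<in>set Is. I \<inter> J = {})"
  unfolding pairwise_disjoint_list_def
  by (simp add: All_less_Suc2 all_set_conv_all_nth Int_commute) blast

lemma ordered_set_partition_alt:
  "ordered_set_partition A lam Is \<longleftrightarrow>
     map card Is = lam \<and> \<Union> (set Is) = A \<and> pairwise_disjoint_list Is"
  by (simp add: ordered_set_partition_def pairwise_disjoint_list_def)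

lemma distinct_concat_pairwise:
  "distinct (concat U) \<longleftrightarrow> (\<forall>row\<in>set U. distinct row) \<and> pairwise_disjoint_list (map set U)"
  by (induction U) auto

lemma card_Union_pairwise_disjoint_list:
  "pairwise_disjoint_list Is \<Longrightarrow> \<forall>I\<in>set Is. finite I \<Longrightarrow> card (\<Union> (set Is)) = sum_list (map card Is)"
proof (induction Is)
  case (Cons I Is)
  then have "I \<inter> \<Union> (set Is) = {}" by auto
  with Cons show ?case by (simp add: card_Un_disjoint)
qed simp

text \<open>Common form of tableaux, based covers and sequences of orientations: \<open>s\<close>
  gives the support of an object and \<open>Q\<close> is a condition on each object alone. Two
  families of this form can be compared support by support.\<close>

definition structures :: "('b \<Rightarrow> 'a set) \<Rightarrow> ('b \<Rightarrow> bool) \<Rightarrow> 'a set \<Rightarrow> nat list \<Rightarrow> 'b list set" where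
  "structures s Q A lam = {us. ordered_set_partition A lam (map s us) \<and> (\<forall>u\<in>set us. Q u)}"

lemma structures_support:
  assumes "us \<in> structures s Q A lam" "u \<in> set us" "\<forall>k\<in>set lam. 0 < k"
  shows "s u \<subseteq> A" "finite (s u)" "s u \<noteq> {}" "Q u"
proof -
  have "card (s u) \<in> set lam" "s u \<subseteq> A" "Q u"
    using assms(1,2) unfolding structures_def ordered_set_partition_def by auto
  then have "0 < card (s u)" using assms(3) by blast
  then show "finite (s u)" "s u \<noteq> {}" by (auto simp: card_gt_0_iff)
  show "s u \<subseteq> A" "Q u" by fact+
qed

text \<open>A bijection is chosen for every possible support and applied to each entry; supports do
  not move, so the partition into blocks is kept. Positive parts exclude the empty support, on which
  counts may differ: the empty row is cyclically semistrict, but the empty graph has no source.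
  Finiteness is what turns equal cardinalities into bijections.\<close>

lemma card_structures_eq:
  fixes s :: "'b \<Rightarrow> 'a set" and t :: "'c \<Rightarrow> 'a set"
  assumes pos: "\<forall>k\<in>set lam. 0 < k"
    and fin: "\<And>I. I \<subseteq> A \<Longrightarrow> finite I \<Longrightarrow> I \<noteq> {} \<Longrightarrow> finite {u. s u = I \<and> Q u}"
      "\<And>I. I \<subseteq> A \<Longrightarrow> finite I \<Longrightarrow> I \<noteq> {} \<Longrightarrow> finite {u. t u = I \<and> R u}"
    and eq: "\<And>I. I \<subseteq> A \<Longrightarrow> finite I \<Longrightarrow> I \<noteq> {} \<Longrightarrow> card {u. s u = I \<and> Q u} = card {u. t u = I \<and> R u}"
  shows "card (structures s Q A lam) = card (structures t R A lam)"
proof -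
  have "\<exists>f. bij_betw f {u. s u = I \<and> Q u} {u. t u = I \<and> R u}"
    if "I \<subseteq> A" "finite I" "I \<noteq> {}" for I
    using finite_same_card_bij[OF fin(1)[OF that] fin(2)[OF that] eq[OF that]] .
  then obtain F where F: "\<And>I. I \<subseteq> A \<Longrightarrow> finite I \<Longrightarrow> I \<noteq> {} \<Longrightarrow>
      bij_betw (F I) {u. s u = I \<and> Q u} {u. t u = I \<and> R u}"
    by metis
  \<comment> \<open>Since \<open>t (f u) = s u\<close>, the inverse \<open>g\<close> finds the
    bijection that was used by looking at the support of the image.\<close>
  define f where "f u = F (s u) u" for u
  define g where "g u = inv_into {v. s v = t u \<and> Q v} (F (t u)) u" for u
  have f: "t (f u) = s u \<and> R (f u) \<and> g (f u) = u"
    if "s u \<subseteq> A" "finite (s u)" "s u \<noteq> {}" "Q u" for u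
  proof -
    have "f u \<in> {v. t v = s u \<and> R v}"
      using bij_betwE[OF F[OF that(1-3)]] that(4) by (auto simp: f_def)
    moreover from this have "g (f u) = u"
      using bij_betw_inv_into_left[OF F[OF that(1-3)], of u] that(4) by (auto simp: f_def g_def)
    ultimately show ?thesis by simp
  qed
  have g: "s (g u) = t u \<and> Q (g u) \<and> f (g u) = u"
    if "t u \<subseteq> A" "finite (t u)" "t u \<noteq> {}" "R u" for u
  proof -
    have "g u \<in> {v. s v = t u \<and> Q v}"
      using bij_betwE[OF bij_betw_inv_into[OF F[OF that(1-3)]]] that(4) by (auto simp: g_def)
    moreover from this have "f (g u) = u"
      using bij_betw_inv_into_right[OF F[OF that(1-3)], of u] that(4) by (auto simp: f_def g_def)
    ultimately show ?thesis by simp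
  qed
  have F': "t (f u) = s u" "R (f u)" "g (f u) = u"
    if "us \<in> structures s Q A lam" "u \<in> set us" for u us
    using f structures_support[OF that pos] by blast+
  have G': "s (g u) = t u" "Q (g u)" "f (g u) = u"
    if "us \<in> structures t R A lam" "u \<in> set us" for u us
    using g structures_support[OF that pos] by blast+
  show ?thesis
  proof (rule bij_betw_same_card)
    show "bij_betw (map f) (structures s Q A lam) (structures t R A lam)"
    proof (rule bij_betw_byWitness[where f' = "map g"])
      show "\<forall>us\<in>structures s Q A lam. map g (map f us) = us"
        using F'(3) by (auto simp: map_idI)
      show "\<forall>us\<in>structures t R A lam. map f (map g us) = us"
        using G'(3) by (auto simp: map_idI)
      show "map f ` structures s Q A lam \<subseteq> structures t R A lam"
      proof
        fix vs assume "vs \<in> map f ` structures s Q A lam"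
        then obtain us where us: "us \<in> structures s Q A lam" "vs = map f us" by blast
        then have "map t vs = map s us" "\<forall>v\<in>set vs. R v" using F' by auto
        then show "vs \<in> structures t R A lam" using us(1) by (simp add: structures_def)
      qed
      show "map g ` structures t R A lam \<subseteq> structures s Q A lam"
      proof
        fix vs assume "vs \<in> map g ` structures t R A lam"
        then obtain us where us: "us \<in> structures t R A lam" "vs = map g us" by blast
        then have "map s vs = map t us" "\<forall>v\<in>set vs. Q v" using G' by auto
        then show "vs \<in> structures s Q A lam" using us(1) by (simp add: structures_def)
      qed
    qed
  qed
qed

lemma tableau_structures:
  "{U. tableau A lam U \<and> (\<forall>row\<in>set U. p row)} = structures set (\<lambda>row. distinct row \<and> p row) A lam"
proof -
  have "map length U = map (card \<circ> set) U" if "\<forall>row\<in>set U. distinct row" for U :: "'a list list"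
    using that by (auto simp: distinct_card)
  note len = this
  have "tableau A lam U \<and> (\<forall>row\<in>set U. p row) \<longleftrightarrow>
      ordered_set_partition A lam (map set U) \<and> (\<forall>row\<in>set U. distinct row \<and> p row)" for U
  proof (cases "\<forall>row\<in>set U. distinct row")
    case True
    have "set (concat U) = \<Union> (set (map set U))" "map card (map set U) = map (card \<circ> set) U"
      by simp_all
    then show ?thesis
      unfolding tableau_def ordered_set_partition_alt distinct_concat_pairwise
      using len[OF True] True by metis
  next
    case False
    then show ?thesis unfolding tableau_def distinct_concat_pairwise by blast
  qed
  then show ?thesis unfolding structures_def by blast
qed

text \<open>For a nonempty distinct list this says that it is a cycle of \<open>w\<close>, written
  from some starting point.\<close>

definition rotation_of :: "('a \<Rightarrow> 'a) \<Rightarrow> 'a list \<Rightarrow> bool" where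
  "rotation_of w xs \<longleftrightarrow> map w xs = rotate1 xs"

lemma rotation_of_funpow:
  assumes "rotation_of w xs"
  shows "map (w ^^ k) xs = rotate k xs"
proof (induction k)
  case (Suc k)
  have "map (w ^^ Suc k) xs = map w (map (w ^^ k) xs)" by simp
  also have "\<dots> = map w (rotate k xs)" by (simp only: Suc)
  also have "\<dots> = rotate k (rotate1 xs)" using assms by (simp add: rotation_of_def flip: rotate_map)
  finally show ?case by (simp add: rotate1_rotate_swap comp_def)
qed (simp add: map_idI)

lemma rotation_of_nth:
  assumes "rotation_of w xs" "i < length xs"
  shows "xs ! i = (w ^^ i) (hd xs)"
proof -
  have "xs \<noteq> []" using assms(2) by auto
  have "map (w ^^ i) xs ! 0 = rotate i xs ! 0" by (simp only: rotation_of_funpow[OF assms(1)])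
  then show ?thesis using assms(2) \<open>xs \<noteq> []\<close> by (simp add: nth_rotate hd_conv_nth)
qed

lemma rotation_of_unique:
  assumes "rotation_of w xs" "rotation_of w ys" "length xs = length ys" "hd xs = hd ys"
  shows "xs = ys"
proof (rule nth_equalityI)
  fix i assume i: "i < length xs"
  then show "xs ! i = ys ! i"
    using rotation_of_nth[OF assms(1) i] rotation_of_nth[OF assms(2)] assms(3,4) by simp
qed fact

section \<open>Cycle digraphs and their listings\<close>

definition cycle_graph :: "'a list \<Rightarrow> 'a pair_pre_digraph" where
  "cycle_graph xs = \<lparr> pverts = set xs, parcs = set (zip xs (rotate1 xs)) \<rparr>"

lemma cycle_graph_rotate: "cycle_graph (rotate n xs) = cycle_graph xs"
proof (induction n)
  case (Suc n)
  have "set (zip (rotate1 xs) (rotate1 (rotate1 xs))) = set (zip xs (rotate1 xs))" for xs :: "'a list"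
  proof -
    have "zip (rotate1 xs) (rotate1 ys) = rotate1 (zip xs ys)" if "length xs = length ys" for ys
      using that by (cases xs; cases ys) auto
    from this[of "rotate1 xs"] show ?thesis by simp
  qed
  then have "cycle_graph (rotate1 xs) = cycle_graph xs" for xs :: "'a list"
    by (simp add: cycle_graph_def)
  then show ?case using Suc by simp
qed simp

lemma parcs_cycle_graph:
  "parcs (cycle_graph xs) = (\<lambda>i. (xs ! i, xs ! (Suc i mod length xs))) ` {0..<length xs}"
  by (auto simp: cycle_graph_def set_zip nth_rotate1)

lemma parcs_cycle_graph_subset: "parcs (cycle_graph xs) \<subseteq> set xs \<times> set xs"
  by (auto simp: cycle_graph_def dest: set_zip_leftD set_zip_rightD)

text \<open>Both lists follow the successor function given by the arcs, so each consists of its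
  iterates from the common head.\<close>

lemma cycle_graph_inj:
  assumes "distinct xs" "distinct ys" "cycle_graph xs = cycle_graph ys" "hd xs = hd ys"
  shows "xs = ys"
proof (rule rotation_of_unique)
  define w where "w x = the (map_of (zip xs (rotate1 xs)) x)" for x
  have w: "w x = y" if "(x, y) \<in> set (zip xs (rotate1 xs))" for x y
    using that assms(1) by (simp add: w_def)
  have rot: "rotation_of w zs" if "\<And>x y. (x, y) \<in> set (zip zs (rotate1 zs)) \<Longrightarrow> w x = y" for zs
    unfolding rotation_of_def
  proof (rule nth_equalityI)
    fix i assume i: "i < length (map w zs)"
    then have "(zs ! i, rotate1 zs ! i) \<in> set (zip zs (rotate1 zs))"
      by (auto simp: set_zip intro!: exI[of _ i])
    then show "map w zs ! i = rotate1 zs ! i" using that i by simp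
  qed simp
  show "rotation_of w xs" using rot w by blast
  have "set (zip ys (rotate1 ys)) = set (zip xs (rotate1 xs))" "set ys = set xs"
    using assms(3) by (simp_all add: cycle_graph_def)
  then show "rotation_of w ys" using rot w by blast
  show "length xs = length ys"
    using \<open>set ys = set xs\<close> assms(1,2) distinct_card by metis
qed fact

lemma digraph_iso_cycle_graph:
  assumes "distinct xs"
  shows "digraph_iso (with_proj (cycle_graph xs)) (with_proj (directed_cycle (length xs)))"
proof -
  define n where "n = inv_into {0..<length xs} (nth xs)"
  have inj: "inj_on (nth xs) {0..<length xs}" using assms by (simp add: inj_on_nth)
  have n: "n (xs ! i) = i" if "i < length xs" for i
    using inv_into_f_f[OF inj] that by (simp add: n_def)
  have injn: "inj_on n (set xs)"
    unfolding n_def by (rule inj_on_inv_into) (auto simp: set_conv_nth)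
  note sub = parcs_cycle_graph_subset[of xs]
  define f where "f = \<lparr>iso_verts = n, iso_arcs = map_prod n n, iso_head = snd, iso_tail = fst\<rparr>"
  have wf: "wf_digraph (with_proj (cycle_graph xs))"
    using sub by unfold_locales (auto simp: cycle_graph_def)
  have "inj_on (map_prod n n) (parcs (cycle_graph xs))"
    using map_prod_inj_on[OF injn injn] sub by (rule inj_on_subset)
  then have "pre_digraph.digraph_isomorphism (with_proj (cycle_graph xs)) f"
    unfolding pre_digraph.digraph_isomorphism_def using wf injn by (simp add: f_def cycle_graph_def)
  moreover have "with_proj (directed_cycle (length xs)) = app_iso f (with_proj (cycle_graph xs))"
  proof -
    have "n ` set xs = {0..<length xs}"
      using n by (force simp: set_conv_nth image_iff)
    moreover have "map_prod n n ` parcs (cycle_graph xs) =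
        (\<lambda>i. (i, Suc i mod length xs)) ` {0..<length xs}"
      unfolding parcs_cycle_graph image_image
    proof (intro image_cong refl)
      fix i assume "i \<in> {0..<length xs}"
      then have "i < length xs" "Suc i mod length xs < length xs"
        by (auto intro: mod_less_divisor)
      then show "map_prod n n (xs ! i, xs ! (Suc i mod length xs)) = (i, Suc i mod length xs)"
        using n by simp
    qed
    ultimately show ?thesis
      by (simp add: app_iso_def with_proj_def directed_cycle_def f_def)
         (simp add: cycle_graph_def)
  qed
  ultimately show ?thesis unfolding digraph_iso_def by blast
qed

text \<open>The vertices are listed in the order of the standard cycle, and the list is then rotated
  to begin at \<open>v\<close>, which leaves its graph unchanged.\<close>

lemma digraph_iso_directed_cycle:
  assumes "digraph_iso (with_proj H) (with_proj (directed_cycle k))" and v: "v \<in> pverts H"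
    and wf: "wf_digraph (with_proj H)"
  shows "\<exists>xs. distinct xs \<and> length xs = k \<and> hd xs = v \<and> cycle_graph xs = H"
proof -
  obtain f where iso: "pre_digraph.digraph_isomorphism (with_proj H) f"
    and app: "with_proj (directed_cycle k) = app_iso f (with_proj H)"
    using assms(1) unfolding digraph_iso_def by blast
  define n where "n = iso_verts f"
  have inj: "inj_on n (pverts H)"
    using iso by (simp add: pre_digraph.digraph_isomorphism_def n_def)
  have V: "n ` pverts H = {0..<k}"
    and E: "iso_arcs f ` parcs H = (\<lambda>i. (i, Suc i mod k)) ` {0..<k}"
    and ht: "iso_tail f = fst" "iso_head f = snd"
  proof -
    have "verts (with_proj (directed_cycle k)) = n ` pverts H"
      "arcs (with_proj (directed_cycle k)) = iso_arcs f ` parcs H"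
      "tail (with_proj (directed_cycle k)) = iso_tail f"
      "head (with_proj (directed_cycle k)) = iso_head f"
      unfolding app by (simp_all add: n_def)
    then show "n ` pverts H = {0..<k}"
      "iso_arcs f ` parcs H = (\<lambda>i. (i, Suc i mod k)) ` {0..<k}"
      "iso_tail f = fst" "iso_head f = snd"
      unfolding directed_cycle_def by simp_all
  qed
  \<comment> \<open>An isomorphism of the graph library maps arcs separately from vertices. Here the
    target is again given by \<open>with_proj\<close>, so its tail and head maps are the
    projections, and the arc map is forced.\<close>
  have arc: "iso_arcs f (a, b) = (n a, n b)" if "(a, b) \<in> parcs H" for a b
    using iso that ht unfolding pre_digraph.digraph_isomorphism_def n_def
    by (auto simp: prod_eq_iff)
  have HV: "a \<in> pverts H \<and> b \<in> pverts H" if "(a, b) \<in> parcs H" for a b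
    using wf that unfolding wf_digraph_def by force
  define x where "x = inv_into (pverts H) n"
  have xn: "x (n a) = a" if "a \<in> pverts H" for a using inj that by (simp add: x_def)
  have bij: "bij_betw x {0..<k} (pverts H)"
    unfolding x_def by (rule bij_betw_inv_into) (simp add: bij_betw_def inj V)
  define ys where "ys = map x [0..<k]"
  have dys: "distinct ys" using bij by (auto simp: ys_def distinct_map bij_betw_def)
  have sys: "set ys = pverts H" using bij by (auto simp: ys_def bij_betw_def)
  have lys: "length ys = k" by (simp add: ys_def)
  have "parcs H = (\<lambda>i. (x i, x (Suc i mod k))) ` {0..<k}"
  proof (intro equalityI subsetI)
    fix e assume "e \<in> parcs H"
    moreover obtain a b where e: "e = (a, b)" by (cases e)
    ultimately have ab: "(a, b) \<in> parcs H" by simp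
    then have "(n a, n b) \<in> (\<lambda>i. (i, Suc i mod k)) ` {0..<k}"
      unfolding E[symmetric] arc[OF ab, symmetric] by (rule imageI)
    then have "n a < k" "n b = Suc (n a) mod k" by auto
    then have "e = (x (n a), x (Suc (n a) mod k))" using xn HV[OF ab] e by metis
    then show "e \<in> (\<lambda>i. (x i, x (Suc i mod k))) ` {0..<k}" using \<open>n a < k\<close>
      by (intro image_eqI[of _ _ "n a"]) simp_all
  next
    fix e assume "e \<in> (\<lambda>i. (x i, x (Suc i mod k))) ` {0..<k}"
    then obtain i where i: "i < k" "e = (x i, x (Suc i mod k))" by auto
    then have "(i, Suc i mod k) \<in> iso_arcs f ` parcs H" unfolding E by auto
    then obtain e' where e': "e' \<in> parcs H" "iso_arcs f e' = (i, Suc i mod k)"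
      by (elim imageE) simp
    obtain a b where "e' = (a, b)" by (cases e')
    with e' have ab: "(a, b) \<in> parcs H" by simp
    then have "i = n a" "Suc i mod k = n b" using arc[OF ab] e'(2) \<open>e' = (a, b)\<close> by simp_all
    then show "e \<in> parcs H" using i(2) ab xn HV[OF ab] by metis
  qed
  also have "\<dots> = parcs (cycle_graph ys)"
    unfolding parcs_cycle_graph lys
  proof (intro image_cong refl)
    fix i assume "i \<in> {0..<k}"
    then have "i < k" "Suc i mod k < k" by (auto intro: mod_less_divisor)
    then show "(x i, x (Suc i mod k)) = (ys ! i, ys ! (Suc i mod k))" by (simp add: ys_def)
  qed
  finally have H: "cycle_graph ys = H" using sys by (simp add: cycle_graph_def)
  obtain j where j: "j < k" "ys ! j = v" using v sys lys by (metis in_set_conv_nth)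
  have "hd (rotate j ys) = v" using j lys by (subst hd_conv_nth) (auto simp: nth_rotate)
  then show ?thesis using dys lys H by (intro exI[of _ "rotate j ys"]) (simp add: cycle_graph_rotate)
qed

section \<open>Tableaux, covers and orientations of a poset\<close>

context strict_poset begin

lemma semistrict_conv_nth:
  "semistrict xs \<longleftrightarrow> (\<forall>j. Suc j < length xs \<longrightarrow> \<not> xs ! Suc j \<prec> xs ! j)"
  by (simp add: semistrict_def successively_conv_nth)

lemma no_record_conv_nth:
  "no_record xs \<longleftrightarrow> \<not> (\<exists>j<length xs. j \<noteq> 0 \<and> (\<forall>k<j. xs ! k \<prec> xs ! j))"
proof
  assume nr: "no_record xs"
  show "\<not> (\<exists>j<length xs. j \<noteq> 0 \<and> (\<forall>k<j. xs ! k \<prec> xs ! j))"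
  proof
    assume "\<exists>j<length xs. j \<noteq> 0 \<and> (\<forall>k<j. xs ! k \<prec> xs ! j)"
    then obtain j where j: "j < length xs" "j \<noteq> 0" "\<And>k. k < j \<Longrightarrow> xs ! k \<prec> xs ! j" by blast
    have "xs = take j xs @ xs ! j # drop (Suc j) xs" by (rule id_take_nth_drop[OF j(1)])
    moreover have "take j xs \<noteq> []" using j by auto
    ultimately obtain a where "a \<in> set (take j xs)" "\<not> a \<prec> xs ! j"
      using nr unfolding no_record_def by blast
    moreover from this obtain k where "k < j" "a = xs ! k"
      using j(1) by (auto simp: in_set_conv_nth)
    ultimately show False using j(3) by blast
  qed
next
  assume *: "\<not> (\<exists>j<length xs. j \<noteq> 0 \<and> (\<forall>k<j. xs ! k \<prec> xs ! j))"
  show "no_record xs"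
    unfolding no_record_def
  proof (intro allI impI)
    fix as y bs assume xs: "xs = as @ y # bs" and "as \<noteq> []"
    then have "length as < length xs" "length as \<noteq> 0" by auto
    then obtain k where "k < length as" "\<not> xs ! k \<prec> xs ! length as" using * by blast
    then show "\<exists>a\<in>set as. \<not> a \<prec> y"
      using xs by (intro bexI[of _ "as ! k"]) (auto simp: nth_append)
  qed
qed

end

locale poset_graph =
  fixes P :: "'a set" and r :: "'a rel"
  assumes finite_P: "finite P" and partial_order: "partial_order_on P r"
begin

sublocale strict_poset "strictly_below r"
proof
  show "\<not> strictly_below r x x" for x by (simp add: strictly_below_def)
  show "strictly_below r x z" if "strictly_below r x y" "strictly_below r y z" for x y z
    using that partial_order_onD(2,3)[OF partial_order] unfolding strictly_below_def
    by (metis antisymD transD)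
qed

lemma incomparable_iff:
  assumes "x \<in> P" "y \<in> P"
  shows "\<not> comparable x y \<longleftrightarrow> (x, y) \<notin> r \<and> (y, x) \<notin> r"
  using refl_onD[OF partial_order_onD(1)[OF partial_order] assms(1)]
  unfolding comparable_def strictly_below_def by blast

lemma inc_eq:
  assumes "I \<subseteq> P"
  shows "inc I (Restr r I) = incomparability I"
proof -
  have "{(x, y) \<in> I \<times> I. (x, y) \<notin> Restr r I \<and> (y, x) \<notin> Restr r I} = {(x, y) \<in> I \<times> I. \<not> comparable x y}"
    using incomparable_iff assms by blast
  then show ?thesis unfolding inc_def incomparability_def by simp
qed

lemma inc_P: "inc P r = incomparability P"
proof -
  have "{(x, y) \<in> P \<times> P. (x, y) \<notin> r \<and> (y, x) \<notin> r} = {(x, y) \<in> P \<times> P. \<not> comparable x y}"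
    using incomparable_iff by blast
  then show ?thesis unfolding inc_def incomparability_def by simp
qed

lemma row_semistrict_iff: "row_semistrict r U \<longleftrightarrow> (\<forall>row\<in>set U. semistrict row)"
  unfolding row_semistrict_def semistrict_conv_nth all_set_conv_all_nth ..

lemma record_free_iff: "record_free r U \<longleftrightarrow> (\<forall>row\<in>set U. no_record row)"
  unfolding record_free_def no_record_conv_nth all_set_conv_all_nth by blast

text \<open>Empty rows are excluded because \<open>hd\<close> and \<open>last\<close> are
  unspecified on them.\<close>

lemma cyclically_row_semistrict_iff:
  assumes "\<forall>row\<in>set U. row \<noteq> []"
  shows "cyclically_row_semistrict r U \<longleftrightarrow> (\<forall>row\<in>set U. cyclically_semistrict row)"
proof -
  have "(\<forall>i<length U. \<not> strictly_below r (hd (U ! i)) (last (U ! i))) \<longleftrightarrow>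
      (\<forall>row\<in>set U. \<not> strictly_below r (hd row) (last row))"
    by (simp add: all_set_conv_all_nth)
  moreover have "(\<forall>row\<in>set U. cyclically_semistrict row) \<longleftrightarrow>
      (\<forall>row\<in>set U. semistrict row) \<and> (\<forall>row\<in>set U. \<not> strictly_below r (hd row) (last row))"
    using assms cyclically_semistrict_iff by blast
  ultimately show ?thesis
    unfolding cyclically_row_semistrict_def row_semistrict_iff by blast
qed

lemma tableau_row_nonempty:
  assumes "tableau A lam U" "\<forall>k\<in>set lam. 0 < k" "row \<in> set U"
  shows "row \<noteq> []"
  using assms unfolding tableau_def by auto

lemma cyclic_tableaux_eq:
  assumes "\<forall>k\<in>set lam. 0 < k"
  shows "{U. tableau P lam U \<and> cyclically_row_semistrict r U} =
    structures set (\<lambda>row. distinct row \<and> cyclically_semistrict row) P lam"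
proof -
  have "tableau P lam U \<and> cyclically_row_semistrict r U \<longleftrightarrow>
      tableau P lam U \<and> (\<forall>row\<in>set U. cyclically_semistrict row)" for U
    using cyclically_row_semistrict_iff[of U] tableau_row_nonempty[OF _ assms] by blast
  then show ?thesis by (simp only: tableau_structures)
qed

lemma record_free_tableaux_eq:
  "{U. tableau P lam U \<and> record_free r U \<and> row_semistrict r U} =
    structures set (\<lambda>row. distinct row \<and> semistrict row \<and> no_record row) P lam"
proof -
  have "record_free r U \<and> row_semistrict r U \<longleftrightarrow> (\<forall>row\<in>set U. semistrict row \<and> no_record row)" for U
    unfolding record_free_iff row_semistrict_iff by blast
  then show ?thesis by (simp only: tableau_structures)
qed

lemma rows_Collect: "{row. set row = I \<and> distinct row \<and> p row} = {row \<in> rows I. p row}"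
  by (auto simp: rows_def)

lemma card_record_free_tableaux:
  assumes "\<forall>k\<in>set lam. 0 < k"
  shows "card {U. tableau P lam U \<and> record_free r U \<and> row_semistrict r U} =
    card {U. tableau P lam U \<and> cyclically_row_semistrict r U}"
  unfolding record_free_tableaux_eq cyclic_tableaux_eq[OF assms]
  by (rule card_structures_eq[OF assms])
    (simp_all add: rows_Collect finite_rows card_cyclic_rows_eq_one_source card_no_record_rows)

text \<open>The oriented sequence can be recovered from the vertex sets of \<open>Qs\<close>, which
  eliminates the existential quantifier and leaves a condition on each component.\<close>

lemma single_source_orientations_eq:
  "single_source_orientations P r lam =
    structures pverts (\<lambda>Q. Q \<in> one_source_orientations (pverts Q)) P lam"
proof -
  have ind: "induced_subgraph (with_proj (inc I (Restr r I))) (with_proj (inc P r))" if "I \<subseteq> P" for I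
  proof -
    have "wf_digraph (with_proj (incomparability J))" for J
      by unfold_locales (auto simp: incomparability_def)
    then show ?thesis
      unfolding inc_eq[OF that] inc_P induced_subgraph_def subgraph_def
      using that by (auto simp: incomparability_def compatible_def)
  qed
  have pv: "pverts (inc I R) = I" for I :: "'a set" and R by (simp add: inc_def)
  have iff1: "map (\<lambda>I. inc I (Restr r I)) Is \<in> induced_sequences lam (inc P r) \<longleftrightarrow>
      ordered_set_partition P lam Is" for Is
  proof
    assume "map (\<lambda>I. inc I (Restr r I)) Is \<in> induced_sequences lam (inc P r)"
    then obtain Js where "ordered_set_partition P lam Js"
      and "list_all2 (\<lambda>H I. pverts H = I \<and> induced_subgraph (with_proj H) (with_proj (inc P r)))
        (map (\<lambda>I. inc I (Restr r I)) Is) Js"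
      unfolding induced_sequences_def by (auto simp: pv)
    moreover from this(2) have "Is = Js"
      by (auto simp: list_all2_map1 pv list_all2_conv_all_nth intro: nth_equalityI)
    ultimately show "ordered_set_partition P lam Is" by simp
  next
    assume osp: "ordered_set_partition P lam Is"
    then have "I \<subseteq> P" if "I \<in> set Is" for I
      using that unfolding ordered_set_partition_def by auto
    then have "list_all2 (\<lambda>H I. pverts H = I \<and> induced_subgraph (with_proj H) (with_proj (inc P r)))
        (map (\<lambda>I. inc I (Restr r I)) Is) Is"
      using ind by (auto simp: list_all2_map1 pv intro!: list.rel_refl_strong)
    with osp show "map (\<lambda>I. inc I (Restr r I)) Is \<in> induced_sequences lam (inc P r)"
      unfolding induced_sequences_def by (auto simp: pv)
  qed
  have iff2: "list_all2 acyclic_orientation (map (\<lambda>I. inc I (Restr r I)) Is) Qs \<longleftrightarrow>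
      Is = map pverts Qs \<and> (\<forall>Q\<in>set Qs. acyclic_orientation (incomparability (pverts Q)) Q)"
    if "\<forall>I\<in>set Is. I \<subseteq> P" for Is Qs
    using that
  proof (induction Is arbitrary: Qs)
    case Nil
    then show ?case by auto
  next
    case (Cons I Is)
    have "acyclic_orientation (incomparability I) Q \<longleftrightarrow>
        I = pverts Q \<and> acyclic_orientation (incomparability (pverts Q)) Q" for Q
      by (auto simp: acyclic_orientation_def incomparability_def)
    then show ?case using Cons by (cases Qs) (auto simp: inc_eq)
  qed
  have sub: "\<forall>I\<in>set Is. I \<subseteq> P" if "ordered_set_partition P lam Is" for Is
    using that unfolding ordered_set_partition_def by auto
  have "(\<exists>Is. map (\<lambda>I. inc I (Restr r I)) Is \<in> induced_sequences lam (inc P r) \<and>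
        list_all2 acyclic_orientation (map (\<lambda>I. inc I (Restr r I)) Is) Qs) \<longleftrightarrow>
      ordered_set_partition P lam (map pverts Qs) \<and>
        (\<forall>Q\<in>set Qs. acyclic_orientation (incomparability (pverts Q)) Q)" for Qs
    unfolding iff1
  proof
    assume "\<exists>Is. ordered_set_partition P lam Is \<and>
      list_all2 acyclic_orientation (map (\<lambda>I. inc I (Restr r I)) Is) Qs"
    then obtain Is where osp: "ordered_set_partition P lam Is"
      and ao: "list_all2 acyclic_orientation (map (\<lambda>I. inc I (Restr r I)) Is) Qs" by blast
    then have eq: "Is = map pverts Qs"
      and Q: "\<forall>Q\<in>set Qs. acyclic_orientation (incomparability (pverts Q)) Q"
      using ao unfolding iff2[OF sub[OF osp]] by simp_all
    show "ordered_set_partition P lam (map pverts Qs) \<and>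
        (\<forall>Q\<in>set Qs. acyclic_orientation (incomparability (pverts Q)) Q)"
      using osp Q unfolding eq ..
  next
    assume R: "ordered_set_partition P lam (map pverts Qs) \<and>
        (\<forall>Q\<in>set Qs. acyclic_orientation (incomparability (pverts Q)) Q)"
    then have "list_all2 acyclic_orientation (map (\<lambda>I. inc I (Restr r I)) (map pverts Qs)) Qs"
      unfolding iff2[OF sub[OF conjunct1[OF R]]] by simp
    with R show "\<exists>Is. ordered_set_partition P lam Is \<and>
      list_all2 acyclic_orientation (map (\<lambda>I. inc I (Restr r I)) Is) Qs" by blast
  qed
  moreover have "(\<forall>Q\<in>set Qs. Q \<in> one_source_orientations (pverts Q)) \<longleftrightarrow>
      (\<forall>Q\<in>set Qs. acyclic_orientation (incomparability (pverts Q)) Q) \<and> (\<forall>Q\<in>set Qs. \<exists>!v. source Q v)" for Qs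
    unfolding one_source_orientations_def by blast
  ultimately show ?thesis
    unfolding single_source_orientations_def structures_def by (simp only: conj_assoc)
qed

lemma card_single_source_orientations:
  assumes "\<forall>k\<in>set lam. 0 < k"
  shows "card (single_source_orientations P r lam) =
    card {U. tableau P lam U \<and> cyclically_row_semistrict r U}"
  unfolding single_source_orientations_eq cyclic_tableaux_eq[OF assms]
proof (rule card_structures_eq[OF assms])
  fix I assume I: "I \<subseteq> P" "finite I" "I \<noteq> {}"
  have eq: "{Q. pverts Q = I \<and> Q \<in> one_source_orientations (pverts Q)} = one_source_orientations I"
    unfolding one_source_orientations_def
    by (auto simp: acyclic_orientation_def incomparability_def)
  show "finite {Q. pverts Q = I \<and> Q \<in> one_source_orientations (pverts Q)}"
    unfolding eq using finite_acyclic_orientations[OF I(2)]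
    by (rule finite_subset[rotated]) (auto simp: one_source_orientations_def)
  show "finite {row. set row = I \<and> distinct row \<and> cyclically_semistrict row}"
    by (simp add: rows_Collect finite_rows)
  show "card {Q. pverts Q = I \<and> Q \<in> one_source_orientations (pverts Q)} =
      card {row. set row = I \<and> distinct row \<and> cyclically_semistrict row}"
    unfolding eq rows_Collect using card_cyclic_rows_eq_one_source[OF I(2,3)] by simp
qed

text \<open>The cycle length is read off the vertex set instead of being a parameter, so that this
  is a condition on one entry as required by \<open>structures\<close>.\<close>

definition based_cycle :: "'a pair_pre_digraph \<times> 'a \<Rightarrow> bool" where
  "based_cycle u \<longleftrightarrow> snd u \<in> pverts (fst u) \<and>
     subgraph (with_proj (fst u)) (with_proj (ngr P r)) \<and>
     digraph_iso (with_proj (fst u)) (with_proj (directed_cycle (card (pverts (fst u)))))"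

text \<open>The one point that is not local is covering: disjoint subsets of \<open>P\<close> whose
  sizes add up to \<open>card P\<close> exhaust \<open>P\<close> (fact \<open>PD\<close>). The rest
  is passing between a pair of lists and a list of pairs.\<close>

lemma based_cyclic_vertex_covers_eq:
  assumes "sum_list lam = card P" "\<forall>k\<in>set lam. 0 < k"
  shows "based_cyclic_vertex_covers (ngr P r) lam =
    (\<lambda>us. (map fst us, map snd us)) ` structures (pverts \<circ> fst) based_cycle P lam"
proof -
  let ?D = "with_proj (ngr P r)"
  have card_iso: "card (pverts H) = k"
    if "digraph_iso (with_proj H) (with_proj (directed_cycle k))" for H :: "'a pair_pre_digraph" and k
  proof -
    obtain f where iso: "pre_digraph.digraph_isomorphism (with_proj H) f"
      and app: "with_proj (directed_cycle k) = app_iso f (with_proj H)"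
      using \<open>digraph_iso _ _\<close> unfolding digraph_iso_def by blast
    have "inj_on (iso_verts f) (pverts H)"
      using iso unfolding pre_digraph.digraph_isomorphism_def by simp
    moreover have "iso_verts f ` pverts H = verts (with_proj (directed_cycle k))"
      unfolding app by simp
    moreover have "verts (with_proj (directed_cycle k)) = {0..<k}"
      by (simp add: directed_cycle_def)
    ultimately show ?thesis using card_image by fastforce
  qed
  have iff1: "list_all2 (\<lambda>H k. subgraph (with_proj H) ?D \<and>
        digraph_iso (with_proj H) (with_proj (directed_cycle k))) Hs lam \<and>
      list_all2 (\<lambda>H v. v \<in> pverts H) Hs vs \<longleftrightarrow>
      map (card \<circ> pverts) Hs = lam \<and> length Hs = length vs \<and> (\<forall>u\<in>set (zip Hs vs). based_cycle u)"
    for Hs vs lam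
  proof (induction Hs arbitrary: lam vs)
    case Nil
    then show ?case by auto
  next
    case (Cons H Hs)
    show ?case
      using Cons card_iso[of H] unfolding based_cycle_def by (cases vs; cases lam) auto
  qed
  have PD: "\<Union> (set (map pverts Hs)) = P"
    if "\<forall>H\<in>set Hs. subgraph (with_proj H) ?D" "map (card \<circ> pverts) Hs = lam"
      "pairwise_disjoint_list (map pverts Hs)" for Hs
  proof (rule card_subset_eq[OF finite_P])
    show sub: "\<Union> (set (map pverts Hs)) \<subseteq> P"
      using that(1) unfolding subgraph_def by (auto simp: ngr_def)
    have "finite I" if "I \<in> set (map pverts Hs)" for I
      by (rule finite_subset[OF order_trans[OF Union_upper[OF that] sub] finite_P])
    then have "card (\<Union> (set (map pverts Hs))) = sum_list (map card (map pverts Hs))"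
      by (intro card_Union_pairwise_disjoint_list that(3)) blast
    then show "card (\<Union> (set (map pverts Hs))) = card P" using that(2) assms(1) by simp
  qed
  have iff2: "(Hs, vs) \<in> based_cyclic_vertex_covers (ngr P r) lam \<longleftrightarrow>
      length Hs = length vs \<and> zip Hs vs \<in> structures (pverts \<circ> fst) based_cycle P lam" for Hs vs
  proof -
    have D: "pairwise_disjoint_list (map pverts Hs) \<longleftrightarrow>
        (\<forall>i<length Hs. \<forall>j<length Hs. i \<noteq> j \<longrightarrow> pverts (Hs ! i) \<inter> pverts (Hs ! j) = {})"
      by (auto simp: pairwise_disjoint_list_def)
    have "(Hs, vs) \<in> based_cyclic_vertex_covers (ngr P r) lam \<longleftrightarrow>
       (map (card \<circ> pverts) Hs = lam \<and> length Hs = length vs \<and> (\<forall>u\<in>set (zip Hs vs). based_cycle u))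
       \<and> pairwise_disjoint_list (map pverts Hs)"
      unfolding based_cyclic_vertex_covers_def disjoint_cyclic_vertex_cover_def D
      using iff1[of Hs lam vs] by blast
    also have "\<dots> \<longleftrightarrow> length Hs = length vs \<and> (\<forall>u\<in>set (zip Hs vs). based_cycle u) \<and>
        ordered_set_partition P lam (map pverts Hs)"
    proof -
      have "\<forall>H\<in>set Hs. subgraph (with_proj H) ?D"
        if "length Hs = length vs" "\<forall>u\<in>set (zip Hs vs). based_cycle u"
      proof
        fix H assume "H \<in> set Hs"
        then have "H \<in> fst ` set (zip Hs vs)"
          unfolding set_map[symmetric] map_fst_zip[OF that(1)] .
        then obtain v where "(H, v) \<in> set (zip Hs vs)" by auto
        then show "subgraph (with_proj H) ?D" using that(2) by (auto simp: based_cycle_def)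
      qed
      then show ?thesis using PD[of Hs] unfolding ordered_set_partition_alt by auto
    qed
    also have "\<dots> \<longleftrightarrow> length Hs = length vs \<and> zip Hs vs \<in> structures (pverts \<circ> fst) based_cycle P lam"
    proof -
      have "map (pverts \<circ> fst) (zip Hs vs) = map pverts Hs" if "length Hs = length vs"
        using that by (simp flip: map_map)
      then show ?thesis unfolding structures_def by auto
    qed
    finally show ?thesis .
  qed
  show ?thesis
  proof (intro equalityI subsetI)
    fix x assume x: "x \<in> based_cyclic_vertex_covers (ngr P r) lam"
    obtain Hs vs where [simp]: "x = (Hs, vs)" by (cases x)
    have "length Hs = length vs" "zip Hs vs \<in> structures (pverts \<circ> fst) based_cycle P lam"
      using iff2 x by simp_all
    then show "x \<in> (\<lambda>us. (map fst us, map snd us)) ` structures (pverts \<circ> fst) based_cycle P lam"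
      by (intro image_eqI[of _ _ "zip Hs vs"]) simp_all
  next
    fix x assume "x \<in> (\<lambda>us. (map fst us, map snd us)) ` structures (pverts \<circ> fst) based_cycle P lam"
    then obtain us where us: "us \<in> structures (pverts \<circ> fst) based_cycle P lam"
      "x = (map fst us, map snd us)" by blast
    then show "x \<in> based_cyclic_vertex_covers (ngr P r) lam"
      using iff2[of "map fst us" "map snd us"] by (simp add: zip_map_fst_snd)
  qed
qed

text \<open>Reading a cycle from its base point gives a row, and its arcs belong to
  \<open>ngr P r\<close> exactly when no cyclically adjacent pair of the row is a descent.\<close>

lemma based_cycles_with_support:
  assumes I: "I \<subseteq> P" "finite I" "I \<noteq> {}"
  shows "{u. (pverts \<circ> fst) u = I \<and> based_cycle u} =
    (\<lambda>xs. (cycle_graph xs, hd xs)) ` {xs \<in> rows I. cyclically_semistrict xs}"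
proof -
  have cyc: "cyclically_semistrict xs \<longleftrightarrow> parcs (cycle_graph xs) \<subseteq> parcs (ngr P r)"
    if "set xs \<subseteq> P" for xs
  proof -
    have "parcs (cycle_graph xs) \<subseteq> P \<times> P"
      using that parcs_cycle_graph_subset[of xs] by blast
    then show ?thesis
      unfolding cyclically_semistrict_def list_all2_iff ngr_def
      by (auto simp: cycle_graph_def)
  qed
  have wfD: "wf_digraph (with_proj (ngr P r))" by unfold_locales (auto simp: ngr_def)
  have wfC: "wf_digraph (with_proj (cycle_graph xs))" for xs :: "'a list"
    using parcs_cycle_graph_subset[of xs] by unfold_locales (auto simp: cycle_graph_def)
  show ?thesis
  proof (intro equalityI subsetI)
    fix u assume "u \<in> {u. (pverts \<circ> fst) u = I \<and> based_cycle u}"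
    then obtain H v where u: "u = (H, v)" "pverts H = I" "based_cycle (H, v)" by (cases u) auto
    then have sub: "subgraph (with_proj H) (with_proj (ngr P r))" by (simp add: based_cycle_def)
    obtain xs where xs: "distinct xs" "hd xs = v" "cycle_graph xs = H"
      using digraph_iso_directed_cycle[of H "card (pverts H)" v] u(3) sub
      unfolding based_cycle_def subgraph_def by auto
    then have "set xs = I" using u(2) by (auto simp: cycle_graph_def)
    moreover have "parcs (cycle_graph xs) \<subseteq> parcs (ngr P r)"
      using sub xs(3) by (simp add: subgraph_def)
    ultimately have "xs \<in> {xs \<in> rows I. cyclically_semistrict xs}"
      using cyc[of xs] I(1) xs(1) by (simp add: rows_def)
    then show "u \<in> (\<lambda>xs. (cycle_graph xs, hd xs)) ` {xs \<in> rows I. cyclically_semistrict xs}"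
      using xs u(1) by blast
  next
    fix u assume "u \<in> (\<lambda>xs. (cycle_graph xs, hd xs)) ` {xs \<in> rows I. cyclically_semistrict xs}"
    then obtain xs where xs: "u = (cycle_graph xs, hd xs)" "distinct xs" "set xs = I"
      "cyclically_semistrict xs" by (auto simp: rows_def)
    have "subgraph (with_proj (cycle_graph xs)) (with_proj (ngr P r))"
      unfolding subgraph_def using cyc[of xs] xs I(1) wfD wfC
      by (simp add: compatibleI_with_proj) (simp add: cycle_graph_def ngr_def)
    moreover have "digraph_iso (with_proj (cycle_graph xs)) (with_proj (directed_cycle (card (set xs))))"
      using digraph_iso_cycle_graph[OF xs(2)] distinct_card[OF xs(2)] by simp
    moreover have "pverts (cycle_graph xs) = set xs" by (simp add: cycle_graph_def)
    moreover have "hd xs \<in> set xs" using xs(3) I(3) by (intro hd_in_set) auto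
    ultimately show "u \<in> {u. (pverts \<circ> fst) u = I \<and> based_cycle u}"
      using xs(1,3) by (simp add: based_cycle_def)
  qed
qed

lemma card_based_cyclic_vertex_covers:
  assumes "sum_list lam = card P" "\<forall>k\<in>set lam. 0 < k"
  shows "card (based_cyclic_vertex_covers (ngr P r) lam) =
    card {U. tableau P lam U \<and> cyclically_row_semistrict r U}"
proof -
  have "inj (\<lambda>us :: ('a pair_pre_digraph \<times> 'a) list. (map fst us, map snd us))"
    by (rule injI) (metis Pair_inject zip_map_fst_snd)
  then have "card (based_cyclic_vertex_covers (ngr P r) lam) =
      card (structures (pverts \<circ> fst) based_cycle P lam)"
    unfolding based_cyclic_vertex_covers_eq[OF assms]
    by (intro card_image) (rule inj_on_subset, auto)
  also have "\<dots> = card (structures set (\<lambda>row. distinct row \<and> cyclically_semistrict row) P lam)"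
  proof (rule card_structures_eq[OF assms(2)])
    fix I assume I: "I \<subseteq> P" "finite I" "I \<noteq> {}"
    have fin: "finite {xs \<in> rows I. cyclically_semistrict xs}" using finite_rows[of I] by simp
    show "finite {u. (pverts \<circ> fst) u = I \<and> based_cycle u}"
      unfolding based_cycles_with_support[OF I] using fin by simp
    show "finite {row. set row = I \<and> distinct row \<and> cyclically_semistrict row}"
      unfolding rows_Collect by (rule fin)
    have "inj_on (\<lambda>xs. (cycle_graph xs, hd xs)) {xs \<in> rows I. cyclically_semistrict xs}"
      using cycle_graph_inj by (auto simp: inj_on_def rows_def)
    then show "card {u. (pverts \<circ> fst) u = I \<and> based_cycle u} =
        card {row. set row = I \<and> distinct row \<and> cyclically_semistrict row}"
      unfolding based_cycles_with_support[OF I] rows_Collect by (rule card_image)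
  qed
  finally show ?thesis unfolding cyclic_tableaux_eq[OF assms(2)] .
qed

end

section \<open>Induced sign characters and colorings\<close>

context strict_poset begin

text \<open>Let \<open>m\<close> be a maximal moved point. Its image is comparable to it, distinct
  from it and not below it, hence above it, and is moved as well, a contradiction. This is the
  unitriangular case: only the identity contributes to the determinant.\<close>

lemma permutes_weakly_increasing:
  assumes "finite A" "v permutes A" "\<And>m. m \<in> A \<Longrightarrow> comparable (v m) m" "\<And>m. m \<in> A \<Longrightarrow> \<not> v m \<prec> m"
  shows "v = id"
proof (rule ccontr)
  assume "v \<noteq> id"
  let ?M = "{m \<in> A. v m \<noteq> m}"
  have "?M \<noteq> {}" using \<open>v \<noteq> id\<close> permutes_not_in[OF assms(2)] by fastforce
  then obtain m where m: "m \<in> ?M" "\<forall>x\<in>?M. \<not> m \<prec> x"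
    using ex_maximal[of ?M] assms(1) by auto
  have "v m \<in> A" using m permutes_in_image[OF assms(2)] by simp
  moreover have "v (v m) \<noteq> v m" using m permutes_inj[OF assms(2)] by (simp add: inj_eq)
  moreover have "m \<prec> v m" using m assms(3,4) by (auto simp: comparable_def)
  ultimately show False using m by blast
qed

text \<open>Take an incomparable pair in a block for which the down-sets are smallest in total: an element
  below only one of the two would give a smaller such pair.\<close>

lemma ex_same_downset:
  assumes "finite A" "a \<in> A" "b \<in> A" "f a = f b" "\<not> comparable a b"
  shows "\<exists>i\<in>A. \<exists>j\<in>A. f i = f j \<and> i \<noteq> j \<and>
    (\<forall>k\<in>A. f k = f i \<longrightarrow> (k \<prec> i \<longleftrightarrow> k \<prec> j))"
proof -
  define D where "D i = {k \<in> A. f k = f i \<and> k \<prec> i}" for i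
  define bad where "bad u \<longleftrightarrow> fst u \<in> A \<and> snd u \<in> A \<and> f (fst u) = f (snd u) \<and> \<not> comparable (fst u) (snd u)"
    for u
  define size2 where "size2 u = card (D (fst u)) + card (D (snd u))" for u
  have "bad (a, b)" using assms by (simp add: bad_def)
  then obtain u where u: "bad u" "\<And>w. bad w \<Longrightarrow> size2 u \<le> size2 w"
    using ex_has_least_nat[of bad "(a, b)" size2] by blast
  have finD: "finite (D i)" for i using assms(1) by (simp add: D_def)
  have sub: "k \<prec> j"
    if ij: "i \<in> A" "j \<in> A" "f i = f j" "\<not> comparable i j" and k: "k \<in> D i"
      and min: "\<And>w. bad w \<Longrightarrow> card (D i) + card (D j) \<le> size2 w" for i j k
  proof (rule ccontr)
    assume "\<not> k \<prec> j"
    have kA: "k \<in> A" "f k = f i" "k \<prec> i" using k by (simp_all add: D_def)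
    have "\<not> comparable k j"
    proof
      assume "comparable k j"
      then have "j = k \<or> j \<prec> k" using \<open>\<not> k \<prec> j\<close> unfolding comparable_def by blast
      then have "j \<prec> i" using kA(3) lt_trans by blast
      then show False using ij(4) by (simp add: comparable_def)
    qed
    then have "bad (k, j)" using ij kA by (simp add: bad_def)
    have "D k \<subseteq> D i" using kA lt_trans unfolding D_def by auto
    moreover have "k \<notin> D k" using lt_irrefl by (simp add: D_def)
    ultimately have "card (D k) < card (D i)"
      using k finD by (intro psubset_card_mono) auto
    with min[OF \<open>bad (k, j)\<close>] show False by (simp add: size2_def)
  qed
  obtain i j where [simp]: "u = (i, j)" by (cases u)
  have ij: "i \<in> A" "j \<in> A" "f i = f j" "\<not> comparable i j" using u(1) by (simp_all add: bad_def)
  have ji: "f j = f i" "\<not> comparable j i" using ij comparable_sym by auto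
  have min: "card (D i) + card (D j) \<le> size2 w" "card (D j) + card (D i) \<le> size2 w" if "bad w" for w
    using u(2)[OF that] by (simp_all add: size2_def)
  have "k \<prec> i \<longleftrightarrow> k \<prec> j" if "k \<in> A" "f k = f i" for k
  proof
    assume "k \<prec> i"
    then show "k \<prec> j" using sub[OF ij _ min(1)] that by (simp add: D_def)
  next
    assume "k \<prec> j"
    then show "k \<prec> i" using sub[OF ij(2,1) ji _ min(2)] that ij(3) by (simp add: D_def)
  qed
  moreover have "i \<noteq> j" using ij(4) by auto
  ultimately show ?thesis using ij by blast
qed

text \<open>This is the product over the blocks of \<open>f\<close> of the determinants of the matrices with
  entry 0 at \<open>(m, m')\<close> if \<open>m' \<prec> m\<close> and 1 otherwise. It is unitriangular on a chain and has two
  equal rows on any other block.\<close>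

lemma signed_sum_blocks:
  fixes f :: "'a \<Rightarrow> 'c"
  assumes "finite A"
  defines "H \<equiv> {v. v permutes A \<and> (\<forall>m\<in>A. f (v m) = f m)}"
  shows "(\<Sum>v\<in>H. if \<forall>m\<in>A. \<not> v m \<prec> m then sign v else 0) =
    (if \<forall>m\<in>A. \<forall>m'\<in>A. f m = f m' \<longrightarrow> comparable m m' then 1 else 0)"
proof (cases "\<forall>m\<in>A. \<forall>m'\<in>A. f m = f m' \<longrightarrow> comparable m m'")
  case True
  have "(\<forall>m\<in>A. \<not> v m \<prec> m) \<longleftrightarrow> v = id" if "v \<in> H" for v
  proof
    assume nd: "\<forall>m\<in>A. \<not> v m \<prec> m"
    have v: "v permutes A" "\<And>m. m \<in> A \<Longrightarrow> f (v m) = f m" using that by (simp_all add: H_def)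
    have "comparable (v m) m" if "m \<in> A" for m
      using True v(2)[OF that] that permutes_in_image[OF v(1)] by blast
    then show "v = id" using permutes_weakly_increasing[OF assms(1) v(1)] nd by blast
  next
    assume "v = id"
    then show "\<forall>m\<in>A. \<not> v m \<prec> m" using lt_irrefl by simp
  qed
  then have "(\<Sum>v\<in>H. if \<forall>m\<in>A. \<not> v m \<prec> m then sign v else 0) = (\<Sum>v\<in>H. if v = id then sign v else 0)"
    by (intro sum.cong) auto
  also have "\<dots> = 1"
  proof -
    have "finite H" using finite_permutations[OF assms(1)] by (simp add: H_def)
    moreover have "id \<in> H" by (simp add: H_def permutes_id)
    ultimately show ?thesis by (simp add: sum.delta)
  qed
  finally show ?thesis using True by simp
next
  case False
  then obtain a b where "a \<in> A" "b \<in> A" "f a = f b" "\<not> comparable a b" by blast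
  from ex_same_downset[of A a b f, OF assms(1) this] obtain i j
    where ij: "i \<in> A" "j \<in> A" "f i = f j" "i \<noteq> j"
      and "\<forall>k\<in>A. f k = f i \<longrightarrow> (k \<prec> i \<longleftrightarrow> k \<prec> j)"
    by (elim bexE conjE)
  then have down: "\<And>k. k \<in> A \<Longrightarrow> f k = f i \<Longrightarrow> k \<prec> i \<longleftrightarrow> k \<prec> j" by simp
  \<comment> \<open>Composition with \<open>t\<close> exchanges the two equal rows: it is an
    involution of \<open>H\<close> that preserves the condition on \<open>v\<close> and changes the
    sign, so the sum equals its own negative.\<close>
  define t where "t = transpose i j"
  have tt: "t \<circ> t = id" by (simp add: t_def)
  have tp: "t permutes A" unfolding t_def using ij(1,2) by (rule permutes_swap_id)
  have ft: "f (t m) = f m" for m using ij(3) by (simp add: t_def transpose_def)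
  have Ht: "v \<circ> t \<in> H" if "v \<in> H" for v
    using that permutes_compose[OF tp] permutes_in_image[OF tp] ft by (auto simp: H_def)
  have imp: "\<forall>m\<in>A. \<not> (v \<circ> t) m \<prec> m" if v: "v \<in> H" "\<forall>m\<in>A. \<not> v m \<prec> m" for v
  proof
    fix m assume m: "m \<in> A"
    have vA: "v k \<in> A" "f (v k) = f k" if "k \<in> A" for k
      using v(1) that permutes_in_image[of v A k] by (auto simp: H_def)
    consider "m = i" | "m = j" | "m \<noteq> i" "m \<noteq> j" by blast
    then show "\<not> (v \<circ> t) m \<prec> m"
    proof cases
      case 1
      then show ?thesis using down[of "v j"] vA[OF ij(2)] ij v(2) by (simp add: t_def)
    next
      case 2
      then show ?thesis using down[of "v i"] vA[OF ij(1)] ij v(2) by (simp add: t_def)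
    next
      case 3
      then show ?thesis using v(2) m by (simp add: t_def)
    qed
  qed
  have vtt: "(v \<circ> t) \<circ> t = v" for v :: "'a \<Rightarrow> 'a" by (simp add: comp_assoc tt)
  let ?g = "\<lambda>v. if \<forall>m\<in>A. \<not> v m \<prec> m then sign v else (0::int)"
  have neg: "?g (v \<circ> t) = - ?g v" if v: "v \<in> H" for v
  proof -
    have "(\<forall>m\<in>A. \<not> (v \<circ> t) m \<prec> m) \<longleftrightarrow> (\<forall>m\<in>A. \<not> v m \<prec> m)"
      using imp[OF v] imp[OF Ht[OF v]] vtt by metis
    moreover have "sign (v \<circ> t) = - sign v"
    proof -
      have "permutation v" "permutation t"
        using v tp assms(1) permutation_permutes by (auto simp: H_def)
      then show ?thesis using ij(4) by (simp add: sign_compose t_def sign_swap_id)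
    qed
    ultimately show ?thesis by simp
  qed
  have "sum ?g H = (\<Sum>v\<in>H. ?g (v \<circ> t))"
    by (rule sum.reindex_bij_witness[of _ "\<lambda>v. v \<circ> t" "\<lambda>v. v \<circ> t"]) (simp_all only: vtt Ht)
  also have "\<dots> = - sum ?g H" by (simp only: neg sum_negf cong: sum.cong)
  finally have "sum ?g H = 0" by simp
  then show ?thesis using False by simp
qed

end

text \<open>Index, counted from 0, of the Young block that contains \<open>m\<close>; meaningful for
  \<open>m\<close> between 1 and \<open>sum_list mu\<close>.\<close>

definition block_of :: "nat list \<Rightarrow> nat \<Rightarrow> nat" where
  "block_of mu m = (LEAST i. m \<le> sum_list (take (Suc i) mu))"

lemma sum_list_take_mono: "i \<le> j \<Longrightarrow> sum_list (take i mu) \<le> sum_list (take j (mu :: nat list))"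
  by (metis le_add1 le_Suc_ex sum_list_append take_add)

lemma young_block_iff:
  assumes "m \<in> {1..sum_list mu}"
  shows "m \<in> young_block mu i \<longleftrightarrow> block_of mu m = i"
proof
  assume m: "m \<in> young_block mu i"
  show "block_of mu m = i"
    unfolding block_of_def
  proof (rule Least_equality)
    show "m \<le> sum_list (take (Suc i) mu)" using m by (simp add: young_block_def)
    fix j assume j: "m \<le> sum_list (take (Suc j) mu)"
    show "i \<le> j"
    proof (rule ccontr)
      assume "\<not> i \<le> j"
      then have "sum_list (take (Suc j) mu) \<le> sum_list (take i mu)" by (intro sum_list_take_mono) simp
      then show False using m j by (simp add: young_block_def)
    qed
  qed
next
  assume i: "block_of mu m = i"
  have ex: "m \<le> sum_list (take (Suc (length mu)) mu)" using assms by simp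
  have "m \<le> sum_list (take (Suc i) mu)"
    using LeastI[of "\<lambda>i. m \<le> sum_list (take (Suc i) mu)", OF ex] i by (simp add: block_of_def)
  moreover have "sum_list (take i mu) < m"
  proof (cases i)
    case 0
    then show ?thesis using assms by simp
  next
    case (Suc j)
    then have "\<not> m \<le> sum_list (take (Suc j) mu)"
      using i not_less_Least[of j "\<lambda>i. m \<le> sum_list (take (Suc i) mu)"] by (simp add: block_of_def)
    then show ?thesis using Suc by simp
  qed
  ultimately show "m \<in> young_block mu i" by (simp add: young_block_def)
qed

lemma block_of_less:
  assumes "m \<in> {1..sum_list mu}"
  shows "block_of mu m < length mu"
proof -
  have "m \<in> young_block mu (block_of mu m)" using young_block_iff[OF assms] by simp
  then have "sum_list (take (block_of mu m) mu) < sum_list (take (Suc (block_of mu m)) mu)"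
    by (simp add: young_block_def)
  then show ?thesis by (metis leI less_irrefl take_all le_SucI)
qed

lemma young_block_subset:
  assumes "i < length mu"
  shows "young_block mu i \<subseteq> {1..sum_list mu}"
  using sum_list_take_mono[of "Suc i" "length mu" mu] assms by (auto simp: young_block_def)

lemma young_block_eq:
  assumes "i < length mu"
  shows "young_block mu i = {m \<in> {1..sum_list mu}. block_of mu m = i}"
  using young_block_subset[OF assms] young_block_iff by blast

lemma card_young_block:
  assumes "i < length mu"
  shows "card (young_block mu i) = mu ! i"
  using assms by (simp add: young_block_def take_Suc_conv_app_nth)

text \<open>On a finite block an injective map into the block is onto, so stabilising the blocks as
  sets is the same as preserving \<open>block_of\<close>. In this form the subgroup is the set
  \<open>H\<close> of \<open>signed_sum_blocks\<close>.\<close>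

lemma young_subgroup_eq:
  "young_subgroup mu = {w. w permutes {1..sum_list mu} \<and> (\<forall>m\<in>{1..sum_list mu}. block_of mu (w m) = block_of mu m)}"
proof -
  have "(\<forall>i<length mu. w ` young_block mu i = young_block mu i) \<longleftrightarrow>
      (\<forall>m\<in>{1..sum_list mu}. block_of mu (w m) = block_of mu m)"
    if w: "w permutes {1..sum_list mu}" for w
  proof
    assume *: "\<forall>i<length mu. w ` young_block mu i = young_block mu i"
    show "\<forall>m\<in>{1..sum_list mu}. block_of mu (w m) = block_of mu m"
    proof
      fix m assume m: "m \<in> {1..sum_list mu}"
      then have "m \<in> young_block mu (block_of mu m)" using young_block_iff by simp
      then have "w m \<in> young_block mu (block_of mu m)" using * block_of_less[OF m] by blast
      moreover have "w m \<in> {1..sum_list mu}" using permutes_in_image[OF w] m by simp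
      ultimately show "block_of mu (w m) = block_of mu m" using young_block_iff by blast
    qed
  next
    assume *: "\<forall>m\<in>{1..sum_list mu}. block_of mu (w m) = block_of mu m"
    show "\<forall>i<length mu. w ` young_block mu i = young_block mu i"
    proof (intro allI impI)
      fix i assume i: "i < length mu"
      have "w ` young_block mu i \<subseteq> young_block mu i"
        unfolding young_block_eq[OF i] using * permutes_in_image[OF w] by auto
      moreover have "inj_on w (young_block mu i)" using permutes_inj_on[OF w] .
      ultimately show "w ` young_block mu i = young_block mu i"
        by (intro endo_inj_surj) (simp_all add: young_block_def)
    qed
  qed
  then show ?thesis unfolding young_subgroup_def sym_group_carrier by blast
qed

lemma young_subgroup_permutes: "w \<in> young_subgroup mu \<Longrightarrow> w permutes {1..sum_list mu}"
  by (simp add: young_subgroup_eq)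

lemma finite_young_subgroup: "finite (young_subgroup mu)"
  by (rule finite_subset[OF _ finite_permutations[of "{1..sum_list mu}"]])
    (auto simp: young_subgroup_eq)

lemma card_young_subgroup_pos: "0 < card (young_subgroup mu)"
proof -
  have "id \<in> young_subgroup mu" by (simp add: young_subgroup_eq permutes_id)
  then show ?thesis using finite_young_subgroup card_gt_0_iff by blast
qed

section \<open>Induced sign characters as sums over conjugates\<close>

lemma induced_sign_eq:
  "w permutes {1..sum_list mu} \<Longrightarrow> induced_sign mu w =
     (\<Sum>x | x permutes {1..sum_list mu}.
        if inv' x \<circ> w \<circ> x \<in> young_subgroup mu then of_int (sign (inv' x \<circ> w \<circ> x)) else 0)
     / of_nat (card (young_subgroup mu))"
  unfolding induced_sign_def induced_class_function_def
  by (intro arg_cong2[where f = "(/)"] sum.cong refl) (auto simp: sym_group_mult sym_group_carrier)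

lemma sum_conjugate:
  fixes g :: "('b \<Rightarrow> 'b) \<Rightarrow> 'c :: comm_monoid_add"
  assumes "x permutes A"
  shows "(\<Sum>w | w permutes A. g w) = (\<Sum>v | v permutes A. g (x \<circ> v \<circ> inv' x))"
proof (rule sum.reindex_bij_witness[of _ "\<lambda>v. x \<circ> v \<circ> inv' x" "\<lambda>w. inv' x \<circ> w \<circ> x"])
  note px = permutes_inv_o[OF assms]
  show *: "x \<circ> (inv' x \<circ> w \<circ> x) \<circ> inv' x = w" for w :: "'b \<Rightarrow> 'b"
  proof -
    have "x \<circ> (inv' x \<circ> w \<circ> x) \<circ> inv' x = (x \<circ> inv' x) \<circ> w \<circ> (x \<circ> inv' x)" by (simp only: comp_assoc)
    then show ?thesis by (simp only: px comp_id id_comp)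
  qed
  show "inv' x \<circ> (x \<circ> v \<circ> inv' x) \<circ> x = v" for v :: "'b \<Rightarrow> 'b"
  proof -
    have "inv' x \<circ> (x \<circ> v \<circ> inv' x) \<circ> x = (inv' x \<circ> x) \<circ> v \<circ> (inv' x \<circ> x)" by (simp only: comp_assoc)
    then show ?thesis by (simp only: px comp_id id_comp)
  qed
  show "x \<circ> v \<circ> inv' x \<in> {w. w permutes A}" if "v \<in> {v. v permutes A}" for v
    using that assms by (simp add: permutes_compose permutes_inv)
  show "inv' x \<circ> v \<circ> x \<in> {w. w permutes A}" if "v \<in> {v. v permutes A}" for v
    using that assms by (simp add: permutes_compose permutes_inv)
  show "g (x \<circ> (inv' x \<circ> w \<circ> x) \<circ> inv' x) = g w" for w by (simp only: *)
qed

lemma count_image_mset_set: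
  assumes "finite A"
  shows "count (image_mset f (mset_set A)) i = card {m \<in> A. f m = i}"
proof -
  have "f -` {i} \<inter> A = {m \<in> A. f m = i}" by auto
  then show ?thesis using assms by (simp add: count_image_mset)
qed

text \<open>Characters live on permutations of \<open>{1..card P}\<close>, so the elements of
  \<open>P\<close> are named by numbers; the labelling \<open>p\<close> is an arbitrary
  bijection.\<close>

locale labelled_poset_graph = poset_graph P r for P :: "'a set" and r +
  fixes p :: "nat \<Rightarrow> 'a"
  assumes bij_p: "bij_betw p {1..card P} P"
begin

section \<open>Proper colorings as cosets of a Young subgroup\<close>

lemma p_mem: "m \<in> {1..card P} \<Longrightarrow> p m \<in> P"
  using bij_p by (auto simp: bij_betw_def)

lemma p_eq_iff: "m \<in> {1..card P} \<Longrightarrow> m' \<in> {1..card P} \<Longrightarrow> p m = p m' \<longleftrightarrow> m = m'"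
  using bij_p by (auto simp: bij_betw_def inj_on_eq_iff)

text \<open>The classes of the colors \<open>1, ..., length mu\<close> have prescribed sizes with
  sum \<open>card P\<close>, so they leave no vertex for another color.\<close>

lemma proper_coloring_range:
  assumes "sum_list mu = card P" "\<kappa> \<in> proper_colorings (inc P r) mu" "v \<in> P"
  shows "\<kappa> v \<in> Suc ` {..<length mu}"
proof -
  let ?C = "\<lambda>i. {v \<in> P. \<kappa> v = Suc i}"
  have C: "card (?C i) = mu ! i" if "i < length mu" for i
    using assms(2) that by (simp add: proper_colorings_def inc_def)
  have "card (\<Union>i<length mu. ?C i) = (\<Sum>i<length mu. card (?C i))"
    by (rule card_UN_disjoint) (use finite_P in auto)
  also have "\<dots> = card P" using C assms(1) by (simp add: sum_list_sum_nth atLeast0LessThan)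
  finally have "(\<Union>i<length mu. ?C i) = P" by (intro card_subset_eq finite_P) auto
  then show ?thesis using assms(3) by blast
qed

text \<open>The coloring and the block function have fibers of the same sizes, and two functions on
  a finite set with this property differ by a permutation of the set.\<close>

lemma ex_permutation_of_coloring:
  assumes mu: "sum_list mu = card P" and \<kappa>: "\<kappa> \<in> proper_colorings (inc P r) mu"
  shows "\<exists>x. x permutes {1..card P} \<and> (\<forall>m\<in>{1..card P}. \<kappa> (p (x m)) = Suc (block_of mu m))"
proof -
  let ?N = "{1..card P}"
  \<comment> \<open>Colors are counted from 1, blocks from 0.\<close>
  define g where "g m = \<kappa> (p m) - 1" for m
  have g: "\<kappa> (p m) = Suc (g m)" "g m < length mu" if "m \<in> ?N" for m
    using proper_coloring_range[OF mu \<kappa> p_mem[OF that]] by (auto simp: g_def)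
  have "card {m \<in> ?N. block_of mu m = i} = card {m \<in> ?N. g m = i}" if i: "i < length mu" for i
  proof -
    have "bij_betw p {m \<in> ?N. g m = i} {v \<in> P. \<kappa> v = Suc i}"
    proof (rule bij_betw_subset[OF bij_p])
      show "p ` {m \<in> ?N. g m = i} = {v \<in> P. \<kappa> v = Suc i}"
      proof (intro equalityI subsetI)
        fix v assume "v \<in> p ` {m \<in> ?N. g m = i}"
        then show "v \<in> {v \<in> P. \<kappa> v = Suc i}" using g(1) p_mem by auto
      next
        fix v assume v: "v \<in> {v \<in> P. \<kappa> v = Suc i}"
        then have "v \<in> p ` ?N" using bij_betw_imp_surj_on[OF bij_p] by blast
        then obtain m where "m \<in> ?N" "v = p m" by blast
        then show "v \<in> p ` {m \<in> ?N. g m = i}" using v g(1) by auto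
      qed
    qed auto
    then have "card {m \<in> ?N. g m = i} = card {v \<in> P. \<kappa> v = Suc i}" by (rule bij_betw_same_card)
    also have "\<dots> = mu ! i" using \<kappa> i by (simp add: proper_colorings_def inc_def)
    finally show ?thesis using card_young_block[OF i] young_block_eq[OF i] mu by simp
  qed
  moreover have "card {m \<in> ?N. block_of mu m = i} = card {m \<in> ?N. g m = i}" if i: "\<not> i < length mu" for i
  proof -
    have "{m \<in> ?N. block_of mu m = i} = {}" using i block_of_less[of _ mu] mu by auto
    moreover have "{m \<in> ?N. g m = i} = {}" using i g(2) by auto
    ultimately show ?thesis by (simp only:)
  qed
  ultimately have "card {m \<in> ?N. block_of mu m = i} = card {m \<in> ?N. g m = i}" for i
    by blast
  then have "image_mset (block_of mu) (mset_set ?N) = image_mset g (mset_set ?N)"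
    by (intro multiset_eqI) (simp only: count_image_mset_set finite_atLeastAtMost)
  then obtain x where "x permutes ?N" "\<forall>m\<in>?N. block_of mu m = g (x m)"
    by (rule image_mset_eq_implies_permutes[OF finite_atLeastAtMost]) blast
  then show ?thesis using g(1) permutes_in_image[of x ?N] by (intro exI[of _ x]) auto
qed

text \<open>Giving \<open>p (x m)\<close> the color of the block of \<open>m\<close> yields a
  coloring, which is proper exactly when \<open>x\<close> places a chain in each block. The
  permutations \<open>x\<close> with a given coloring form a left coset of the Young
  subgroup.\<close>

lemma card_chain_block_permutations:
  assumes mu: "sum_list mu = card P"
  shows "card {x. x permutes {1..card P} \<and>
      (\<forall>m\<in>{1..card P}. \<forall>m'\<in>{1..card P}. block_of mu m = block_of mu m' \<longrightarrow> comparable (p (x m)) (p (x m')))} =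
    coloring_count (inc P r) mu * card (young_subgroup mu)"
proof -
  let ?N = "{1..card P}"
  let ?X = "{x. x permutes ?N \<and>
      (\<forall>m\<in>?N. \<forall>m'\<in>?N. block_of mu m = block_of mu m' \<longrightarrow> comparable (p (x m)) (p (x m')))}"
  let ?K = "proper_colorings (inc P r) mu"
  define fib where "fib \<kappa> = {x. x permutes ?N \<and> (\<forall>m\<in>?N. \<kappa> (p (x m)) = Suc (block_of mu m))}" for \<kappa> :: "'a \<Rightarrow> nat"
  define col where "col x = (\<lambda>v\<in>P. Suc (block_of mu (inv_into ?N (p \<circ> x) v)))" for x
  have bij: "bij_betw (p \<circ> x) ?N P" if "x permutes ?N" for x
    using bij_betw_trans[OF permutes_imp_bij[OF that] bij_p] .
  have col: "col x (p (x m)) = Suc (block_of mu m)" if "x permutes ?N" "m \<in> ?N" for x m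
  proof -
    have "p (x m) \<in> P" using that p_mem permutes_in_image[OF that(1)] by blast
    moreover have "inv_into ?N (p \<circ> x) ((p \<circ> x) m) = m"
      using bij_betw_inv_into_left[OF bij[OF that(1)] that(2)] .
    ultimately show ?thesis by (simp add: col_def)
  qed
  have ext: "\<kappa> = \<kappa>'" if "\<kappa> \<in> extensional P" "\<kappa>' \<in> extensional P" "x permutes ?N"
    "\<And>m. m \<in> ?N \<Longrightarrow> \<kappa> (p (x m)) = \<kappa>' (p (x m))" for \<kappa> \<kappa>' :: "'a \<Rightarrow> nat" and x
  proof (rule extensionalityI[OF that(1,2)])
    fix v assume "v \<in> P"
    then have "v \<in> (p \<circ> x) ` ?N" using bij_betw_imp_surj_on[OF bij[OF that(3)]] by blast
    then obtain m where "m \<in> ?N" "v = (p \<circ> x) m" by blast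
    then show "\<kappa> v = \<kappa>' v" using that(4) by simp
  qed
  have Kext: "\<kappa> \<in> extensional P" if "\<kappa> \<in> ?K" for \<kappa>
    using that by (auto simp: proper_colorings_def PiE_def inc_def)
  have fib_col: "\<kappa> = col x" if "\<kappa> \<in> ?K" "x \<in> fib \<kappa>" for \<kappa> x
  proof (rule ext[of _ _ x])
    show "\<kappa> \<in> extensional P" using Kext that by blast
    show "col x \<in> extensional P" unfolding col_def by (rule restrict_extensional)
    show x: "x permutes ?N" using that by (simp add: fib_def)
    show "\<kappa> (p (x m)) = col x (p (x m))" if "m \<in> ?N" for m
      using col[OF x that] \<open>x \<in> fib \<kappa>\<close> that by (simp add: fib_def)
  qed
  have finS: "finite {x. x permutes ?N}" by (rule finite_permutations) simp
  have finK: "finite ?K"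
  proof (rule finite_subset)
    show "?K \<subseteq> col ` {x. x permutes ?N}"
    proof
      fix \<kappa> assume k: "\<kappa> \<in> ?K"
      then obtain x where "x \<in> fib \<kappa>" using ex_permutation_of_coloring[OF mu] by (auto simp: fib_def)
      then show "\<kappa> \<in> col ` {x. x permutes ?N}" using fib_col[OF k] by (auto simp: fib_def)
    qed
  qed (use finS in simp)
  have "?X = (\<Union>\<kappa>\<in>?K. fib \<kappa>)"
  proof (intro equalityI subsetI)
    fix x assume x: "x \<in> ?X"
    then have xp: "x permutes ?N" by simp
    have "col x \<in> ?K"
      unfolding proper_colorings_def
    proof (intro CollectI conjI)
      show "col x \<in> pverts (inc P r) \<rightarrow>\<^sub>E {1..}" by (auto simp: col_def inc_def)
      show "\<forall>(u, v)\<in>parcs (inc P r). col x u \<noteq> col x v"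
      proof clarify
        fix u v assume uv: "(u, v) \<in> parcs (inc P r)" and eq: "col x u = col x v"
        then have "u \<in> P" "v \<in> P" by (auto simp: inc_def)
        then have "u \<in> (p \<circ> x) ` ?N" "v \<in> (p \<circ> x) ` ?N"
          using bij_betw_imp_surj_on[OF bij[OF xp]] by blast+
        then obtain m m' where m: "m \<in> ?N" "m' \<in> ?N" "u = p (x m)" "v = p (x m')"
          by (elim imageE) simp
        then have "comparable u v" using col[OF xp] eq x by auto
        then show False using uv by (auto simp: inc_P incomparability_def)
      qed
      show "\<forall>i<length mu. card {v \<in> pverts (inc P r). col x v = Suc i} = mu ! i"
      proof (intro allI impI)
        fix i assume i: "i < length mu"
        have "bij_betw (p \<circ> x) (young_block mu i) {v \<in> P. col x v = Suc i}"
        proof (rule bij_betw_subset[OF bij[OF xp]])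
          show "young_block mu i \<subseteq> ?N" using young_block_subset[OF i] mu by simp
          show "(p \<circ> x) ` young_block mu i = {v \<in> P. col x v = Suc i}"
          proof (intro equalityI subsetI)
            fix v assume "v \<in> (p \<circ> x) ` young_block mu i"
            then show "v \<in> {v \<in> P. col x v = Suc i}"
              using young_block_eq[OF i] mu col[OF xp] p_mem permutes_in_image[OF xp] by auto
          next
            fix v assume v: "v \<in> {v \<in> P. col x v = Suc i}"
            then have "v \<in> (p \<circ> x) ` ?N" using bij_betw_imp_surj_on[OF bij[OF xp]] by blast
            then obtain m where "m \<in> ?N" "v = (p \<circ> x) m" by blast
            then show "v \<in> (p \<circ> x) ` young_block mu i"
              using v young_block_eq[OF i] mu col[OF xp] by auto
          qed
        qed
        then have "card {v \<in> P. col x v = Suc i} = card (young_block mu i)"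
          using bij_betw_same_card by fastforce
        then show "card {v \<in> pverts (inc P r). col x v = Suc i} = mu ! i"
          using card_young_block[OF i] by (simp add: inc_def)
      qed
    qed
    moreover have "x \<in> fib (col x)" using xp col by (simp add: fib_def)
    ultimately show "x \<in> (\<Union>\<kappa>\<in>?K. fib \<kappa>)" by blast
  next
    fix x assume "x \<in> (\<Union>\<kappa>\<in>?K. fib \<kappa>)"
    then obtain \<kappa> where \<kappa>: "\<kappa> \<in> ?K" and x: "x permutes ?N"
      and \<kappa>x: "\<And>m. m \<in> ?N \<Longrightarrow> \<kappa> (p (x m)) = Suc (block_of mu m)" by (auto simp: fib_def)
    have "comparable (p (x m)) (p (x m'))"
      if m: "m \<in> ?N" "m' \<in> ?N" "block_of mu m = block_of mu m'" for m m'
    proof (rule ccontr)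
      assume "\<not> comparable (p (x m)) (p (x m'))"
      then have "(p (x m), p (x m')) \<in> parcs (inc P r)"
        using m p_mem permutes_in_image[OF x] by (simp add: inc_P incomparability_def)
      then have "\<kappa> (p (x m)) \<noteq> \<kappa> (p (x m'))" using \<kappa> by (auto simp: proper_colorings_def)
      then show False using \<kappa>x m by simp
    qed
    then show "x \<in> ?X" using x by simp
  qed
  moreover have "card (fib \<kappa>) = card (young_subgroup mu)" if \<kappa>: "\<kappa> \<in> ?K" for \<kappa>
  proof -
    obtain y where y: "y permutes ?N" "\<And>m. m \<in> ?N \<Longrightarrow> \<kappa> (p (y m)) = Suc (block_of mu m)"
      using ex_permutation_of_coloring[OF mu \<kappa>] by auto
    have iy: "inv' y permutes ?N" using permutes_inv[OF y(1)] .
    \<comment> \<open>The fiber is the coset of any one of its elements \<open>y\<close>.\<close>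
    have "bij_betw (\<lambda>h. y \<circ> h) (young_subgroup mu) (fib \<kappa>)"
    proof (rule bij_betw_byWitness[where f' = "\<lambda>x. inv' y \<circ> x"])
      show "\<forall>h\<in>young_subgroup mu. inv' y \<circ> (y \<circ> h) = h"
        using permutes_inv_o[OF y(1)] by (simp flip: comp_assoc)
      show "\<forall>x\<in>fib \<kappa>. y \<circ> (inv' y \<circ> x) = x"
        using permutes_inv_o[OF y(1)] by (simp flip: comp_assoc)
      show "(\<lambda>h. y \<circ> h) ` young_subgroup mu \<subseteq> fib \<kappa>"
      proof clarify
        fix h assume "h \<in> young_subgroup mu"
        then have h: "h permutes ?N" "\<And>m. m \<in> ?N \<Longrightarrow> block_of mu (h m) = block_of mu m"
          using mu by (simp_all add: young_subgroup_eq)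
        have "\<kappa> (p (y (h m))) = Suc (block_of mu m)" if "m \<in> ?N" for m
          using y(2)[of "h m"] h(2)[OF that] that permutes_in_image[OF h(1), of m] by simp
        then show "y \<circ> h \<in> fib \<kappa>" using permutes_compose[OF h(1) y(1)] by (simp add: fib_def)
      qed
      show "(\<lambda>x. inv' y \<circ> x) ` fib \<kappa> \<subseteq> young_subgroup mu"
      proof clarify
        fix x assume "x \<in> fib \<kappa>"
        then have x: "x permutes ?N" "\<And>m. m \<in> ?N \<Longrightarrow> \<kappa> (p (x m)) = Suc (block_of mu m)"
          by (simp_all add: fib_def)
        have "block_of mu (inv' y (x m)) = block_of mu m" if "m \<in> ?N" for m
        proof -
          have "inv' y (x m) \<in> ?N" using that permutes_in_image[OF x(1)] permutes_in_image[OF iy] by simp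
          then have "\<kappa> (p (y (inv' y (x m)))) = Suc (block_of mu (inv' y (x m)))" by (rule y(2))
          moreover have "y (inv' y (x m)) = x m" using permutes_inverses(1)[OF y(1)] .
          ultimately show ?thesis using x(2)[OF that] by simp
        qed
        then show "inv' y \<circ> x \<in> young_subgroup mu"
          using permutes_compose[OF x(1) iy] mu by (simp add: young_subgroup_eq)
      qed
    qed
    then show ?thesis using bij_betw_same_card by fastforce
  qed
  moreover have "fib \<kappa> \<inter> fib \<kappa>' = {}" if "\<kappa> \<in> ?K" "\<kappa>' \<in> ?K" "\<kappa> \<noteq> \<kappa>'" for \<kappa> \<kappa>'
    using fib_col that by blast
  moreover have "finite (fib \<kappa>)" for \<kappa> using finS by (rule finite_subset[rotated]) (auto simp: fib_def)
  ultimately show ?thesis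
    using finK by (simp add: card_UN_disjoint coloring_count_def)
qed

text \<open>This is \<open>A(w) = 1\<close>: the term of \<open>w\<close> in the expansion of an
  immanant of the 0/1 comparison matrix does not vanish.\<close>

definition no_descent :: "(nat \<Rightarrow> nat) \<Rightarrow> bool" where
  "no_descent w \<longleftrightarrow> (\<forall>m\<in>{1..card P}. \<not> strictly_below r (p (w m)) (p m))"

text \<open>After the sums over \<open>w\<close> and over the conjugating \<open>x\<close> are
  exchanged, conjugation by a fixed \<open>x\<close> leaves a signed sum over the Young subgroup,
  for the order carried over to the labels by \<open>p \<circ> x\<close>. It is 1 if every block
  becomes a chain and 0 otherwise. Such \<open>x\<close> number the colorings times the order of the
  subgroup, which cancels the denominator.\<close>

lemma coloring_count_eq_sum:
  assumes mu: "sum_list mu = card P"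
  shows "of_nat (coloring_count (inc P r) mu) =
    (\<Sum>w | w permutes {1..card P}. induced_sign mu w * of_bool (no_descent w))"
proof -
  let ?N = "{1..card P}" and ?H = "young_subgroup mu"
  let ?S = "{w. w permutes ?N}"
  have finS: "finite ?S" by (rule finite_permutations) simp
  define s where "s v = (if v \<in> ?H then of_int (sign v) else (0::complex))" for v
  have inner: "(\<Sum>w\<in>?S. s (inv' x \<circ> w \<circ> x) * of_bool (no_descent w)) =
      of_bool (\<forall>m\<in>?N. \<forall>m'\<in>?N. block_of mu m = block_of mu m' \<longrightarrow> comparable (p (x m)) (p (x m')))"
    if x: "x permutes ?N" for x
  proof -
    interpret X: strict_poset "\<lambda>a b. strictly_below r (p (x a)) (p (x b))"
      by unfold_locales (auto dest: lt_irrefl[THEN notE] lt_trans)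
    \<comment> \<open>Comparability includes equality, which \<open>p\<close> reflects only on
      \<open>?N\<close>, where it is injective.\<close>
    have cmp: "X.comparable a b \<longleftrightarrow> comparable (p (x a)) (p (x b))" if "a \<in> ?N" "b \<in> ?N" for a b
    proof -
      have "x a \<in> ?N" "x b \<in> ?N" using that permutes_in_image[OF x] by blast+
      then have "p (x a) = p (x b) \<longleftrightarrow> a = b" using p_eq_iff permutes_inj[OF x] by (simp add: inj_eq)
      then show ?thesis by (simp add: X.comparable_def comparable_def)
    qed
    have conj: "inv' x \<circ> (x \<circ> v \<circ> inv' x) \<circ> x = v" for v :: "nat \<Rightarrow> nat"
    proof -
      have "inv' x \<circ> (x \<circ> v \<circ> inv' x) \<circ> x = (inv' x \<circ> x) \<circ> v \<circ> (inv' x \<circ> x)" by (simp only: comp_assoc)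
      then show ?thesis by (simp only: permutes_inv_o[OF x] comp_id id_comp)
    qed
    have nd: "no_descent (x \<circ> v \<circ> inv' x) \<longleftrightarrow> (\<forall>m\<in>?N. \<not> strictly_below r (p (x (v m))) (p (x m)))" for v
    proof -
      have "no_descent (x \<circ> v \<circ> inv' x) \<longleftrightarrow> (\<forall>m\<in>x ` ?N. \<not> strictly_below r (p (x (v (inv' x m)))) (p m))"
        unfolding no_descent_def permutes_image[OF x] by simp
      also have "\<dots> \<longleftrightarrow> (\<forall>m\<in>?N. \<not> strictly_below r (p (x (v m))) (p (x m)))"
        using permutes_inverses(2)[OF x] by simp
      finally show ?thesis .
    qed
    have "(\<Sum>w\<in>?S. s (inv' x \<circ> w \<circ> x) * of_bool (no_descent w)) =
        (\<Sum>v\<in>?S. s v * of_bool (\<forall>m\<in>?N. \<not> strictly_below r (p (x (v m))) (p (x m))))"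
      by (subst sum_conjugate[OF x]) (simp only: conj nd)
    also have "\<dots> = (\<Sum>v\<in>?H. s v * of_bool (\<forall>m\<in>?N. \<not> strictly_below r (p (x (v m))) (p (x m))))"
      by (rule sum.mono_neutral_right[OF finS]) (use young_subgroup_permutes[of _ mu] mu in \<open>auto simp: s_def\<close>)
    also have "\<dots> = of_int (\<Sum>v\<in>?H. if \<forall>m\<in>?N. \<not> strictly_below r (p (x (v m))) (p (x m)) then sign v else 0)"
      unfolding of_int_sum by (rule sum.cong) (simp_all add: s_def)
    also have "(\<Sum>v\<in>?H. if \<forall>m\<in>?N. \<not> strictly_below r (p (x (v m))) (p (x m)) then sign v else 0) =
        (if \<forall>m\<in>?N. \<forall>m'\<in>?N. block_of mu m = block_of mu m' \<longrightarrow> X.comparable m m' then 1 else 0)"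
      using X.signed_sum_blocks[of ?N "block_of mu"] mu by (simp add: young_subgroup_eq)
    also have "of_int \<dots> = of_bool (\<forall>m\<in>?N. \<forall>m'\<in>?N. block_of mu m = block_of mu m' \<longrightarrow> comparable (p (x m)) (p (x m')))"
    proof -
      have "(\<forall>m\<in>?N. \<forall>m'\<in>?N. block_of mu m = block_of mu m' \<longrightarrow> X.comparable m m') \<longleftrightarrow>
          (\<forall>m\<in>?N. \<forall>m'\<in>?N. block_of mu m = block_of mu m' \<longrightarrow> comparable (p (x m)) (p (x m')))"
        using cmp by blast
      then show ?thesis by (simp only: of_bool_def if_distrib[of of_int] of_int_1 of_int_0)
    qed
    finally show ?thesis .
  qed
  have pointwise: "induced_sign mu w * of_bool (no_descent w) =
      (\<Sum>x\<in>?S. s (inv' x \<circ> w \<circ> x) * of_bool (no_descent w)) / of_nat (card ?H)" if "w \<in> ?S" for w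
  proof -
    have "induced_sign mu w = (\<Sum>x\<in>?S. s (inv' x \<circ> w \<circ> x)) / of_nat (card ?H)"
      using induced_sign_eq[of w mu] that unfolding s_def mu by simp
    then show ?thesis by (simp only: sum_distrib_right times_divide_eq_left)
  qed
  have "(\<Sum>w\<in>?S. induced_sign mu w * of_bool (no_descent w)) =
      (\<Sum>w\<in>?S. (\<Sum>x\<in>?S. s (inv' x \<circ> w \<circ> x) * of_bool (no_descent w)) / of_nat (card ?H))"
    using pointwise by (rule sum.cong[OF refl])
  also have "\<dots> = (\<Sum>w\<in>?S. (\<Sum>x\<in>?S. s (inv' x \<circ> w \<circ> x) * of_bool (no_descent w))) / of_nat (card ?H)"
    by (rule sum_divide_distrib[symmetric])
  also have "(\<Sum>w\<in>?S. (\<Sum>x\<in>?S. s (inv' x \<circ> w \<circ> x) * of_bool (no_descent w))) =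
      (\<Sum>x\<in>?S. (\<Sum>w\<in>?S. s (inv' x \<circ> w \<circ> x) * of_bool (no_descent w)))"
    by (rule sum.swap)
  also have "\<dots> = (\<Sum>x\<in>?S. of_bool (\<forall>m\<in>?N. \<forall>m'\<in>?N. block_of mu m = block_of mu m' \<longrightarrow> comparable (p (x m)) (p (x m'))))"
    by (rule sum.cong) (use inner in simp_all)
  also have "\<dots> = of_nat (coloring_count (inc P r) mu * card ?H)"
    unfolding card_chain_block_permutations[OF mu, symmetric]
    using finS by (simp add: Collect_conj_eq)
  finally show ?thesis using card_young_subgroup_pos[of mu] by simp
qed

end

section \<open>Tableaux whose rows are cycles\<close>

lemma support_facts:
  assumes "permutation w"
  shows "rotation_of w (support w v)" "distinct (support w v)" "set (support w v) = orbit w v"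
    "hd (support w v) = v"
proof -
  let ?k = "least_power w v"
  have k: "(w ^^ ?k) v = v" "0 < ?k" using least_power_of_permutation[OF assms] by blast+
  show "rotation_of w (support w v)"
    unfolding rotation_of_def
  proof (rule nth_equalityI)
    fix i assume "i < length (map w (support w v))"
    then have i: "i < ?k" by simp
    have "w ((w ^^ i) v) = (w ^^ (Suc i mod ?k)) v"
    proof (cases "Suc i = ?k")
      case True
      then show ?thesis using k(1) by (metis comp_apply funpow.simps(2) funpow_0 mod_self)
    next
      case False
      then show ?thesis using i by simp
    qed
    moreover have "Suc i mod ?k < ?k" using k(2) by simp
    ultimately show "map w (support w v) ! i = rotate1 (support w v) ! i"
      using i by (simp add: nth_rotate1)
  qed simp
  show "distinct (support w v)" by (rule cycle_of_permutation[OF assms])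
  show "set (support w v) = orbit w v"
    unfolding support_set[OF assms] orbit_altdef_permutation[OF assms] by auto
  show "hd (support w v) = v" using k(2) by (simp add: hd_map)
qed

text \<open>Once the list is rotated to begin at \<open>x\<close>, its entries are the successive
  iterates of \<open>w\<close> at \<open>x\<close>, and the next iterate returns to
  \<open>x\<close>.\<close>

lemma orbit_rotation_of:
  assumes "rotation_of w xs" "x \<in> set xs"
  shows "orbit w x = set xs"
proof -
  obtain i where i: "i < length xs" "xs ! i = x" using assms(2) by (auto simp: in_set_conv_nth)
  let ?ys = "rotate i xs"
  have ne: "xs \<noteq> []" using i by auto
  have rot: "rotation_of w ?ys"
    using assms(1) by (simp add: rotation_of_def rotate1_rotate_swap flip: rotate_map)
  have hd: "hd ?ys = x" using i ne by (simp add: hd_conv_nth nth_rotate)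
  have "map (w ^^ length ?ys) ?ys = ?ys" using rotation_of_funpow[OF rot, of "length ?ys"] by simp
  then have "(w ^^ length ?ys) (hd ?ys) = hd ?ys" using ne by (metis hd_map rotate_is_Nil_conv)
  then have "orbit w x = {(w ^^ m) x |m. m < length ?ys}"
    using orbit_altdef_bounded[of "length ?ys" w x] hd ne by simp
  also have "\<dots> = {?ys ! m |m. m < length ?ys}"
    using rotation_of_nth[OF rot] hd by metis
  also have "\<dots> = set ?ys" by (simp only: set_conv_nth)
  also have "\<dots> = set xs" by simp
  finally show ?thesis .
qed

lemma ex_permutation_map:
  assumes "distinct xs" "distinct ys" "set xs = set ys"
  shows "\<exists>y. y permutes set xs \<and> map y xs = ys"
proof -
  have len: "length xs = length ys" using assms distinct_card by metis
  have "list_permutes (zip xs ys) (set xs)"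
    using assms len by simp
  then have "permutation_of_list (zip xs ys) permutes set xs" by (rule permutation_of_list_permutes)
  moreover have "map (permutation_of_list (zip xs ys)) xs = ys"
  proof (rule nth_equalityI)
    fix i assume i: "i < length (map (permutation_of_list (zip xs ys)) xs)"
    then have "(xs ! i, ys ! i) \<in> set (zip xs ys)" using len by (auto simp: set_zip)
    then show "map (permutation_of_list (zip xs ys)) xs ! i = ys ! i"
      using i permutation_of_list_unique'[of "zip xs ys"] assms(1) len by simp
  qed (use len in simp)
  ultimately show ?thesis by blast
qed

text \<open>The permutation sends the reading word of \<open>V\<close> to that of the tableau with
  every row rotated by one. Together with \<open>rotation_of_tableau_unique\<close> it assigns each
  tableau to exactly one permutation.\<close>

lemma ex_rotation_of_tableau:
  assumes "tableau A lam V"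
  shows "\<exists>w. w permutes A \<and> (\<forall>row\<in>set V. rotation_of w row)"
proof -
  let ?xs = "concat V" and ?ys = "concat (map rotate1 V)"
  have xs: "distinct ?xs" "set ?xs = A" using assms by (simp_all add: tableau_def)
  have "set ?ys = set ?xs" by simp
  moreover have "length ?ys = length ?xs" by (simp add: length_concat comp_def)
  ultimately have "distinct ?ys" using xs(1) by (metis card_distinct distinct_card)
  then obtain w where w: "w permutes set ?xs" "map w ?xs = ?ys"
    using ex_permutation_map[OF xs(1)] \<open>set ?ys = set ?xs\<close> by metis
  have "concat (map (map w) V) = concat (map rotate1 V)" using w(2) by (simp add: map_concat)
  then have "map (map w) V = map rotate1 V"
    by (subst (asm) concat_eq_concat_iff) (auto simp: set_zip)
  then show ?thesis using w(1) xs(2) by (auto simp: rotation_of_def)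
qed

lemma rotation_of_tableau_unique:
  assumes V: "tableau A lam V"
    and w: "w permutes A" "\<forall>row\<in>set V. rotation_of w row"
    and w': "w' permutes A" "\<forall>row\<in>set V. rotation_of w' row"
  shows "w = w'"
proof
  fix x
  show "w x = w' x"
  proof (cases "x \<in> A")
    case True
    then obtain row where row: "row \<in> set V" "x \<in> set row" using V by (auto simp: tableau_def)
    then have "map w row = map w' row" using w w' by (simp add: rotation_of_def)
    then show ?thesis using row(2) by simp
  next
    case False
    then show ?thesis using w w' by (simp add: permutes_not_in)
  qed
qed

text \<open>With \<open>B\<close> the set of orbits of a permutation: arrangements of the orbits in
  an order with sizes \<open>lam\<close>, with a starting point in each. Their number is
  \<open>z_number lam\<close> if the sizes fit.\<close>

definition based_lists :: "'a set set \<Rightarrow> nat list \<Rightarrow> ('a set \<times> 'a) list set" where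
  "based_lists B lam = {us. distinct (map fst us) \<and> set (map fst us) = B \<and>
     map (card \<circ> fst) us = lam \<and> (\<forall>u\<in>set us. snd u \<in> fst u)}"

lemma finite_based_lists:
  assumes "finite B" "\<forall>I\<in>B. finite I"
  shows "finite (based_lists B lam)"
proof (rule finite_subset)
  show "based_lists B lam \<subseteq> {us. set us \<subseteq> Sigma B id \<and> length us = length lam}"
  proof clarify
    fix us assume us: "us \<in> based_lists B lam"
    then have "fst u \<in> B \<and> snd u \<in> fst u" if "u \<in> set us" for u
      using that by (auto simp: based_lists_def)
    then have "set us \<subseteq> Sigma B id" by (auto simp: mem_Sigma_iff)
    moreover have "length us = length lam" using us by (auto simp: based_lists_def)
    ultimately show "set us \<subseteq> Sigma B id \<and> length us = length lam" by blast
  qed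
  show "finite {us. set us \<subseteq> Sigma B id \<and> length us = length lam}"
    by (rule finite_lists_length_eq) (use assms in auto)
qed

lemma based_lists_Cons:
  "based_lists B (k # lam) =
     (\<Union>u\<in>Sigma {I \<in> B. card I = k} id. (#) u ` based_lists (B - {fst u}) lam)"
proof (intro equalityI subsetI)
  fix us assume us: "us \<in> based_lists B (k # lam)"
  then obtain u us' where "us = u # us'" by (cases us) (auto simp: based_lists_def)
  with us have us: "u # us' \<in> based_lists B (k # lam)" by simp
  have "u \<in> Sigma {I \<in> B. card I = k} id" using us by (cases u) (auto simp: based_lists_def)
  moreover have "us' \<in> based_lists (B - {fst u}) lam" using us by (auto simp: based_lists_def)
  ultimately show "us \<in> (\<Union>u\<in>Sigma {I \<in> B. card I = k} id. (#) u ` based_lists (B - {fst u}) lam)"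
    unfolding \<open>us = u # us'\<close> by (blast intro: imageI[of _ _ "(#) u"])
next
  fix us assume "us \<in> (\<Union>u\<in>Sigma {I \<in> B. card I = k} id. (#) u ` based_lists (B - {fst u}) lam)"
  then obtain u us' where u: "u \<in> Sigma {I \<in> B. card I = k} id" "us = u # us'"
    and us': "us' \<in> based_lists (B - {fst u}) lam" by blast
  have "fst u \<in> B" "card (fst u) = k" "snd u \<in> fst u" using u(1) by auto
  moreover have "set (map fst us') = B - {fst u}" "distinct (map fst us')"
    "map (card \<circ> fst) us' = lam" "\<forall>u\<in>set us'. snd u \<in> fst u"
    using us' by (simp_all add: based_lists_def)
  moreover from this(1) have "fst u \<notin> set (map fst us')" by blast
  ultimately show "us \<in> based_lists B (k # lam)"
    unfolding based_lists_def u(2) by (simp del: set_map) auto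
qed

text \<open>The first entry is one of \<open>Suc (count_list lam k)\<close> sets of size
  \<open>k\<close> together with one of its \<open>k\<close> points; these are the factors by which
  the right-hand side grows from \<open>lam\<close> to \<open>k # lam\<close>. The product runs over
  a fixed \<open>S\<close> so that its index set does not change during the induction.\<close>

lemma card_based_lists:
  assumes "finite B" "\<forall>I\<in>B. finite I" "image_mset card (mset_set B) = mset lam"
    and S: "finite S" "set lam \<subseteq> S"
  shows "card (based_lists B lam) = prod_list lam * (\<Prod>i\<in>S. fact (count_list lam i))"
  using assms
proof (induction lam arbitrary: B)
  case Nil
  then have "B = {}" by (simp add: mset_set_empty_iff)
  then have "based_lists B [] = {[]}" by (auto simp: based_lists_def)
  then show ?case by simp
next
  case (Cons k lam)
  let ?z = "prod_list lam * (\<Prod>i\<in>S. fact (count_list lam i))"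
  let ?U = "Sigma {I \<in> B. card I = k} id"
  have IH: "card (based_lists (B - {fst u}) lam) = ?z" if "u \<in> ?U" for u
  proof -
    have u: "fst u \<in> B" "card (fst u) = k" using that by auto
    have "mset_set B = add_mset (fst u) (mset_set (B - {fst u}))"
      using mset_set.remove[OF Cons.prems(1) u(1)] by simp
    then have "image_mset card (mset_set (B - {fst u})) = mset lam"
      using Cons.prems(3) u(2) by simp
    then show ?thesis using Cons.IH[of "B - {fst u}"] Cons.prems by simp
  qed
  have finU: "finite ?U" using Cons.prems(1,2) by auto
  have "card (based_lists B (k # lam)) = (\<Sum>u\<in>?U. card ((#) u ` based_lists (B - {fst u}) lam))"
    unfolding based_lists_Cons
  proof (rule card_UN_disjoint[OF finU])
    show "\<forall>u\<in>?U. finite ((#) u ` based_lists (B - {fst u}) lam)"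
      using Cons.prems(1,2) by (intro ballI finite_imageI finite_based_lists) auto
  qed auto
  also have "\<dots> = (\<Sum>u\<in>?U. ?z)"
    by (rule sum.cong[OF refl]) (simp add: card_image IH)
  also have "\<dots> = card ?U * ?z" by simp
  also have "card ?U = (\<Sum>I | I \<in> B \<and> card I = k. card I)"
    using Cons.prems(1,2) by (subst card_SigmaI) auto
  also have "\<dots> = k * card {I \<in> B. card I = k}" by simp
  also have "card {I \<in> B. card I = k} = Suc (count_list lam k)"
    using count_image_mset_set[OF Cons.prems(1), of card k] Cons.prems(3) by (simp add: count_mset)
  also have "k * Suc (count_list lam k) * ?z =
      prod_list (k # lam) * (Suc (count_list lam k) * (\<Prod>i\<in>S. fact (count_list lam i)))"
    by (simp add: algebra_simps)
  also have "Suc (count_list lam k) * (\<Prod>i\<in>S. fact (count_list lam i)) =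
      (\<Prod>i\<in>S. fact (count_list (k # lam) i))"
  proof -
    have k: "k \<in> S" using Cons.prems(5) by simp
    have "(\<Prod>i\<in>S - {k}. fact (count_list (k # lam) i)) = (\<Prod>i\<in>S - {k}. fact (count_list lam i) :: nat)"
      by (rule prod.cong) auto
    then show ?thesis
      by (simp add: prod.remove[OF S(1) k] algebra_simps)
  qed
  finally show ?case .
qed

lemma orbit_eq_or_disjoint:
  assumes "permutation w"
  shows "orbit w a = orbit w b \<or> orbit w a \<inter> orbit w b = {}"
proof -
  have "orbit w x = orbit w a" if "x \<in> orbit w a" for x a
    using orbit_rotation_of[OF support_facts(1)[OF assms], of x a] support_facts(3)[OF assms] that by simp
  then show ?thesis by blast
qed

text \<open>A row that is a cycle of \<open>w\<close> is determined by its orbit and its first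
  entry, so these tableaux amount to orderings of the orbits with a point chosen in each. No
  ordering has shape \<open>lam\<close> unless the cycle type is \<open>lam\<close>.\<close>

lemma card_rotation_tableaux:
  assumes w: "w permutes {1..sum_list lam}" and pos: "\<forall>k\<in>set lam. 0 < k"
  shows "card {V. tableau {1..sum_list lam} lam V \<and> (\<forall>row\<in>set V. rotation_of w row)} =
    (if cycle_type (sum_list lam) w = mset lam then z_number lam else 0)"
proof -
  let ?N = "{1..sum_list lam}"
  let ?B = "orbit w ` ?N"
  have pw: "permutation w" using w permutation_permutes by blast
  note sup = support_facts[OF pw]
  have self: "m \<in> orbit w m" for m by (rule permutation_self_in_orbit[OF pw])
  have orbN: "orbit w m \<subseteq> ?N" if "m \<in> ?N" for m using permutes_orbit_subset[OF w that] .
  have finB: "finite ?B" "\<forall>I\<in>?B. finite I" using orbN finite_subset by blast+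
  have "card {V. tableau ?N lam V \<and> (\<forall>row\<in>set V. rotation_of w row)} =
      card (structures set (\<lambda>row. distinct row \<and> rotation_of w row) ?N lam)"
    by (simp only: tableau_structures)
  also have "\<dots> = card (structures fst (\<lambda>u. fst u \<in> ?B \<and> snd u \<in> fst u) ?N lam)"
  proof (rule card_structures_eq[OF pos])
    fix I assume I: "I \<subseteq> ?N" "finite I" "I \<noteq> {}"
    let ?L = "{row. set row = I \<and> distinct row \<and> rotation_of w row}"
    let ?R = "{u. fst u = I \<and> fst u \<in> ?B \<and> snd u \<in> fst u}"
    show "finite ?L" by (rule finite_subset[OF _ finite_subset_distinct[OF I(2)]]) auto
    show "finite ?R" by (rule finite_subset[of _ "{I} \<times> I"]) (use I in auto)
    have "bij_betw (\<lambda>row. (I, hd row)) ?L ?R"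
      unfolding bij_betw_def
    proof
      show "inj_on (\<lambda>row. (I, hd row)) ?L"
      proof (rule inj_onI)
        fix xs ys assume *: "xs \<in> ?L" "ys \<in> ?L" "(I, hd xs) = (I, hd ys)"
        then have "length xs = card I" "length ys = card I" using distinct_card[of xs] distinct_card[of ys] by simp_all
        then have "length xs = length ys" by simp
        then show "xs = ys" using * rotation_of_unique by blast
      qed
      show "(\<lambda>row. (I, hd row)) ` ?L = ?R"
      proof (intro equalityI subsetI)
        fix u assume "u \<in> (\<lambda>row. (I, hd row)) ` ?L"
        then obtain row where row: "u = (I, hd row)" "set row = I" "rotation_of w row" by blast
        have h: "hd row \<in> set row" using row(2) I(3) by (intro hd_in_set) auto
        have "orbit w (hd row) = I" using orbit_rotation_of[OF row(3) h] row(2) by simp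
        moreover have "hd row \<in> ?N" using h row(2) I(1) by blast
        ultimately have "I \<in> ?B" by blast
        then show "u \<in> ?R" using row h by simp
      next
        fix u assume u: "u \<in> ?R"
        then obtain m where m: "m \<in> ?N" "I = orbit w m" by blast
        obtain v where v: "u = (I, v)" "v \<in> I" using u by (cases u) auto
        have "orbit w v = I" using orbit_eq_or_disjoint[OF pw, of v m] self[of v] v(2) m(2) by blast
        then have "support w v \<in> ?L" using sup by blast
        then show "u \<in> (\<lambda>row. (I, hd row)) ` ?L"
          using v(1) sup(4)[of v] by (intro image_eqI[of _ _ "support w v"]) (simp only:)
      qed
    qed
    then show "card ?L = card ?R" by (rule bij_betw_same_card)
  qed
  \<comment> \<open>Orbits are nonempty and partition \<open>?N\<close>, so a list of orbits is an
    ordered set partition exactly when it contains each orbit once.\<close>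
  also have "structures fst (\<lambda>u. fst u \<in> ?B \<and> snd u \<in> fst u) ?N lam = based_lists ?B lam"
  proof (intro equalityI subsetI)
    fix us assume us: "us \<in> structures fst (\<lambda>u. fst u \<in> ?B \<and> snd u \<in> fst u) ?N lam"
    then have all: "\<And>u. u \<in> set us \<Longrightarrow> fst u \<in> ?B \<and> snd u \<in> fst u"
      and lam: "map card (map fst us) = lam" and Un: "\<Union> (set (map fst us)) = ?N"
      and disj: "pairwise_disjoint_list (map fst us)"
      unfolding structures_def ordered_set_partition_alt by blast+
    have "distinct (map fst us)"
      unfolding distinct_conv_nth
    proof (intro allI impI)
      fix i j assume ij: "i < length (map fst us)" "j < length (map fst us)" "i \<noteq> j"
      then have "map fst us ! i \<inter> map fst us ! j = {}"
        using disj unfolding pairwise_disjoint_list_def by blast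
      moreover have "map fst us ! i \<noteq> {}" using all[OF nth_mem[of i us]] ij by auto
      ultimately show "map fst us ! i \<noteq> map fst us ! j" by auto
    qed
    moreover have "set (map fst us) = ?B"
    proof
      show "set (map fst us) \<subseteq> ?B" using all by auto
      show "?B \<subseteq> set (map fst us)"
      proof
        fix I assume "I \<in> ?B"
        then obtain m where m: "m \<in> ?N" "I = orbit w m" by blast
        then obtain J where J: "J \<in> set (map fst us)" "m \<in> J" using Un by blast
        then have "J \<in> ?B" using all by fastforce
        then obtain m' where "J = orbit w m'" by blast
        then have "J = I" using orbit_eq_or_disjoint[OF pw, of m m'] self[of m] J m by blast
        then show "I \<in> set (map fst us)" using J by simp
      qed
    qed
    ultimately show "us \<in> based_lists ?B lam" using lam all by (simp add: based_lists_def del: set_map)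
  next
    fix us assume us: "us \<in> based_lists ?B lam"
    then have d: "distinct (map fst us)" and set: "set (map fst us) = ?B"
      and lam: "map (card \<circ> fst) us = lam" and mem: "\<forall>u\<in>set us. snd u \<in> fst u"
      unfolding based_lists_def by blast+
    have "\<Union> ?B = ?N" using orbN self by blast
    moreover have "pairwise_disjoint_list (map fst us)"
      unfolding pairwise_disjoint_list_def
    proof (intro allI impI)
      fix i j assume ij: "i < length (map fst us)" "j < length (map fst us)" "i \<noteq> j"
      have "map fst us ! i \<in> ?B" "map fst us ! j \<in> ?B"
        using nth_mem[OF ij(1)] nth_mem[OF ij(2)] unfolding set .
      moreover have "map fst us ! i \<noteq> map fst us ! j"
        using nth_eq_iff_index_eq[OF d ij(1,2)] ij(3) by blast
      ultimately show "map fst us ! i \<inter> map fst us ! j = {}" using orbit_eq_or_disjoint[OF pw] by blast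
    qed
    moreover have "fst u \<in> ?B" if "u \<in> set us" for u
    proof -
      have "fst u \<in> set (map fst us)" using that by simp
      then show ?thesis unfolding set .
    qed
    ultimately show "us \<in> structures fst (\<lambda>u. fst u \<in> ?B \<and> snd u \<in> fst u) ?N lam"
      using lam mem unfolding structures_def ordered_set_partition_alt set mem_Collect_eq map_map by blast
  qed
  also have "card (based_lists ?B lam) = (if cycle_type (sum_list lam) w = mset lam then z_number lam else 0)"
  proof (cases "cycle_type (sum_list lam) w = mset lam")
    case True
    have "set lam \<subseteq> ?N" using pos member_le_sum_list by fastforce
    then show ?thesis
      using card_based_lists[OF finB, of lam ?N] True by (simp add: cycle_type_def z_number_def)
  next
    case False
    have "based_lists ?B lam = {}"
    proof (rule ccontr)
      assume "based_lists ?B lam \<noteq> {}"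
      then obtain us where "us \<in> based_lists ?B lam" by blast
      then have us: "distinct (map fst us)" "set (map fst us) = ?B" "map card (map fst us) = lam"
        by (simp_all only: based_lists_def mem_Collect_eq map_map)
      have "mset lam = image_mset card (mset (map fst us))" by (simp only: us(3)[symmetric] mset_map)
      also have "mset (map fst us) = mset_set ?B" using mset_set_set[OF us(1)] us(2) by simp
      finally show False using False by (simp add: cycle_type_def)
    qed
    then show ?thesis using False by simp
  qed
  finally show ?thesis .
qed

lemma finite_tableaux:
  assumes "finite A"
  shows "finite {V. tableau A lam V}"
proof (rule finite_subset)
  show "{V. tableau A lam V} \<subseteq> {V. set V \<subseteq> {row. set row \<subseteq> A \<and> distinct row} \<and> length V = length lam}"
    by (auto simp: tableau_def distinct_concat_pairwise)
  show "finite {V. set V \<subseteq> {row. set row \<subseteq> A \<and> distinct row} \<and> length V = length lam}"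
    by (rule finite_lists_length_eq[OF finite_subset_distinct[OF assms]])
qed

context labelled_poset_graph begin

text \<open>The value at \<open>w\<close> counts the tableaux whose rows are the cycles of
  \<open>w\<close>. Since \<open>w\<close> maps each entry to the next one in its row, cyclically,
  absence of descents of \<open>w\<close> is a property of the tableau, and the sum over
  \<open>w\<close> collects each tableau once.\<close>

lemma sum_power_sum_trace:
  assumes lam: "sum_list lam = card P" and pos: "\<forall>k\<in>set lam. 0 < k"
  shows "(\<Sum>w | w permutes {1..card P}. power_sum_trace lam w * of_bool (no_descent w)) =
    of_nat (card {U. tableau P lam U \<and> cyclically_row_semistrict r U})"
proof -
  let ?N = "{1..card P}"
  let ?S = "{w. w permutes ?N}"
  let ?T = "\<lambda>w. {V. tableau ?N lam V \<and> (\<forall>row\<in>set V. rotation_of w row)}"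
  define good where "good V \<longleftrightarrow> (\<forall>row\<in>set V. cyclically_semistrict (map p row))" for V
  have nd: "no_descent w \<longleftrightarrow> good V" if V: "V \<in> ?T w" for w V
  proof -
    have N: "?N = (\<Union>row\<in>set V. set row)" using V by (auto simp: tableau_def)
    have "cyclically_semistrict (map p row) \<longleftrightarrow> (\<forall>m\<in>set row. \<not> strictly_below r (p (w m)) (p m))"
      if "row \<in> set V" for row
    proof -
      have "rotate1 row = map w row" using V that by (simp add: rotation_of_def)
      then have "rotate1 (map p row) = map p (map w row)" by (simp add: rotate1_map)
      then show ?thesis
        unfolding cyclically_semistrict_def by (auto simp: list_all2_conv_all_nth all_set_conv_all_nth)
    qed
    then show ?thesis unfolding no_descent_def good_def N by blast
  qed
  have "power_sum_trace lam w * of_bool (no_descent w) = of_nat (card {V \<in> ?T w. good V})"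
    if "w \<in> ?S" for w
  proof -
    have "power_sum_trace lam w = of_nat (card (?T w))"
      using card_rotation_tableaux[of w lam] that pos lam by (simp add: power_sum_trace_def)
    moreover have "{V \<in> ?T w. good V} = (if no_descent w then ?T w else {})" using nd by auto
    ultimately show ?thesis by simp
  qed
  then have "(\<Sum>w\<in>?S. power_sum_trace lam w * of_bool (no_descent w)) =
      of_nat (\<Sum>w\<in>?S. card {V \<in> ?T w. good V})" by simp
  also have "(\<Sum>w\<in>?S. card {V \<in> ?T w. good V}) = card (\<Union>w\<in>?S. {V \<in> ?T w. good V})"
  proof (rule card_UN_disjoint[symmetric])
    show "finite ?S" by (rule finite_permutations) simp
    have "finite {V. tableau ?N lam V}" by (rule finite_tableaux) simp
    then show "\<forall>w\<in>?S. finite {V \<in> ?T w. good V}" by simp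
    show "\<forall>w\<in>?S. \<forall>w'\<in>?S. w \<noteq> w' \<longrightarrow> {V \<in> ?T w. good V} \<inter> {V \<in> ?T w'. good V} = {}"
      using rotation_of_tableau_unique by blast
  qed
  also have "(\<Union>w\<in>?S. {V \<in> ?T w. good V}) = {V. tableau ?N lam V \<and> good V}"
  proof (intro equalityI subsetI)
    fix V assume "V \<in> {V. tableau ?N lam V \<and> good V}"
    then have V: "tableau ?N lam V" "good V" by simp_all
    then obtain w where "w permutes ?N" "\<forall>row\<in>set V. rotation_of w row"
      using ex_rotation_of_tableau[OF V(1)] by (elim exE conjE)
    then show "V \<in> (\<Union>w\<in>?S. {V \<in> ?T w. good V})" using V by (intro UN_I[of w]) simp_all
  qed simp
  also have "card \<dots> = card {U. tableau P lam U \<and> cyclically_row_semistrict r U}"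
  proof (rule bij_betw_same_card)
    define q where "q = inv_into ?N p"
    have pq: "p (q v) = v" if "v \<in> P" for v
      using bij_betw_inv_into_right[OF bij_p that] by (simp add: q_def)
    have qp: "q (p m) = m" if "m \<in> ?N" for m
      using bij_betw_inv_into_left[OF bij_p that] by (simp add: q_def)
    have bq: "bij_betw q P ?N" unfolding q_def by (rule bij_betw_inv_into[OF bij_p])
    have tab: "tableau B lam (map (map f) V)" if "bij_betw f A B" "tableau A lam V" for f A B and V :: "'c list list"
      using that by (auto simp: tableau_def comp_def bij_betw_def distinct_map simp flip: map_concat)
    have id: "map (map f) V = V" if "tableau A lam V" "\<And>a. a \<in> A \<Longrightarrow> f a = a" for f A and V :: "'c list list"
      using that by (intro map_idI) (auto simp: tableau_def)
    have cyc: "cyclically_row_semistrict r U \<longleftrightarrow> (\<forall>row\<in>set U. cyclically_semistrict row)" if "tableau P lam U" for U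
      by (rule cyclically_row_semistrict_iff) (use tableau_row_nonempty[OF that pos] in blast)
    show "bij_betw (map (map p)) {V. tableau ?N lam V \<and> good V} {U. tableau P lam U \<and> cyclically_row_semistrict r U}"
    proof (rule bij_betw_byWitness[where f' = "map (map q)"])
      show "\<forall>V\<in>{V. tableau ?N lam V \<and> good V}. map (map q) (map (map p) V) = V"
        using id[of ?N _ "q \<circ> p"] qp by (auto simp: comp_def)
      show inv: "\<forall>U\<in>{U. tableau P lam U \<and> cyclically_row_semistrict r U}. map (map p) (map (map q) U) = U"
        using id[of P _ "p \<circ> q"] pq by (auto simp: comp_def)
      show "map (map p) ` {V. tableau ?N lam V \<and> good V} \<subseteq> {U. tableau P lam U \<and> cyclically_row_semistrict r U}"
        using tab[OF bij_p] cyc by (auto simp: good_def)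
      show "map (map q) ` {U. tableau P lam U \<and> cyclically_row_semistrict r U} \<subseteq> {V. tableau ?N lam V \<and> good V}"
      proof clarify
        fix U assume U: "tableau P lam U" "cyclically_row_semistrict r U"
        then have eq: "map (map p) (map (map q) U) = U" using inv by blast
        have gd: "good V \<longleftrightarrow> (\<forall>row\<in>set (map (map p) V). cyclically_semistrict row)" for V
          by (simp add: good_def)
        have "good (map (map q) U) \<longleftrightarrow> (\<forall>row\<in>set U. cyclically_semistrict row)"
          using gd[of "map (map q) U"] by (simp only: eq)
        then have "good (map (map q) U)" using cyc[OF U(1)] U(2) by blast
        then show "tableau ?N lam (map (map q) U) \<and> good (map (map q) U)" using tab[OF bq U(1)] by blast
      qed
    qed
  qed
  finally show ?thesis .
qed

end

section \<open>Expanding class functions in induced sign characters\<close>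

lemma prod_list_pos_nat: "\<forall>k\<in>set lam. 0 < k \<Longrightarrow> 0 < prod_list (lam :: nat list)"
  by (induction lam) auto

lemma z_number_pos: "\<forall>k\<in>set lam. 0 < k \<Longrightarrow> 0 < z_number lam"
  by (simp add: z_number_def prod_list_pos_nat prod_pos)

lemma partition_eqI:
  assumes "lam \<turnstile>\<^sub>p n" "mu \<turnstile>\<^sub>p n" "mset lam = mset mu"
  shows "lam = mu"
proof -
  have "sorted (rev lam)" "sorted (rev mu)"
    using assms(1,2) by (simp_all add: is_partition_def sorted_wrt_rev)
  moreover have "mset (rev lam) = mset (rev mu)" using assms(3) by simp
  ultimately have "rev lam = rev mu" by (metis properties_for_sort sorted_sort_id)
  then show ?thesis by simp
qed

lemma length_le_sum_list: "\<forall>k\<in>set lam. 0 < k \<Longrightarrow> length lam \<le> sum_list (lam :: nat list)"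
  by (induction lam) force+

lemma finite_partitions: "finite {lam. lam \<turnstile>\<^sub>p n}"
proof (rule finite_subset)
  show "{lam. lam \<turnstile>\<^sub>p n} \<subseteq> {lam. set lam \<subseteq> {..n} \<and> length lam \<le> n}"
    using length_le_sum_list member_le_sum_list by (fastforce simp: is_partition_def)
  show "finite {lam. set lam \<subseteq> {..n} \<and> length lam \<le> n}"
    by (rule finite_lists_length_le) simp
qed

lemma cycle_type_partition:
  assumes w: "w permutes {1..n}"
  shows "\<exists>lam. lam \<turnstile>\<^sub>p n \<and> mset lam = cycle_type n w"
proof -
  let ?B = "orbit w ` {1..n}"
  have pw: "permutation w" using w permutation_permutes by blast
  have orbN: "orbit w m \<subseteq> {1..n}" if "m \<in> {1..n}" for m using permutes_orbit_subset[OF w that] .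
  have self: "m \<in> orbit w m" for m by (rule permutation_self_in_orbit[OF pw])
  have fin: "finite I" if "I \<in> ?B" for I using that orbN finite_subset by blast
  have "sum_mset (cycle_type n w) = sum card ?B" by (simp add: cycle_type_def sum_unfold_sum_mset)
  also have "\<dots> = card (\<Union> ?B)"
    by (rule card_Union_disjoint[symmetric])
      (use orbit_eq_or_disjoint[OF pw] fin in \<open>auto simp: pairwise_def disjnt_def\<close>)
  also have "\<Union> ?B = {1..n}" using orbN self by blast
  finally have sum: "sum_mset (cycle_type n w) = n" by simp
  have pos: "0 < k" if "k \<in># cycle_type n w" for k
  proof -
    have "k \<in> card ` ?B" using that by (simp add: cycle_type_def)
    then obtain I where "I \<in> ?B" "k = card I" by blast
    moreover from this have "I \<noteq> {}" using self by blast
    ultimately show ?thesis using fin card_gt_0_iff by blast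
  qed
  let ?lam = "rev (sorted_list_of_multiset (cycle_type n w))"
  have mset: "mset ?lam = cycle_type n w" by simp
  have "sum_list ?lam = n" using sum mset by (metis sum_mset_sum_list)
  moreover have "\<forall>k\<in>set ?lam. 0 < k" using pos by simp
  ultimately have "?lam \<turnstile>\<^sub>p n" by (simp add: is_partition_def sorted_wrt_rev)
  with mset show ?thesis by blast
qed

lemma size_cycle_type: "size (cycle_type n w) = card (orbit w ` {1..n})"
  by (simp add: cycle_type_def)

text \<open>Both permutations have tableaux of the same shape whose rows are their cycles, because
  \<open>z_number\<close> is positive. Replacing the entries of one tableau by those of the other is
  the conjugating permutation.\<close>

lemma ex_conjugation:
  assumes "w permutes {1..n}" "w' permutes {1..n}" "cycle_type n w = cycle_type n w'"
  shows "\<exists>y. y permutes {1..n} \<and> w' = y \<circ> w \<circ> inv' y"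
proof -
  obtain lam where lam: "lam \<turnstile>\<^sub>p n" "mset lam = cycle_type n w"
    using cycle_type_partition[OF assms(1)] by blast
  have n: "sum_list lam = n" and pos: "\<forall>k\<in>set lam. 0 < k"
    using lam(1) by (simp_all add: is_partition_def)
  have ex: "\<exists>V. tableau {1..n} lam V \<and> (\<forall>row\<in>set V. rotation_of v row)"
    if "v permutes {1..n}" "cycle_type n v = mset lam" for v
  proof -
    have "card {V. tableau {1..n} lam V \<and> (\<forall>row\<in>set V. rotation_of v row)} \<noteq> 0"
      using card_rotation_tableaux[of v lam] that n pos z_number_pos[OF pos] by simp
    then show ?thesis by (metis (no_types, lifting) card.empty empty_Collect_eq)
  qed
  obtain V where V: "tableau {1..n} lam V" "\<forall>row\<in>set V. rotation_of w row"
    using ex[OF assms(1)] lam(2) by auto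
  obtain V' where V': "tableau {1..n} lam V'" "\<forall>row\<in>set V'. rotation_of w' row"
    using ex[OF assms(2)] lam(2) assms(3) by auto
  have cV: "distinct (concat V)" "set (concat V) = {1..n}" "map length V = lam"
    using V(1) by (simp_all only: tableau_def)
  have cV': "distinct (concat V')" "set (concat V') = {1..n}" "map length V' = lam"
    using V'(1) by (simp_all only: tableau_def)
  obtain y where y: "y permutes {1..n}" "map y (concat V) = concat V'"
    using ex_permutation_map[OF cV(1) cV'(1)] cV(2) cV'(2) by auto
  have "concat (map (map y) V) = concat V'" using y(2) by (simp add: map_concat)
  moreover have len: "map length (map (map y) V) = map length V'"
    using cV(3) cV'(3) by (simp add: comp_def)
  moreover have "length u = length u'" if uu: "(u, u') \<in> set (zip (map (map y) V) V')" for u u'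
  proof -
    obtain i where i: "i < length (map (map y) V)" "i < length V'" "u = map (map y) V ! i" "u' = V' ! i"
      using uu[unfolded in_set_zip fst_conv snd_conv] by blast
    have "map length (map (map y) V) ! i = map length V' ! i" by (simp only: len)
    then show ?thesis using i by simp
  qed
  ultimately have yV: "map (map y) V = V'"
    using map_eq_imp_length_eq[OF len] by (intro concat_injective) auto
  have yw: "y (w m) = w' (y m)" if "m \<in> {1..n}" for m
  proof -
    have "m \<in> set (concat V)" unfolding cV(2) by (rule that)
    then obtain row where row: "row \<in> set V" "m \<in> set row" by auto
    have "map y row \<in> set V'" using row(1) yV by auto
    then have "map w' (map y row) = rotate1 (map y row)" using V'(2) unfolding rotation_of_def by blast
    also have "\<dots> = map y (map w row)" using V(2) row(1) by (simp add: rotation_of_def rotate1_map del: map_map)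
    finally have "map (\<lambda>m. w' (y m)) row = map (\<lambda>m. y (w m)) row" by (simp add: comp_def)
    then show ?thesis using row(2) by (simp only: map_eq_conv)
  qed
  have "w' m = (y \<circ> w \<circ> inv' y) m" for m
  proof (cases "m \<in> {1..n}")
    case True
    then have "inv' y m \<in> {1..n}" using permutes_in_image[OF permutes_inv[OF y(1)]] by simp
    then show ?thesis using yw permutes_inverses(1)[OF y(1)] by simp
  next
    case False
    then have "inv' y m = m" "w m = m" "y m = m" "w' m = m"
      using permutes_not_in assms(1,2) y(1) permutes_inv[OF y(1)] by metis+
    then show ?thesis by simp
  qed
  then show ?thesis using y(1) by blast
qed

text \<open>Stated through cycle types, so that power sum traces qualify by definition; for induced
  characters the passage from conjugation to cycle types is \<open>ex_conjugation\<close>.\<close>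

definition class_function :: "nat \<Rightarrow> ((nat \<Rightarrow> nat) \<Rightarrow> 'b) \<Rightarrow> bool" where
  "class_function n \<theta> \<longleftrightarrow> (\<forall>w w'. w permutes {1..n} \<longrightarrow> w' permutes {1..n} \<longrightarrow>
     cycle_type n w = cycle_type n w' \<longrightarrow> \<theta> w = \<theta> w')"

lemma class_functionD:
  "class_function n \<theta> \<Longrightarrow> w permutes {1..n} \<Longrightarrow> w' permutes {1..n} \<Longrightarrow>
    cycle_type n w = cycle_type n w' \<Longrightarrow> \<theta> w = \<theta> w'"
  unfolding class_function_def by blast

lemma class_function_induced_sign: "class_function (sum_list mu) (induced_sign mu)"
  unfolding class_function_def
proof (intro allI impI)
  let ?N = "{1..sum_list mu}"
  fix w w' assume w: "w permutes ?N" "w' permutes ?N" "cycle_type (sum_list mu) w = cycle_type (sum_list mu) w'"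
  then obtain y where y: "y permutes ?N" "w' = y \<circ> w \<circ> inv' y" using ex_conjugation by blast
  let ?g = "\<lambda>v. if v \<in> young_subgroup mu then of_int (sign v) else (0 :: complex)"
  have "(\<Sum>x | x permutes ?N. ?g (inv' x \<circ> w \<circ> x)) = (\<Sum>x | x permutes ?N. ?g (inv' x \<circ> w' \<circ> x))"
  proof (rule sum.reindex_bij_witness[of _ "\<lambda>x. inv' y \<circ> x" "\<lambda>x. y \<circ> x"])
    show "inv' y \<circ> (y \<circ> x) = x" for x :: "nat \<Rightarrow> nat"
      using permutes_inv_o[OF y(1)] by (simp flip: comp_assoc)
    show "y \<circ> (inv' y \<circ> x) = x" for x :: "nat \<Rightarrow> nat"
      using permutes_inv_o[OF y(1)] by (simp flip: comp_assoc)
    show "y \<circ> x \<in> {x. x permutes ?N}" if "x \<in> {x. x permutes ?N}" for x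
      using that y(1) by (simp add: permutes_compose)
    show "inv' y \<circ> x \<in> {x. x permutes ?N}" if "x \<in> {x. x permutes ?N}" for x
      using that permutes_inv[OF y(1)] by (simp add: permutes_compose)
    show "?g (inv' (y \<circ> x) \<circ> w' \<circ> (y \<circ> x)) = ?g (inv' x \<circ> w \<circ> x)" if "x \<in> {x. x permutes ?N}" for x
    proof -
      have "inv' (y \<circ> x) = inv' x \<circ> inv' y"
        using that y(1) by (intro o_inv_distrib) (auto intro: permutes_bij)
      then have "inv' (y \<circ> x) \<circ> w' \<circ> (y \<circ> x) = inv' x \<circ> (inv' y \<circ> y) \<circ> w \<circ> (inv' y \<circ> y) \<circ> x"
        unfolding y(2) by (simp only: comp_assoc)
      also have "\<dots> = inv' x \<circ> w \<circ> x" by (simp only: permutes_inv_o[OF y(1)] comp_id)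
      finally show ?thesis by (simp only:)
    qed
  qed
  then show "induced_sign mu w = induced_sign mu w'"
    unfolding induced_sign_eq[OF w(1)] induced_sign_eq[OF w(2)] by (simp only:)
qed

text \<open>A permutation conjugate into a Young subgroup has a cycle type refining the partition.\<close>

lemma induced_sign_nonzero:
  assumes mu: "mu \<turnstile>\<^sub>p n" and w: "w permutes {1..n}" and nz: "induced_sign mu w \<noteq> 0"
  shows "length mu \<le> size (cycle_type n w)"
    and "size (cycle_type n w) = length mu \<Longrightarrow> cycle_type n w = mset mu"
proof -
  let ?N = "{1..n}" and ?B = "orbit w ` {1..n}"
  have n: "sum_list mu = n" and pos: "\<forall>k\<in>set mu. 0 < k" using mu by (simp_all add: is_partition_def)
  have pw: "permutation w" using w permutation_permutes by blast
  have self: "m \<in> orbit w m" for m by (rule permutation_self_in_orbit[OF pw])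
  have "\<exists>x. x permutes ?N \<and> inv' x \<circ> w \<circ> x \<in> young_subgroup mu"
  proof (rule ccontr)
    assume "\<nexists>x. x permutes ?N \<and> inv' x \<circ> w \<circ> x \<in> young_subgroup mu"
    then have "induced_sign mu w = 0" using induced_sign_eq[of w mu] w n by simp
    with nz show False ..
  qed
  then obtain x where x: "x permutes ?N" "inv' x \<circ> w \<circ> x \<in> young_subgroup mu" by blast
  note ix = permutes_inverses[OF x(1)]
  have ixN: "inv' x m \<in> ?N" if "m \<in> ?N" for m
    using that permutes_in_image[OF permutes_inv[OF x(1)]] by simp
  \<comment> \<open>Block function carried along \<open>x\<close>; it is constant on the orbits of
    \<open>w\<close>, because the conjugate of \<open>w\<close> preserves the Young blocks.\<close>
  define g where "g m = block_of mu (inv' x m)" for m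
  have gw: "g (w m) = g m" if "m \<in> ?N" for m
  proof -
    have "block_of mu ((inv' x \<circ> w \<circ> x) (inv' x m)) = block_of mu (inv' x m)"
      using x(2) ixN[OF that] unfolding young_subgroup_eq n by blast
    then show ?thesis by (simp add: g_def ix(1))
  qed
  have gpow: "(w ^^ k) m \<in> ?N \<and> g ((w ^^ k) m) = g m" if "m \<in> ?N" for k m
    using that gw permutes_in_image[OF w] by (induction k) auto
  have gorb: "z \<in> ?N \<and> g z = g m" if "m \<in> ?N" "z \<in> orbit w m" for m z
    using that gpow unfolding orbit_altdef_permutation[OF pw] by blast
  have gless: "g m < length mu" if "m \<in> ?N" for m
    using block_of_less[of "inv' x m" mu] ixN[OF that] n by (simp add: g_def)
  have fiber: "{m \<in> ?N. g m = i} = x ` young_block mu i" if i: "i < length mu" for i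
  proof (intro equalityI subsetI)
    fix m assume m: "m \<in> {m \<in> ?N. g m = i}"
    then have "inv' x m \<in> young_block mu i"
      unfolding young_block_eq[OF that] n using ixN by (simp add: g_def)
    then have "x (inv' x m) \<in> x ` young_block mu i" by (rule imageI)
    then show "m \<in> x ` young_block mu i" by (simp only: ix(1))
  next
    fix m assume "m \<in> x ` young_block mu i"
    then obtain m' where "m = x m'" "m' \<in> ?N" "block_of mu m' = i"
      unfolding young_block_eq[OF i] n by blast
    then show "m \<in> {m \<in> ?N. g m = i}"
      using permutes_in_image[OF x(1), of m'] ix(2) by (simp add: g_def)
  qed
  have card_fiber: "card {m \<in> ?N. g m = i} = mu ! i" if "i < length mu" for i
    unfolding fiber[OF that] using card_young_block[OF that] permutes_inj_on[OF x(1)]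
    by (simp add: card_image)
  \<comment> \<open>The induced map from orbits to blocks is onto, as the parts of \<open>mu\<close>
    are positive, which gives the inequality. With equal numbers it is bijective, so every orbit
    fills its block and has the size of a part.\<close>
  define h where "h I = g (SOME m. m \<in> I)" for I
  have h: "h (orbit w m) = g m" if "m \<in> ?N" for m
    using gorb[OF that, of "SOME z. z \<in> orbit w m"] someI[of "\<lambda>z. z \<in> orbit w m", OF self] by (simp add: h_def)
  have hB: "h ` ?B = {..<length mu}"
  proof (intro equalityI subsetI)
    fix i assume "i \<in> h ` ?B"
    then show "i \<in> {..<length mu}" using h gless by auto
  next
    fix i assume "i \<in> {..<length mu}"
    then have i: "i < length mu" by simp
    then have "card {m \<in> ?N. g m = i} \<noteq> 0" using card_fiber pos by simp
    then have "{m \<in> ?N. g m = i} \<noteq> {}" by (rule contrapos_nn) (simp only: card.empty)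
    then obtain m where m: "m \<in> ?N" "g m = i" by blast
    then have "i = h (orbit w m)" using h by simp
    then show "i \<in> h ` ?B" using m(1) by blast
  qed
  have "card (h ` ?B) \<le> card ?B" by (rule card_image_le) simp
  then show "length mu \<le> size (cycle_type n w)" unfolding hB size_cycle_type by simp
  assume "size (cycle_type n w) = length mu"
  then have "card (h ` ?B) = card ?B" unfolding hB size_cycle_type by simp
  then have inj: "inj_on h ?B" by (rule eq_card_imp_inj_on[rotated]) simp
  have "card I = mu ! h I" if I: "I \<in> ?B" for I
  proof -
    obtain m where m: "m \<in> ?N" "I = orbit w m" using I by blast
    have "I = {z \<in> ?N. g z = h I}"
    proof (intro equalityI subsetI)
      fix z assume "z \<in> I"
      then show "z \<in> {z \<in> ?N. g z = h I}" using gorb[OF m(1)] h[OF m(1)] m(2) by simp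
    next
      fix z assume z: "z \<in> {z \<in> ?N. g z = h I}"
      then have "h (orbit w z) = h I" using h by simp
      then have "orbit w z = I" using inj I z by (auto dest: inj_onD)
      then show "z \<in> I" using self by blast
    qed
    moreover have "h I < length mu" using h gless m by simp
    ultimately show ?thesis using card_fiber by metis
  qed
  then have "cycle_type n w = image_mset (\<lambda>I. mu ! h I) (mset_set ?B)"
    unfolding cycle_type_def by (intro image_mset_cong) simp
  also have "\<dots> = image_mset (nth mu) (image_mset h (mset_set ?B))" by (simp add: image_mset.compositionality comp_def)
  also have "image_mset h (mset_set ?B) = mset_set {..<length mu}"
    unfolding hB[symmetric] by (rule image_mset_mset_set[OF inj])
  also have "image_mset (nth mu) (mset_set {..<length mu}) = mset (map (nth mu) [0..<length mu])"
    by (simp add: mset_set_upto_eq_mset_upto)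
  also have "\<dots> = mset mu" by (simp only: map_nth)
  finally show "cycle_type n w = mset mu" .
qed

lemma concat_young_blocks:
  "k \<le> length mu \<Longrightarrow>
   concat (map (\<lambda>i. [Suc (sum_list (take i mu))..<Suc (sum_list (take (Suc i) mu))]) [0..<k]) =
     [1..<Suc (sum_list (take k mu))]"
proof (induction k)
  case (Suc k)
  have "sum_list (take k mu) \<le> sum_list (take (Suc k) mu)" by (rule sum_list_take_mono) simp
  then have "[1..<Suc (sum_list (take (Suc k) mu))] = [1..<Suc (sum_list (take k mu))] @
      [Suc (sum_list (take k mu))..<Suc (sum_list (take (Suc k) mu))]"
    using upt_add_eq_append[of 1 "Suc (sum_list (take k mu))" "sum_list (take (Suc k) mu) - sum_list (take k mu)"]
    by simp
  then show ?case using Suc by simp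
qed simp

text \<open>Take the permutation that cycles each Young block. All its conjugates have the same
  sign, so the terms of the induced character cannot cancel, and the identity contributes
  one.\<close>

lemma ex_induced_sign_nonzero:
  assumes mu: "mu \<turnstile>\<^sub>p n"
  shows "\<exists>w. w permutes {1..n} \<and> cycle_type n w = mset mu \<and> induced_sign mu w \<noteq> 0"
proof -
  let ?N = "{1..n}"
  have n: "sum_list mu = n" and pos: "\<forall>k\<in>set mu. 0 < k" using mu by (simp_all add: is_partition_def)
  define row where "row i = [Suc (sum_list (take i mu))..<Suc (sum_list (take (Suc i) mu))]" for i
  define V where "V = map row [0..<length mu]"
  have set_row: "set (row i) = young_block mu i" for i
    by (auto simp: row_def young_block_def)
  have cV: "concat V = [1..<Suc n]"
    using concat_young_blocks[of "length mu" mu] n by (simp add: V_def row_def[abs_def] del: upt_Suc)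
  have tab: "tableau ?N mu V"
  proof -
    have "map length V = mu"
      by (rule nth_equalityI) (simp_all add: V_def row_def take_Suc_conv_app_nth)
    moreover have "set (concat V) = ?N" unfolding cV by auto
    moreover have "distinct (concat V)" unfolding cV by simp
    ultimately show ?thesis by (simp only: tableau_def)
  qed
  obtain w where w: "w permutes ?N" "\<forall>row\<in>set V. rotation_of w row"
    using ex_rotation_of_tableau[OF tab] by blast
  \<comment> \<open>By \<open>card_rotation_tableaux\<close> this number would be 0 for any other
    cycle type, which identifies the cycle type of \<open>w\<close>.\<close>
  have ne: "card {V. tableau ?N mu V \<and> (\<forall>row\<in>set V. rotation_of w row)} \<noteq> 0"
  proof -
    have "finite {V. tableau ?N mu V \<and> (\<forall>row\<in>set V. rotation_of w row)}"
      by (rule finite_subset[OF _ finite_tableaux[of ?N mu]]) auto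
    moreover have "V \<in> {V. tableau ?N mu V \<and> (\<forall>row\<in>set V. rotation_of w row)}" using tab w(2) by simp
    ultimately have "0 < card {V. tableau ?N mu V \<and> (\<forall>row\<in>set V. rotation_of w row)}"
      by (intro card_gt_0_iff[THEN iffD2]) blast
    then show ?thesis by (rule gr_implies_not0)
  qed
  have type: "cycle_type n w = mset mu"
  proof (rule ccontr)
    assume "cycle_type n w \<noteq> mset mu"
    then have "card {V. tableau ?N mu V \<and> (\<forall>row\<in>set V. rotation_of w row)} = 0"
      using card_rotation_tableaux[of w mu, unfolded n, OF w(1) pos] by (simp only: if_False)
    with ne show False ..
  qed
  have wH: "w \<in> young_subgroup mu"
    unfolding young_subgroup_def sym_group_carrier
  proof (intro CollectI conjI allI impI)
    show "w permutes {1..sum_list mu}" using w(1) n by simp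
    fix i assume "i < length mu"
    then have "map w (row i) = rotate1 (row i)" using w(2) by (simp add: V_def rotation_of_def)
    then have "set (map w (row i)) = set (rotate1 (row i))" by (simp only:)
    then show "w ` young_block mu i = young_block mu i" by (simp add: set_row)
  qed
  let ?X = "{x. x permutes ?N \<and> inv' x \<circ> w \<circ> x \<in> young_subgroup mu}"
  have sign: "sign (inv' x \<circ> w \<circ> x) = sign w" if "x permutes ?N" for x
  proof -
    have p: "permutation x" "permutation (inv' x)" "permutation w"
      using that w(1) permutation_permutes permutes_inv by blast+
    have "sign (inv' x \<circ> w \<circ> x) = sign (inv' x) * sign w * sign x"
      using p by (simp add: sign_compose permutation_compose)
    also have "sign (inv' x) = sign x" by (rule sign_inverse[OF p(1)])
    also have "sign x * sign w * sign x = sign w" by (simp add: sign_def)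
    finally show ?thesis .
  qed
  have fin: "finite {x. x permutes ?N}" by (rule finite_permutations) simp
  have "(\<Sum>x | x permutes ?N. if inv' x \<circ> w \<circ> x \<in> young_subgroup mu
      then of_int (sign (inv' x \<circ> w \<circ> x)) else 0) =
      (\<Sum>x | x permutes ?N. if inv' x \<circ> w \<circ> x \<in> young_subgroup mu then of_int (sign w) else (0::complex))"
    by (rule sum.cong) (simp_all add: sign)
  also have "\<dots> = (\<Sum>x\<in>?X. of_int (sign w))"
    using fin by (simp add: sum.If_cases Collect_conj_eq)
  also have "\<dots> = of_nat (card ?X) * of_int (sign w)" by simp
  finally have "induced_sign mu w = of_nat (card ?X) * of_int (sign w) / of_nat (card (young_subgroup mu))"
    using induced_sign_eq[of w mu] w(1) n by simp
  moreover have "card ?X \<noteq> 0"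
  proof -
    have "id \<in> ?X" using wH by (simp add: permutes_id)
    moreover have "finite ?X" using fin by simp
    ultimately have "0 < card ?X" by (intro card_gt_0_iff[THEN iffD2]) blast
    then show ?thesis by (rule gr_implies_not0)
  qed
  moreover have "of_int (sign w) \<noteq> (0::complex)" by (simp add: sign_def)
  ultimately have "induced_sign mu w \<noteq> 0" using card_young_subgroup_pos[of mu] by simp
  then show ?thesis using w(1) type by blast
qed

text \<open>By the refinement property the matrix of the values of the induced sign characters is
  triangular with respect to the number of cycles.\<close>

lemma class_function_expansion_aux:
  fixes \<theta> :: "(nat \<Rightarrow> nat) \<Rightarrow> complex"
  assumes "class_function n \<theta>"
    and "\<And>w. w permutes {1..n} \<Longrightarrow> size (cycle_type n w) < k \<Longrightarrow> \<theta> w = 0"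
  shows "\<exists>a. induced_sign_expansion n \<theta> a"
  using assms
\<comment> \<open>The bound \<open>k\<close> grows by one at each step; beyond \<open>n\<close>, the
  largest possible number of cycles, the function is 0.\<close>
proof (induction "Suc n - k" arbitrary: k \<theta>)
  case 0
  have "\<theta> w = 0" if w: "w permutes {1..n}" for w
  proof -
    have "size (cycle_type n w) \<le> n"
      unfolding size_cycle_type using card_image_le[of "{1..n}" "orbit w"] by simp
    then show ?thesis using 0 w by simp
  qed
  then show ?case
    by (intro exI[of _ "\<lambda>_. 0"]) (simp add: induced_sign_expansion_def sym_group_carrier)
next
  case (Suc d)
  let ?S = "{mu. mu \<turnstile>\<^sub>p n}"
  define wt where "wt mu = (SOME w. w permutes {1..n} \<and> cycle_type n w = mset mu \<and> induced_sign mu w \<noteq> 0)" for mu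
  have wt: "wt mu permutes {1..n}" "cycle_type n (wt mu) = mset mu" "induced_sign mu (wt mu) \<noteq> 0"
    if "mu \<turnstile>\<^sub>p n" for mu
    using someI_ex[OF ex_induced_sign_nonzero[OF that]] by (simp_all add: wt_def)
  \<comment> \<open>Division by the diagonal entries of the triangular matrix: subtracting this
    combination makes the function vanish on permutations with exactly \<open>k\<close>
    cycles.\<close>
  define b where "b mu = (if length mu = k then \<theta> (wt mu) / induced_sign mu (wt mu) else 0)" for mu
  define \<theta>' where "\<theta>' w = \<theta> w - (\<Sum>mu\<in>?S. b mu * induced_sign mu w)" for w
  have class_ind: "induced_sign mu w = induced_sign mu w'"
    if "mu \<in> ?S" "w permutes {1..n}" "w' permutes {1..n}" "cycle_type n w = cycle_type n w'" for mu w w'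
  proof -
    have "class_function n (induced_sign mu)"
      using class_function_induced_sign[of mu] that(1) by (simp add: is_partition_def)
    then show ?thesis by (rule class_functionD[OF _ that(2-4)])
  qed
  have "class_function n \<theta>'"
    unfolding class_function_def
  proof (intro allI impI)
    fix w w' assume *: "w permutes {1..n}" "w' permutes {1..n}" "cycle_type n w = cycle_type n w'"
    then have "\<theta> w = \<theta> w'" by (rule class_functionD[OF Suc.prems(1)])
    moreover have "(\<Sum>mu\<in>?S. b mu * induced_sign mu w) = (\<Sum>mu\<in>?S. b mu * induced_sign mu w')"
    proof (rule sum.cong[OF refl])
      fix mu assume "mu \<in> ?S"
      then have "induced_sign mu w = induced_sign mu w'" using * by (rule class_ind)
      then show "b mu * induced_sign mu w = b mu * induced_sign mu w'" by (rule arg_cong)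
    qed
    ultimately show "\<theta>' w = \<theta>' w'" by (simp add: \<theta>'_def)
  qed
  moreover have "\<theta>' w = 0" if w: "w permutes {1..n}" "size (cycle_type n w) < Suc k" for w
  proof (cases "size (cycle_type n w) = k")
    case False
    then have "size (cycle_type n w) < k" using w(2) by simp
    \<comment> \<open>Only \<open>mu\<close> with \<open>k\<close> parts have a coefficient, and
      their characters vanish on fewer than \<open>k\<close> cycles, so the earlier zeros are
      kept.\<close>
    then have "b mu * induced_sign mu w = 0" if "mu \<in> ?S" for mu
      using induced_sign_nonzero(1)[OF _ w(1), of mu] that by (auto simp: b_def)
    then have "(\<Sum>mu\<in>?S. b mu * induced_sign mu w) = 0" by (rule sum.neutral[OF ballI])
    then show ?thesis using Suc.prems(2)[OF w(1) \<open>_ < k\<close>] by (simp only: \<theta>'_def diff_zero)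
  next
    case True
    obtain lam where lam: "lam \<turnstile>\<^sub>p n" "mset lam = cycle_type n w"
      using cycle_type_partition[OF w(1)] by blast
    have len: "length lam = k" using lam(2) True by (metis size_mset)
    have "b mu * induced_sign mu w = 0" if mu: "mu \<in> ?S" "mu \<noteq> lam" for mu
    proof (rule ccontr)
      assume "b mu * induced_sign mu w \<noteq> 0"
      then have "length mu = k" "induced_sign mu w \<noteq> 0" by (auto simp: b_def split: if_splits)
      then have "cycle_type n w = mset mu" using induced_sign_nonzero(2)[OF _ w(1)] mu(1) True by simp
      then show False using partition_eqI[OF _ lam(1), of mu] mu lam(2) by simp
    qed
    then have "(\<Sum>mu\<in>?S. b mu * induced_sign mu w) = (\<Sum>mu\<in>{lam}. b mu * induced_sign mu w)"
      using finite_partitions[of n] lam(1) by (intro sum.mono_neutral_right ballI) blast+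
    also have "\<dots> = \<theta> w"
    proof -
      have "\<theta> (wt lam) = \<theta> w"
        by (rule class_functionD[OF Suc.prems(1) wt(1)[OF lam(1)] w(1)]) (simp add: wt(2)[OF lam(1)] lam(2))
      moreover have "induced_sign lam (wt lam) = induced_sign lam w"
        using class_ind[of lam "wt lam" w] wt[OF lam(1)] w(1) lam by simp
      ultimately show ?thesis using wt(3)[OF lam(1)] len by (simp add: b_def)
    qed
    finally show ?thesis by (simp only: \<theta>'_def diff_self)
  qed
  moreover have "d = Suc n - Suc k" using Suc.hyps(2) by simp
  ultimately obtain a' where a': "induced_sign_expansion n \<theta>' a'"
    using Suc.hyps(1) by blast
  have "induced_sign_expansion n \<theta> (\<lambda>mu. a' mu + b mu)"
    unfolding induced_sign_expansion_def
  proof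
    fix w assume "w \<in> carrier (sym_group n)"
    then have "\<theta>' w = (\<Sum>mu\<in>?S. a' mu * induced_sign mu w)"
      using a' by (simp add: induced_sign_expansion_def)
    then show "\<theta> w = (\<Sum>mu\<in>?S. (a' mu + b mu) * induced_sign mu w)"
      by (simp add: \<theta>'_def distrib_right sum.distrib algebra_simps)
  qed
  then show ?case by blast
qed

lemma class_function_expansion:
  "class_function n \<theta> \<Longrightarrow> \<exists>a. induced_sign_expansion n \<theta> a"
  by (rule class_function_expansion_aux[of n \<theta> 0]) simp_all

text \<open>Existence of an expansion makes the coefficients chosen by \<open>SOME\<close> genuine.
  Both sides are then the same linear combination, with \<open>coloring_count_eq_sum\<close> applied
  to each induced sign.\<close>

lemma (in labelled_poset_graph) trace_eval_eq_sum:
  assumes "class_function (card P) \<theta>"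
  shows "trace_eval \<theta> (inc P r) = (\<Sum>w | w permutes {1..card P}. \<theta> w * of_bool (no_descent w))"
proof -
  let ?n = "card P" and ?W = "{w. w permutes {1..card P}}"
  define a where "a = (SOME a. induced_sign_expansion ?n \<theta> a)"
  have a: "\<theta> w = (\<Sum>mu | mu \<turnstile>\<^sub>p ?n. a mu * induced_sign mu w)" if "w \<in> ?W" for w
    using someI_ex[OF class_function_expansion[OF assms]] that
    by (simp add: a_def induced_sign_expansion_def sym_group_carrier)
  have "trace_eval \<theta> (inc P r) = (\<Sum>mu | mu \<turnstile>\<^sub>p ?n. a mu * of_nat (coloring_count (inc P r) mu))"
  proof -
    have "pverts (inc P r) = P" by (simp add: inc_def)
    then show ?thesis by (simp only: trace_eval_def Let_def a_def)
  qed
  also have "\<dots> = (\<Sum>mu | mu \<turnstile>\<^sub>p ?n. a mu * (\<Sum>w\<in>?W. induced_sign mu w * of_bool (no_descent w)))"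
    by (rule sum.cong) (use coloring_count_eq_sum in \<open>simp_all add: is_partition_def\<close>)
  also have "\<dots> = (\<Sum>mu | mu \<turnstile>\<^sub>p ?n. \<Sum>w\<in>?W. a mu * induced_sign mu w * of_bool (no_descent w))"
    by (simp only: sum_distrib_left mult.assoc)
  also have "\<dots> = (\<Sum>w\<in>?W. \<Sum>mu | mu \<turnstile>\<^sub>p ?n. a mu * induced_sign mu w * of_bool (no_descent w))"
    by (rule sum.swap)
  also have "\<dots> = (\<Sum>w\<in>?W. \<theta> w * of_bool (no_descent w))"
    by (rule sum.cong[OF refl]) (simp only: a sum_distrib_right)
  finally show ?thesis .
qed

theorem theorem3p10:
  fixes P :: "'a set" and r :: "'a rel" and lam :: "nat list"
  assumes "finite P" and "partial_order_on P r" and "lam \<turnstile>\<^sub>p card P"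
  shows "trace_eval (power_sum_trace lam) (inc P r) =
           of_nat (card {U. tableau P lam U \<and> cyclically_row_semistrict r U})
       \<and> trace_eval (power_sum_trace lam) (inc P r) =
           of_nat (card {U. tableau P lam U \<and> record_free r U \<and> row_semistrict r U})
       \<and> trace_eval (power_sum_trace lam) (inc P r) =
           of_nat (card (based_cyclic_vertex_covers (ngr P r) lam))
       \<and> trace_eval (power_sum_trace lam) (inc P r) =
           of_nat (card (single_source_orientations P r lam))"
proof -
  obtain p where "bij_betw p {1..card P} P"
    using finite_same_card_bij[of "{1..card P}" P] assms(1) by auto
  then interpret labelled_poset_graph P r p
    using assms(1,2) by unfold_locales
  have lam: "sum_list lam = card P" "\<forall>k\<in>set lam. 0 < k"
    using assms(3) by (simp_all add: is_partition_def)
  have "class_function (card P) (power_sum_trace lam)"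
    using lam(1) by (simp add: class_function_def power_sum_trace_def)
  then have "trace_eval (power_sum_trace lam) (inc P r) =
      of_nat (card {U. tableau P lam U \<and> cyclically_row_semistrict r U})"
    using trace_eval_eq_sum sum_power_sum_trace[OF lam] by simp
  then show ?thesis
    using card_record_free_tableaux[OF lam(2)] card_based_cyclic_vertex_covers[OF lam]
      card_single_source_orientations[OF lam(2)]
    by simp
qed

end
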